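(* Let $A$ be a Noetherian integral domain, $p$ a maximal ideal of $A$, $t$ an indeterminate over $A$, and let $R:=A[t^{-1},pt,p^{(2)}t^2,\ldots,p^{(n)}t^n,\ldots]$ be the symbolic Rees algebra of $p$. Then $R$ is a stably strong S-domain (hence locally Jaffard).
   Context: For a prime ideal $p$ of a domain $A$ and $n\in\mathbb{Z}$, $p^{(n)}:=p^nA_p\cap A$ for $n\ge1$, and $p^{(n)}=A$ for $n\leq 0$. The symbolic Rees algebra of $p$ is $\bigoplus_{n\in\mathbb{Z}}p^{(n)}t^n\subseteq A[t,t^{-1}]$. A domain $S$ is an S-domain if for each height-one prime ideal $P$ of $S$ the extension $P[X]$ to the polynomial ring $S[X]$ in one variable also has height $1$. A ring $S$ is a strong S-ring if $S/P$ is an S-domain for every prime ideal $P$ of $S$; a strong S-domain is a domain that is a strong S-ring. A domain $S$ is a stably strong S-domain if $S[X_1,\ldots,X_n]$ is a strong S-ring for each positive integer $n$. A finite-dimensional domain $S$ is Jaffard if $\dim(S[X_1,\ldots,X_n])=n+\dim(S)$ for all $n\geq 1$ or, equivalently, if its Krull dimension $\dim(S)$ equals its valuative dimension $\dim_v(S)$ (the supremum of the dimensions of the valuation overrings of $S$). A domain $S$ is locally Jaffard if $S_P$ is Jaffard for each prime ideal $P$ of $S$. *)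

theory Defs
  imports
    "HOL-Algebra.UnivPoly"
    "HOL-Algebra.Ideal_Product"
    "HOL-Algebra.Ring_Divisibility"
    "HOL-Library.Multiset"
    "HOL-Library.Extended_Nat"
begin

section \<open>Height and Krull dimension\<close>

definition prime_chain :: "('a, 'b) ring_scheme \<Rightarrow> (nat \<Rightarrow> 'a set) \<Rightarrow> nat \<Rightarrow> bool" where
  "prime_chain R c n \<longleftrightarrow> (\<forall>i\<le>n. primeideal (c i) R) \<and> (\<forall>i<n. c i \<subset> c (Suc i))"

definition height :: "('a, 'b) ring_scheme \<Rightarrow> 'a set \<Rightarrow> enat" where
  "height R P = Sup {enat n |n. \<exists>c. prime_chain R c n \<and> c n = P}"

definition krull_dim :: "('a, 'b) ring_scheme \<Rightarrow> enat" where
  "krull_dim R = Sup {enat n |n. \<exists>c. prime_chain R c n}"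


section \<open>Localization at a prime ideal\<close>

text \<open>The library has no localization of a ring record.  A fraction is the class of a pair
  (numerator, denominator) under the usual relation, with denominators outside \<open>P\<close>.\<close>

definition frac_rel :: "('a, 'b) ring_scheme \<Rightarrow> 'a set \<Rightarrow> (('a \<times> 'a) \<times> ('a \<times> 'a)) set" where
  "frac_rel R P = {((a, s), (b, u)).
     a \<in> carrier R \<and> b \<in> carrier R \<and> s \<in> carrier R - P \<and> u \<in> carrier R - P \<and>
     (\<exists>w \<in> carrier R - P. w \<otimes>\<^bsub>R\<^esub> (a \<otimes>\<^bsub>R\<^esub> u) = w \<otimes>\<^bsub>R\<^esub> (b \<otimes>\<^bsub>R\<^esub> s))}"

definition loc_frac :: "('a, 'b) ring_scheme \<Rightarrow> 'a set \<Rightarrow> 'a \<Rightarrow> 'a \<Rightarrow> ('a \<times> 'a) set" where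
  "loc_frac R P a s = frac_rel R P `` {(a, s)}"

definition localization :: "('a, 'b) ring_scheme \<Rightarrow> 'a set \<Rightarrow> ('a \<times> 'a) set ring" where
  "localization R P = \<lparr>
     carrier = (carrier R \<times> (carrier R - P)) // frac_rel R P,
     monoid.mult = (\<lambda>X Y. \<Union>(a, s)\<in>X. \<Union>(b, u)\<in>Y. loc_frac R P (a \<otimes>\<^bsub>R\<^esub> b) (s \<otimes>\<^bsub>R\<^esub> u)),
     one = loc_frac R P \<one>\<^bsub>R\<^esub> \<one>\<^bsub>R\<^esub>,
     zero = loc_frac R P \<zero>\<^bsub>R\<^esub> \<one>\<^bsub>R\<^esub>,
     add = (\<lambda>X Y. \<Union>(a, s)\<in>X. \<Union>(b, u)\<in>Y.
              loc_frac R P ((a \<otimes>\<^bsub>R\<^esub> u) \<oplus>\<^bsub>R\<^esub> (b \<otimes>\<^bsub>R\<^esub> s)) (s \<otimes>\<^bsub>R\<^esub> u))\<rparr>"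


section \<open>Polynomials in several variables and Laurent polynomials\<close>

text \<open>The monoid ring of a submonoid \<open>M\<close> of the additive monoid \<open>'m\<close>: an element is its
  coefficient function.  In the product, only the finitely many pairs of exponents with nonzero
  coefficients are summed over, since \<^const>\<open>finsum\<close> is trivial on infinite sets.\<close>

definition monoid_ring ::
    "('a, 'b) ring_scheme \<Rightarrow> 'm::comm_monoid_add set \<Rightarrow> ('m \<Rightarrow> 'a) ring" where
  "monoid_ring R M = \<lparr>
     carrier = {f. (\<forall>m. f m \<in> carrier R) \<and> (\<forall>m. m \<notin> M \<longrightarrow> f m = \<zero>\<^bsub>R\<^esub>) \<and>
                   finite {m. f m \<noteq> \<zero>\<^bsub>R\<^esub>}},
     monoid.mult = (\<lambda>f g m. finsum R (\<lambda>(i, j). f i \<otimes>\<^bsub>R\<^esub> g j)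
               {(i, j). f i \<noteq> \<zero>\<^bsub>R\<^esub> \<and> g j \<noteq> \<zero>\<^bsub>R\<^esub> \<and> i + j = m}),
     one = (\<lambda>m. if m = 0 then \<one>\<^bsub>R\<^esub> else \<zero>\<^bsub>R\<^esub>),
     zero = (\<lambda>m. \<zero>\<^bsub>R\<^esub>),
     add = (\<lambda>f g m. f m \<oplus>\<^bsub>R\<^esub> g m)\<rparr>"

text \<open>Monomials in \<open>X\<^sub>0, \<dots>, X\<^sub>n\<^sub>-\<^sub>1\<close> are multisets of variable indices.\<close>

definition mpoly_ring :: "nat \<Rightarrow> ('a, 'b) ring_scheme \<Rightarrow> (nat multiset \<Rightarrow> 'a) ring" where
  "mpoly_ring n R = monoid_ring R {m. set_mset m \<subseteq> {..<n}}"

definition laurent_ring :: "('a, 'b) ring_scheme \<Rightarrow> (int \<Rightarrow> 'a) ring" where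
  "laurent_ring R = monoid_ring R UNIV"


section \<open>Symbolic Rees algebra\<close>

text \<open>\<open>p\<^sup>n A\<^sub>p\<close> is the ideal of \<open>A\<^sub>p\<close> generated by the fractions \<open>x / 1\<close> with \<open>x \<in> p\<^sup>n\<close>; intersecting
  with \<open>A\<close> is taking the preimage under \<open>a \<mapsto> a / 1\<close>.  The power \<open>p\<^sup>n\<close> is taken in the monoid of
  ideals of \<open>A\<close> under the product of ideals.\<close>

definition symbolic_power :: "('a, 'b) ring_scheme \<Rightarrow> 'a set \<Rightarrow> int \<Rightarrow> 'a set" where
  "symbolic_power A p n =
     (if n \<ge> 1
      then {a \<in> carrier A. loc_frac A p a \<one>\<^bsub>A\<^esub> \<in>
              genideal (localization A p)
                ((\<lambda>x. loc_frac A p x \<one>\<^bsub>A\<^esub>) ` (p [^]\<^bsub>ideals_set A\<^esub> nat n))}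
      else carrier A)"

text \<open>\<open>\<Oplus>\<^sub>n p\<^sup>(\<^sup>n\<^sup>) t\<^sup>n\<close> as a subring of \<open>A[t, t\<^sup>-\<^sup>1]\<close>, with \<open>f n\<close> the coefficient of \<open>t\<^sup>n\<close> in \<open>f\<close>.\<close>

definition symbolic_Rees_algebra :: "('a, 'b) ring_scheme \<Rightarrow> 'a set \<Rightarrow> (int \<Rightarrow> 'a) ring" where
  "symbolic_Rees_algebra A p = (laurent_ring A)
     \<lparr>carrier := {f \<in> carrier (laurent_ring A). \<forall>n. f n \<in> symbolic_power A p n}\<rparr>"


section \<open>S-domains and Jaffard domains\<close>

text \<open>The ideal \<open>P[X]\<close> of polynomials with all coefficients in \<open>P\<close>.\<close>

definition poly_extension :: "('a, 'b) ring_scheme \<Rightarrow> 'a set \<Rightarrow> (nat \<Rightarrow> 'a) set" where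
  "poly_extension S P = {f \<in> carrier (UP S). \<forall>n. coeff (UP S) f n \<in> P}"

definition S_domain :: "('a, 'b) ring_scheme \<Rightarrow> bool" where
  "S_domain S \<longleftrightarrow> domain S \<and>
     (\<forall>P. primeideal P S \<and> height S P = 1 \<longrightarrow> height (UP S) (poly_extension S P) = 1)"

definition strong_S_ring :: "('a, 'b) ring_scheme \<Rightarrow> bool" where
  "strong_S_ring S \<longleftrightarrow> cring S \<and> (\<forall>P. primeideal P S \<longrightarrow> S_domain (S Quot P))"

definition stably_strong_S_domain :: "('a, 'b) ring_scheme \<Rightarrow> bool" where
  "stably_strong_S_domain S \<longleftrightarrow> domain S \<and> (\<forall>n\<ge>1. strong_S_ring (mpoly_ring n S))"

definition Jaffard :: "('a, 'b) ring_scheme \<Rightarrow> bool" where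
  "Jaffard S \<longleftrightarrow> domain S \<and> krull_dim S \<noteq> \<infinity> \<and>
     (\<forall>n\<ge>1. krull_dim (mpoly_ring n S) = enat n + krull_dim S)"

definition locally_Jaffard :: "('a, 'b) ring_scheme \<Rightarrow> bool" where
  "locally_Jaffard S \<longleftrightarrow> domain S \<and> (\<forall>P. primeideal P S \<longrightarrow> Jaffard (localization S P))"

end

(* Since p is maximal, p^n is p-primary, so the symbolic powers of p are its ordinary powers and R is
   the extended Rees algebra A[t^-1, pt].  It is generated over A by t^-1 and the a t with a in a finite
   generating set of p, hence Noetherian by Hilbert's basis theorem, and everything follows from facts
   about Noetherian domains.  All of these are reduced to a consequence of Krull's principal ideal
   theorem: in a chain c 0 < ... < c n of primes of a Noetherian ring (n > 0), with x in c n, the primes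
   strictly between the ends can be replaced so that x lies in c 1.  Applied to generators of c n this
   bounds heights; applied in S[X] to a constant of a height-one prime P it shows that P[X] has height
   one; applied in S[X] to constants that do not lie in c 0, together with the fact that no three
   primes of a chain of S[X] have the same contraction to S, it gives dim S[X] = dim S + 1. *)
theory Submission
  imports Defs "HOL-Algebra.Subrings"
begin

section \<open>Saturated ideals and the principal ideal theorem\<close>

text \<open>The principal ideal theorem is needed in \<open>R / Q0\<close> localized at
  \<open>P\<close>. Neither the quotient nor the localization is formed: the ideals of that ring
  correspond to the \<open>P\<close>-saturated ideals of \<open>R\<close> that contain
  \<open>Q0\<close>, so the argument is one about ideals of \<open>R\<close>. Nakayama's lemma and
  the descending chain condition come from maximal elements of families of saturated ideals, without
  modules or length.

  Shifting an element down a chain keeps both ends fixed. This is why it can be iterated: after a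
  shift the bottom prime is dropped, and the tail still ends at the same prime. The usual identity
  \<open>height P[X] = height P\<close> is thereby avoided in the dimension formula: the interior of
  a chain of \<open>S[X]\<close> is replaced until at most one of its links is lost on contraction
  to \<open>S\<close>.

  The symbolic powers are ordinary powers because an element outside a maximal \<open>p\<close> is
  comaximal with every \<open>p^n\<close>. For a prime ideal in general, the symbolic Rees algebra
  need not be Noetherian.\<close>

locale noetherian_cring = noetherian_ring + cring

lemma (in noetherian_domain) is_noetherian_cring: "noetherian_cring R"
  by (intro noetherian_cring.intro noetherian_ring_axioms cring_axioms)

text \<open>Zorn's lemma applies because a nonempty chain of ideals of a Noetherian ring contains
  its own union. Nakayama's lemma, associated primes and the descending chain condition are all
  drawn from this form of the Noetherian property.\<close>

lemma (in noetherian_ring) exists_maximal_ideal_in: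
  assumes "\<And>I. I \<in> S \<Longrightarrow> ideal I R" and "I0 \<in> S"
  obtains M where "M \<in> S" "\<And>J. J \<in> S \<Longrightarrow> M \<subseteq> J \<Longrightarrow> J = M"
proof -
  have "\<exists>M\<in>S. \<forall>X\<in>S. M \<subseteq> X \<longrightarrow> X = M"
  proof (rule subset_Zorn)
    fix C assume C: "subset.chain S C"
    show "\<exists>U\<in>S. \<forall>X\<in>C. X \<subseteq> U"
    proof (cases "C = {}")
      case False
      have "subset.chain {I. ideal I R} C"
        using C assms(1) unfolding pred_on.chain_def by blast
      from ideal_chain_is_trivial[OF False this] have "\<Union>C \<in> C" .
      then show ?thesis using C by (intro bexI[of _ "\<Union>C"]) (auto simp: pred_on.chain_def)
    qed (use assms(2) in auto)
  qed
  then show thesis using that by blast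
qed

lemma (in cring) idealI_cring:
  assumes "I \<subseteq> carrier R" "\<zero> \<in> I" "\<And>a b. a \<in> I \<Longrightarrow> b \<in> I \<Longrightarrow> a \<oplus> b \<in> I"
    "\<And>a x. a \<in> I \<Longrightarrow> x \<in> carrier R \<Longrightarrow> x \<otimes> a \<in> I"
  shows "ideal I R"
proof (rule idealI)
  show "subgroup I (add_monoid R)"
  proof (rule add.subgroupI)
    show "I \<subseteq> carrier R" "I \<noteq> {}" using assms by auto
    fix a assume a: "a \<in> I"
    then have "\<ominus> a = (\<ominus> \<one>) \<otimes> a" using assms(1) by (auto simp: l_minus)
    then show "\<ominus> a \<in> I" using assms(4)[OF a] by simp
  qed (use assms in auto)
  fix a x assume ax: "a \<in> I" "x \<in> carrier R"
  show "x \<otimes> a \<in> I" using ax assms by auto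
  show "a \<otimes> x \<in> I" using ax assms m_comm by (metis subsetD)
qed (rule ring_axioms)

lemma (in ring) minus_add_self: "a \<in> carrier R \<Longrightarrow> b \<in> carrier R \<Longrightarrow> (a \<ominus> b) \<oplus> b = a"
  by (simp add: a_minus_def a_assoc l_neg)

lemma (in ideal) minus_closed: "a \<in> I \<Longrightarrow> b \<in> I \<Longrightarrow> a \<ominus> b \<in> I"
  by (simp add: a_minus_def)

lemma (in primeideal) one_notin: "\<one> \<notin> I"
  using I_notcarr one_imp_carrier by auto

lemma (in primeideal) pow_notin:
  assumes "a \<in> carrier R" "a \<notin> I" shows "a [^] (n::nat) \<notin> I"
proof (induct n)
  case (Suc n)
  then show ?case using I_prime[of "a [^] n" a] assms by auto
qed (use one_notin in simp)

lemma set_add_memI: "j \<in> J \<Longrightarrow> k \<in> K \<Longrightarrow> x = j \<oplus>\<^bsub>R\<^esub> k \<Longrightarrow> x \<in> J <+>\<^bsub>R\<^esub> K"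
  by (auto simp: set_add_def set_mult_def)

text \<open>For a prime \<open>P\<close> and an ideal \<open>I\<close> this is the contraction to
  \<open>R\<close> of the extension of \<open>I\<close> to the localization at \<open>P\<close>,
  written without fractions.\<close>

definition saturation :: "('a, 'b) ring_scheme \<Rightarrow> 'a set \<Rightarrow> 'a set \<Rightarrow> 'a set" where
  "saturation R P I = {v \<in> carrier R. \<exists>s \<in> carrier R - P. s \<otimes>\<^bsub>R\<^esub> v \<in> I}"

lemma (in cring) saturation_ideal:
  assumes "primeideal P R" "ideal I R"
  shows "ideal (saturation R P I) R"
proof -
  interpret P: primeideal P R by fact
  interpret I: ideal I R by fact
  show ?thesis
  proof (rule idealI_cring)
    show "\<zero> \<in> saturation R P I" using P.one_notin by (auto simp: saturation_def intro!: bexI[of _ \<one>])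
    fix a b assume "a \<in> saturation R P I" "b \<in> saturation R P I"
    then obtain s t where s: "s \<in> carrier R - P" "s \<otimes> a \<in> I" "t \<in> carrier R - P" "t \<otimes> b \<in> I"
        and ab: "a \<in> carrier R" "b \<in> carrier R"
      unfolding saturation_def by blast
    have "(s \<otimes> t) \<otimes> (a \<oplus> b) = t \<otimes> (s \<otimes> a) \<oplus> s \<otimes> (t \<otimes> b)"
      using s ab by (simp add: r_distr m_ac)
    then have "(s \<otimes> t) \<otimes> (a \<oplus> b) \<in> I" using s I.I_l_closed by auto
    moreover have "s \<otimes> t \<in> carrier R - P" using s P.I_prime by auto
    ultimately show "a \<oplus> b \<in> saturation R P I" using ab unfolding saturation_def by blast
  next
    fix a x assume "a \<in> saturation R P I" and x: "x \<in> carrier R"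
    then obtain s where s: "s \<in> carrier R - P" "s \<otimes> a \<in> I" and ab: "a \<in> carrier R"
      unfolding saturation_def by blast
    have "s \<otimes> (x \<otimes> a) = x \<otimes> (s \<otimes> a)" using s x ab by (simp add: m_ac)
    then have "s \<otimes> (x \<otimes> a) \<in> I" using s x I.I_l_closed by auto
    then show "x \<otimes> a \<in> saturation R P I" using ab s x unfolding saturation_def by blast
  qed (auto simp: saturation_def)
qed

lemma (in cring) saturation_incl:
  assumes "primeideal P R" "ideal I R" shows "I \<subseteq> saturation R P I"
proof -
  interpret P: primeideal P R by fact
  interpret I: ideal I R by fact
  show ?thesis using P.one_notin I.Icarr unfolding saturation_def
    by (force intro!: bexI[of _ \<one>])
qed

lemma (in cring) saturation_saturation:
  assumes "primeideal P R" "ideal I R" 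
  shows "saturation R P (saturation R P I) = saturation R P I"
proof -
  interpret P: primeideal P R by fact
  show ?thesis
  proof
    show "saturation R P I \<subseteq> saturation R P (saturation R P I)"
      by (intro saturation_incl saturation_ideal assms)
    show "saturation R P (saturation R P I) \<subseteq> saturation R P I"
    proof
      fix v assume "v \<in> saturation R P (saturation R P I)"
      then obtain s t where "v \<in> carrier R" "s \<in> carrier R - P" "t \<in> carrier R - P" "t \<otimes> (s \<otimes> v) \<in> I"
        unfolding saturation_def by blast
      then show "v \<in> saturation R P I" using P.I_prime unfolding saturation_def
        by (auto intro!: bexI[of _ "t \<otimes> s"] simp: m_assoc)
    qed
  qed
qed

lemma saturation_mono: "I \<subseteq> J \<Longrightarrow> saturation R P I \<subseteq> saturation R P J"
  unfolding saturation_def by blast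

lemma saturation_antimono: "Q \<subseteq> P \<Longrightarrow> saturation R P I \<subseteq> saturation R Q I"
  unfolding saturation_def by blast

lemma saturationD:
  "saturation R P I = I \<Longrightarrow> s \<in> carrier R \<Longrightarrow> s \<notin> P \<Longrightarrow> v \<in> carrier R \<Longrightarrow> s \<otimes>\<^bsub>R\<^esub> v \<in> I \<Longrightarrow> v \<in> I"
  unfolding saturation_def by blast

lemma (in cring) saturation_prime:
  assumes "primeideal Q R" "Q \<subseteq> P" "primeideal P R" shows "saturation R P Q = Q"
proof -
  interpret Q: primeideal Q R by fact
  have "saturation R P Q \<subseteq> Q" using Q.I_prime assms unfolding saturation_def by blast
  then show ?thesis using saturation_incl[OF assms(3) Q.is_ideal] by auto
qed

text \<open>Nakayama's lemma in the localization at \<open>P\<close>.  Ideals of \<open>R\<^sub>P\<close> are represented by the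
  \<open>P\<close>-saturated ideals of \<open>R\<close>.\<close>

lemma (in noetherian_cring) nakayama_saturated:
  assumes P: "primeideal P R" and M: "ideal M R" "saturation R P M = M"
    and N: "ideal N R" "saturation R P N = N" "N \<subseteq> M"
    and PM: "M \<subseteq> saturation R P (Idl (N \<union> {q \<otimes> w | q w. q \<in> P \<and> w \<in> M}))"
  shows "M = N"
proof (rule ccontr)
  assume "M \<noteq> N"
  interpret P: primeideal P R by fact
  interpret M: ideal M R by fact
  \<comment> \<open>A maximal \<open>J\<close> in this family makes \<open>M / J\<close> simple
    after localization at \<open>P\<close>; the aim is to show that \<open>P\<close> annihilates
    it.\<close>
  define S where "S = {J. ideal J R \<and> saturation R P J = J \<and> N \<subseteq> J \<and> J \<subset> M}"
  have NS: "N \<in> S" using N M \<open>M \<noteq> N\<close> unfolding S_def by auto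
  obtain J where J: "J \<in> S" and max: "\<And>K. K \<in> S \<Longrightarrow> J \<subseteq> K \<Longrightarrow> K = J"
    by (rule exists_maximal_ideal_in[OF _ NS]) (simp add: S_def, blast)
  interpret J: ideal J R using J unfolding S_def by auto
  have Jsat: "saturation R P J = J" and JM: "J \<subset> M" and NJ: "N \<subseteq> J" using J unfolding S_def by auto
  then obtain z where z: "z \<in> M" "z \<notin> J" by auto
  have zc: "z \<in> carrier R" using z M.Icarr by auto
  have key: "saturation R P (J <+> K) = J \<or> saturation R P (J <+> K) = M" if K: "ideal K R" "K \<subseteq> M" for K
  proof -
    interpret K: ideal K R by fact
    have id: "ideal (J <+> K) R" by (rule add_ideals[OF J.is_ideal K(1)])
    have "J <+> K \<subseteq> M" using JM K(2) unfolding set_add_defs by auto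
    then have 1: "saturation R P (J <+> K) \<subseteq> M" using saturation_mono M(2) by metis
    have "J \<subseteq> J <+> K"
    proof
      fix j assume "j \<in> J"
      then show "j \<in> J <+> K" using J.Icarr
        by (intro set_add_memI[of j _ \<zero>]) auto
    qed
    then have 2: "J \<subseteq> saturation R P (J <+> K)" using saturation_incl[OF P id] by auto
    have "saturation R P (saturation R P (J <+> K)) = saturation R P (J <+> K)"
      by (rule saturation_saturation[OF P id])
    then show ?thesis using max[of "saturation R P (J <+> K)"] 1 2 NJ saturation_ideal[OF P id]
      unfolding S_def by blast
  qed
  have "PIdl z \<subseteq> M" using cgenideal_minimal M.is_ideal z by blast
  moreover have "z \<in> saturation R P (J <+> PIdl z)"
  proof -
    have "z \<in> J <+> PIdl z"
      using cgenideal_self[OF zc] zc by (intro set_add_memI[of \<zero> _ z]) auto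
    then show ?thesis using saturation_incl[OF P add_ideals[OF J.is_ideal cgenideal_ideal[OF zc]]] by auto
  qed
  ultimately have sM: "saturation R P (J <+> PIdl z) = M"
    using key[OF cgenideal_ideal[OF zc]] z by auto
  let ?K = "{q \<otimes> z | q. q \<in> P}"
  have K: "ideal ?K R"
  proof (rule idealI_cring)
    show "\<zero> \<in> ?K" using zc by (auto intro!: exI[of _ \<zero>])
    fix a b assume "a \<in> ?K" "b \<in> ?K"
    then obtain q r where "a = q \<otimes> z" "b = r \<otimes> z" "q \<in> P" "r \<in> P" by blast
    then show "a \<oplus> b \<in> ?K" using zc by (auto intro!: exI[of _ "q \<oplus> r"] simp: l_distr P.Icarr)
  next
    fix a x assume "a \<in> ?K" "x \<in> carrier R"
    then show "x \<otimes> a \<in> ?K" using zc P.I_l_closed by (force simp: P.Icarr m_assoc)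
  qed (use zc P.Icarr in auto)
  \<comment> \<open>The other possibility gives \<open>s z = j + q z\<close> with \<open>s\<close>
    outside \<open>P\<close> and \<open>q\<close> in \<open>P\<close>. Then \<open>s - q\<close> is
    outside \<open>P\<close> as well, and \<open>z\<close> falls into \<open>J\<close>.\<close>
  have "saturation R P (J <+> ?K) = J"
  proof (rule ccontr)
    assume "saturation R P (J <+> ?K) \<noteq> J"
    moreover have "?K \<subseteq> M" using z M.I_l_closed P.Icarr by blast
    ultimately have "saturation R P (J <+> ?K) = M" using key[OF K] by blast
    then have "z \<in> saturation R P (J <+> ?K)" using z by blast
    then obtain s j q where s: "s \<in> carrier R" "s \<notin> P" "j \<in> J" "q \<in> P" and eq: "s \<otimes> z = j \<oplus> q \<otimes> z"
      unfolding saturation_def set_add_defs by auto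
    have qc: "q \<in> carrier R" using s P.Icarr by auto
    have "(s \<ominus> q) \<otimes> z = s \<otimes> z \<ominus> q \<otimes> z" using s qc zc by (simp add: l_distr l_minus a_minus_def)
    also have "\<dots> = j" using eq s qc zc J.Icarr by (simp add: a_minus_def a_assoc r_neg)
    finally have "(s \<ominus> q) \<otimes> z \<in> J" using s by simp
    moreover have "s \<ominus> q \<notin> P"
    proof
      assume "s \<ominus> q \<in> P"
      then have "(s \<ominus> q) \<oplus> q \<in> P" using s by auto
      moreover have "(s \<ominus> q) \<oplus> q = s" using s qc by (simp add: a_minus_def a_assoc l_neg)
      ultimately show False using s by simp
    qed
    ultimately show False using saturationD[OF Jsat, of "s \<ominus> q" z] s qc zc z by auto
  qed
  then have PzJ: "q \<otimes> z \<in> J" if "q \<in> P" for q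
  proof -
    have "q \<otimes> z \<in> J <+> ?K" using that P.Icarr zc
      by (intro set_add_memI[of \<zero> _ "q \<otimes> z"]) auto
    then show ?thesis using saturation_incl[OF P add_ideals[OF J.is_ideal K]]
      \<open>saturation R P (J <+> ?K) = J\<close> by auto
  qed
  \<comment> \<open>Locally \<open>M\<close> is \<open>J + (z)\<close>, so
    \<open>P z \<subseteq> J\<close> gives \<open>P M \<subseteq> J\<close>, and the hypothesis
    \<open>PM\<close> then places all of \<open>M\<close> inside the saturated ideal
    \<open>J\<close>.\<close>
  have "q \<otimes> w \<in> J" if q: "q \<in> P" and w: "w \<in> M" for q w
  proof -
    have "w \<in> saturation R P (J <+> PIdl z)" using sM w by simp
    then obtain s j r where s: "s \<in> carrier R" "s \<notin> P" "j \<in> J" "r \<in> carrier R" and eq: "s \<otimes> w = j \<oplus> r \<otimes> z"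
      unfolding saturation_def set_add_defs cgenideal_def by auto
    have c: "q \<in> carrier R" "w \<in> carrier R" "j \<in> carrier R" using q w s P.Icarr M.Icarr J.Icarr by auto
    have "s \<otimes> (q \<otimes> w) = q \<otimes> (s \<otimes> w)" using s c by (simp add: m_ac)
    also have "\<dots> = q \<otimes> j \<oplus> r \<otimes> (q \<otimes> z)" using s c zc unfolding eq by (simp add: r_distr m_ac)
    finally have "s \<otimes> (q \<otimes> w) \<in> J" using s c PzJ[OF q] J.I_l_closed by auto
    then show ?thesis using saturationD[OF Jsat, of s "q \<otimes> w"] s c by auto
  qed
  then have "Idl (N \<union> {q \<otimes> w | q w. q \<in> P \<and> w \<in> M}) \<subseteq> J"
    using NJ by (intro genideal_minimal J.is_ideal) auto
  from subset_trans[OF PM saturation_mono[OF this]] have "M \<subseteq> J" unfolding Jsat .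
  then show False using JM by auto
qed

text \<open>A maximal ideal among the \<open>(J : z)\<close> with \<open>z\<close> outside
  \<open>J\<close> is prime: if \<open>b z\<close> is not in \<open>J\<close>, then
  \<open>(J : b z)\<close> belongs to the same family and contains \<open>(J : z)\<close>, hence
  equals it, and \<open>a b z \<in> J\<close> says that \<open>a\<close> lies in
  \<open>(J : b z)\<close>.\<close>

lemma (in noetherian_cring) associated_prime:
  assumes J: "ideal J R" and "J \<noteq> carrier R"
  obtains z where "z \<in> carrier R" "z \<notin> J" "primeideal {r \<in> carrier R. r \<otimes> z \<in> J} R"
proof -
  interpret J: ideal J R by fact
  define ann where "ann z = {r \<in> carrier R. r \<otimes> z \<in> J}" for z
  have id: "ideal (ann z) R" if z: "z \<in> carrier R" for z
  proof (rule idealI_cring)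
    show "\<zero> \<in> ann z" using z by (simp add: ann_def)
    fix a b assume "a \<in> ann z" "b \<in> ann z"
    then show "a \<oplus> b \<in> ann z" using z by (simp add: ann_def l_distr)
  next
    fix a x assume "a \<in> ann z" "x \<in> carrier R"
    then show "x \<otimes> a \<in> ann z" using z J.I_l_closed by (simp add: ann_def m_assoc)
  qed (simp add: ann_def)
  obtain y where y: "y \<in> carrier R" "y \<notin> J" using assms J.Icarr by blast
  define S where "S = ann ` (carrier R - J)"
  have S: "\<And>I. I \<in> S \<Longrightarrow> ideal I R" "ann y \<in> S" using id y unfolding S_def by auto
  obtain M where M: "M \<in> S" and max: "\<And>K. K \<in> S \<Longrightarrow> M \<subseteq> K \<Longrightarrow> K = M"
    by (rule exists_maximal_ideal_in[OF S]) auto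
  obtain z where z: "z \<in> carrier R" "z \<notin> J" "M = ann z" using M unfolding S_def by auto
  have "primeideal (ann z) R"
  proof (rule primeidealI[OF id[OF z(1)] is_cring])
    have "\<one> \<notin> ann z" using z by (simp add: ann_def)
    then show "carrier R \<noteq> ann z" by auto
    fix a b assume ab: "a \<in> carrier R" "b \<in> carrier R" "a \<otimes> b \<in> ann z"
    show "a \<in> ann z \<or> b \<in> ann z"
    proof (cases "b \<otimes> z \<in> J")
      case False
      then have "ann (b \<otimes> z) \<in> S" using ab z unfolding S_def by auto
      moreover have "ann z \<subseteq> ann (b \<otimes> z)"
      proof
        fix r assume r: "r \<in> ann z"
        then have "r \<otimes> (b \<otimes> z) = b \<otimes> (r \<otimes> z)" using ab z by (simp add: ann_def m_ac)
        then show "r \<in> ann (b \<otimes> z)" using r ab J.I_l_closed by (simp add: ann_def)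
      qed
      ultimately have "ann (b \<otimes> z) = ann z" using max z by auto
      moreover have "a \<in> ann (b \<otimes> z)" using ab z by (simp add: ann_def m_assoc)
      ultimately show ?thesis by auto
    qed (use ab in \<open>simp add: ann_def\<close>)
  qed
  then show thesis using that z unfolding ann_def by blast
qed

lemma set_add_memE:
  assumes "x \<in> J <+>\<^bsub>R\<^esub> K" obtains j k where "j \<in> J" "k \<in> K" "x = j \<oplus>\<^bsub>R\<^esub> k"
  using assms by (auto simp: set_add_def set_mult_def)

text \<open>If \<open>P\<close> is minimal over \<open>K\<close>, then \<open>(R/K)\<^sub>P\<close> is Artinian.\<close>

lemma (in noetherian_cring) dcc_saturated:
  assumes P: "primeideal P R" and K: "ideal K R" 
    and min: "\<And>P'. primeideal P' R \<Longrightarrow> K \<subseteq> P' \<Longrightarrow> P' \<subseteq> P \<Longrightarrow> P' = P"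
    and I: "\<And>n. ideal (I n) R" "\<And>n. saturation R P (I n) = I n" "\<And>n. K \<subseteq> I n"
      "\<And>n. I (Suc n) \<subseteq> I n"
  shows "\<exists>n. I (Suc n) = I n"
proof -
  interpret P: primeideal P R by fact
  have dec: "I m \<subseteq> I n" if "n \<le> m" for n m
    using lift_Suc_antimono_le[of I n m] I(4) that by blast
  \<comment> \<open>These are the ideals on which the traces of the sequence become stationary. The
    sequence itself is stationary once \<open>carrier R\<close> is shown to be the maximal
    member.\<close>
  define S where "S = {J. ideal J R \<and> saturation R P J = J \<and> K \<subseteq> J \<and> (\<exists>N. \<forall>m\<ge>N. I m \<inter> J = I N \<inter> J)}"
  have "saturation R P K \<subseteq> I n" for n using saturation_mono[OF I(3)[of n], of R P] unfolding I(2) .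
  then have "I m \<inter> saturation R P K = saturation R P K" for m by auto
  then have KS: "saturation R P K \<in> S"
    unfolding S_def using saturation_ideal[OF P K] saturation_saturation[OF P K] saturation_incl[OF P K]
    by auto
  have Sid: "\<And>J. J \<in> S \<Longrightarrow> ideal J R" unfolding S_def by auto
  obtain J where J: "J \<in> S" and max: "\<And>L. L \<in> S \<Longrightarrow> J \<subseteq> L \<Longrightarrow> L = J"
    by (rule exists_maximal_ideal_in[OF Sid KS]) auto
  have Jid: "ideal J R" and Jsat: "saturation R P J = J" and KJ: "K \<subseteq> J" using J unfolding S_def by auto
  obtain N where N: "\<And>m. m \<ge> N \<Longrightarrow> I m \<inter> J = I N \<inter> J" using J unfolding S_def by auto
  interpret J: ideal J R by fact
  show ?thesis
  proof (cases "J = carrier R")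
    case True
    have "I n \<inter> J = I n" for n using ideal.Icarr[OF I(1)] True by auto
    then show ?thesis using N[of "Suc N"] by auto
  next
    case False
    obtain z where z: "z \<in> carrier R" "z \<notin> J" and pr: "primeideal {r \<in> carrier R. r \<otimes> z \<in> J} R"
      using associated_prime[OF Jid False] .
    \<comment> \<open>The prime \<open>(J : z)\<close> contains \<open>K\<close>, and it lies in
      \<open>P\<close> because \<open>J\<close> is saturated; minimality makes it \<open>P\<close>.
      So \<open>(J + (z)) / J\<close> becomes, at \<open>P\<close>, a line over the residue
      field.\<close>
    have "{r \<in> carrier R. r \<otimes> z \<in> J} = P"
    proof (rule min[OF pr])
      show "K \<subseteq> {r \<in> carrier R. r \<otimes> z \<in> J}"
        using KJ J.Icarr J.I_r_closed z by auto
      show "{r \<in> carrier R. r \<otimes> z \<in> J} \<subseteq> P" using saturationD[OF Jsat _ _ z(1)] z(2) by auto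
    qed
    then have Pz: "q \<otimes> z \<in> J" if "q \<in> P" for q using that by auto
    define L where "L = saturation R P (J <+> PIdl z)"
    have id: "ideal (J <+> PIdl z) R" by (intro add_ideals Jid cgenideal_ideal z)
    have L: "ideal L R" "saturation R P L = L" unfolding L_def
      by (intro saturation_ideal P id saturation_saturation)+
    interpret L: ideal L R by fact
    have JL: "J \<subseteq> L"
    proof
      fix j assume j: "j \<in> J"
      have "\<zero> \<in> PIdl z" using cgenideal_ideal[OF z(1)] by (simp add: additive_subgroup.zero_closed ideal.axioms(1))
      then have "j \<in> J <+> PIdl z" using j J.Icarr by (intro set_add_memI[of j _ \<zero>]) auto
      then show "j \<in> L" using saturation_incl[OF P id] unfolding L_def by auto
    qed
    have "z \<in> J <+> PIdl z"
      using cgenideal_self[OF z(1)] z by (intro set_add_memI[of \<zero> _ z]) auto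
    then have zL: "z \<in> L" using saturation_incl[OF P id] unfolding L_def by auto
    have "L \<in> S"
    \<comment> \<open>A line has no proper nonzero subspace: either some trace
      \<open>I n \<inter> L\<close> falls into \<open>J\<close>, or every trace generates
      \<open>L\<close> modulo \<open>J\<close> after localization.\<close>
    proof (cases "\<exists>n. I n \<inter> L \<subseteq> J")
      case True
      then obtain n where n: "I n \<inter> L \<subseteq> J" by auto
      have "I m \<inter> L = I m \<inter> J" if "m \<ge> n" for m using dec[OF that] n JL by blast
      then have "I m \<inter> L = I (max n N) \<inter> L" if "m \<ge> max n N" for m
        using N[of m] N[of "max n N"] that by auto
      then show ?thesis using L KJ JL unfolding S_def by blast
    next
      case nex: False
      have "I N \<inter> L \<subseteq> I m" if m: "m \<ge> N" for m
      proof
        interpret Im: ideal "I m" R by (rule I)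
        interpret IN: ideal "I N" R by (rule I)
        obtain w where w: "w \<in> I m" "w \<in> L" "w \<notin> J" using nex by blast
        fix v assume v: "v \<in> I N \<inter> L"
        have c: "w \<in> carrier R" "v \<in> carrier R" using w v L.Icarr by auto
        obtain s' j' r' where s': "s' \<in> carrier R" "s' \<notin> P" "j' \<in> J" "r' \<in> carrier R" "s' \<otimes> w = j' \<oplus> r' \<otimes> z"
          using w(2) unfolding L_def saturation_def by (auto elim!: set_add_memE simp: cgenideal_def)
        obtain s j r where s: "s \<in> carrier R" "s \<notin> P" "j \<in> J" "r \<in> carrier R" "s \<otimes> v = j \<oplus> r \<otimes> z"
          using v unfolding L_def saturation_def by (auto elim!: set_add_memE simp: cgenideal_def)
        have jc: "j \<in> carrier R" "j' \<in> carrier R" using s s' J.Icarr by auto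
        have r': "r' \<notin> P"
        proof
          assume "r' \<in> P"
          then have "s' \<otimes> w \<in> J" using Pz s' by auto
          then show False using saturationD[OF Jsat s'(1,2) c(1)] w by auto
        qed
        \<comment> \<open>Eliminating \<open>z\<close> between \<open>s v\<close> and
          \<open>s' w\<close> leaves an element of \<open>J \<inter> I N\<close>, which equals
          \<open>J \<inter> I m\<close>. Since \<open>w\<close> is in \<open>I m\<close>, so is
          \<open>(r' s) v\<close>, and \<open>r' s\<close> is outside \<open>P\<close>.\<close>
        have "r' \<otimes> (s \<otimes> v) \<ominus> r \<otimes> (s' \<otimes> w) = (r' \<otimes> j \<oplus> r \<otimes> (r' \<otimes> z)) \<ominus> (r \<otimes> j' \<oplus> r \<otimes> (r' \<otimes> z))"
          unfolding s(5) s'(5) using s s' jc z by (simp add: r_distr m_ac)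
        also have "\<dots> = r' \<otimes> j \<ominus> r \<otimes> j'"
          using s s' jc z by (simp add: a_minus_def minus_add a_ac r_neg1 r_neg2 r_neg)
        finally have eq: "r' \<otimes> (s \<otimes> v) \<ominus> r \<otimes> (s' \<otimes> w) = r' \<otimes> j \<ominus> r \<otimes> j'" .
        then have "r' \<otimes> (s \<otimes> v) \<ominus> r \<otimes> (s' \<otimes> w) \<in> J"
          using s s' J.minus_closed J.I_l_closed by auto
        moreover have "r' \<otimes> (s \<otimes> v) \<ominus> r \<otimes> (s' \<otimes> w) \<in> I N"
          using s s' v w dec[OF m] by (intro IN.minus_closed IN.I_l_closed) auto
        ultimately have "r' \<otimes> (s \<otimes> v) \<ominus> r \<otimes> (s' \<otimes> w) \<in> I m" using N[OF m] by blast
        then have "(r' \<otimes> (s \<otimes> v) \<ominus> r \<otimes> (s' \<otimes> w)) \<oplus> r \<otimes> (s' \<otimes> w) \<in> I m"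
          using s s' w by (intro Im.a_closed Im.I_l_closed) auto
        moreover have "(r' \<otimes> (s \<otimes> v) \<ominus> r \<otimes> (s' \<otimes> w)) \<oplus> r \<otimes> (s' \<otimes> w) = (r' \<otimes> s) \<otimes> v"
          using minus_add_self[of "r' \<otimes> (s \<otimes> v)" "r \<otimes> (s' \<otimes> w)"] s(1,4) s'(1,4) c
          by (simp add: m_assoc)
        ultimately have "(r' \<otimes> s) \<otimes> v \<in> I m" by simp
        moreover have "r' \<otimes> s \<notin> P" using r' s s' P.I_prime by auto
        ultimately show "v \<in> I m" using saturationD[OF I(2)[of m], of "r' \<otimes> s" v] s s' c by auto
      qed
      then have "I m \<inter> L = I N \<inter> L" if "m \<ge> N" for m using dec[OF that] that by blast
      then show ?thesis using L KJ JL unfolding S_def by blast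
    qed
    then have "L = J" using max JL by blast
    then show ?thesis using zL z by blast
  qed
qed


text \<open>\<open>symb R Q Q0 n\<close> plays the role of the \<open>n\<close>-th symbolic power of \<open>Q / Q0\<close> in the domain \<open>R / Q0\<close>.\<close>

primrec symb :: "('a, 'b) ring_scheme \<Rightarrow> 'a set \<Rightarrow> 'a set \<Rightarrow> nat \<Rightarrow> 'a set" where
  "symb R Q Q0 0 = carrier R"
| "symb R Q Q0 (Suc n) =
     saturation R Q (Idl\<^bsub>R\<^esub> (Q0 \<union> {q \<otimes>\<^bsub>R\<^esub> w | q w. q \<in> Q \<and> w \<in> symb R Q Q0 n}))"

context noetherian_cring
begin

context
  fixes Q Q0 assumes Q: "primeideal Q R" and Q0: "primeideal Q0 R" and Q0Q: "Q0 \<subset> Q"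
begin

interpretation Q: primeideal Q R by (rule Q)
interpretation Q0: primeideal Q0 R by (rule Q0)

lemma symb_ideal: "ideal (symb R Q Q0 n) R"
proof (induct n)
  case (Suc n)
  interpret ideal "symb R Q Q0 n" R by fact
  show ?case using Q.Icarr Q0.Icarr Icarr
    by (auto intro!: saturation_ideal Q genideal_ideal)
qed (simp add: oneideal)

lemma symb_gens_carrier: "Q0 \<union> {q \<otimes> w | q w. q \<in> Q \<and> w \<in> symb R Q Q0 n} \<subseteq> carrier R"
  using Q.Icarr Q0.Icarr ideal.Icarr[OF symb_ideal] by auto

lemma symb_saturated: "saturation R Q (symb R Q Q0 n) = symb R Q Q0 n"
proof (cases n)
  case 0
  then show ?thesis using Q.one_notin by (auto simp: saturation_def)
next
  case (Suc k)
  show ?thesis unfolding Suc symb.simps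
    by (rule saturation_saturation[OF Q genideal_ideal[OF symb_gens_carrier]])
qed

lemma symb_gens_subset: "Q0 \<union> {q \<otimes> w | q w. q \<in> Q \<and> w \<in> symb R Q Q0 n} \<subseteq> symb R Q Q0 (Suc n)"
  unfolding symb.simps using genideal_self[OF symb_gens_carrier[of n]]
    saturation_incl[OF Q genideal_ideal[OF symb_gens_carrier[of n]]] by (rule subset_trans)

lemma symb_dec: "symb R Q Q0 (Suc n) \<subseteq> symb R Q Q0 n"
proof (induct n)
  case 0
  then show ?case by (auto simp: saturation_def)
next
  case (Suc n)
  have "{q \<otimes> w | q w. q \<in> Q \<and> w \<in> symb R Q Q0 (Suc n)} \<subseteq> {q \<otimes> w | q w. q \<in> Q \<and> w \<in> symb R Q Q0 n}"
    using Suc by blast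
  then show ?case unfolding symb.simps(2)[of R Q Q0 "Suc n"] symb.simps(2)[of R Q Q0 n]
    by (intro saturation_mono subset_Idl_subset symb_gens_carrier) blast
qed

lemma symb_Q0: "Q0 \<subseteq> symb R Q Q0 n"
  by (cases n) (use symb_gens_subset Q0.Icarr in auto)

text \<open>If two consecutive terms agreed, Nakayama's lemma would reduce the term to
  \<open>Q0\<close>. But the powers of an element of \<open>Q\<close> outside \<open>Q0\<close> lie
  in the respective terms and never in \<open>Q0\<close>.\<close>

lemma symb_strict: "symb R Q Q0 (Suc n) \<noteq> symb R Q Q0 n"
proof
  assume eq: "symb R Q Q0 (Suc n) = symb R Q Q0 n"
  have "symb R Q Q0 n = Q0"
  proof (rule nakayama_saturated[OF Q symb_ideal symb_saturated Q0.is_ideal _ symb_Q0])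
    show "saturation R Q Q0 = Q0" using saturation_prime[OF Q0 _ Q] Q0Q by auto
    show "symb R Q Q0 n \<subseteq> saturation R Q (Idl (Q0 \<union> {q \<otimes> w |q w. q \<in> Q \<and> w \<in> symb R Q Q0 n}))"
      using eq by simp
  qed
  moreover obtain q where q: "q \<in> Q" "q \<notin> Q0" using Q0Q by auto
  have "q [^] k \<in> symb R Q Q0 k" for k :: nat
  proof (induct k)
    case (Suc k)
    have "q [^] Suc k = q \<otimes> q [^] k" using q Q.Icarr by (simp add: m_comm)
    then show ?case using symb_gens_subset[of k] q Suc by blast
  qed simp
  ultimately show False using Q0.pow_notin[of q n] q Q.Icarr by auto
qed

end

text \<open>Krull's principal ideal theorem in \<open>R / Q0\<close>: the ideals \<open>Q\<^sup>(\<^sup>n\<^sup>) + (x)\<close> become stationary, hence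
  \<open>Q\<^sup>(\<^sup>n\<^sup>) = Q\<^sup>(\<^sup>n\<^sup>+\<^sup>1\<^sup>) + x Q\<^sup>(\<^sup>n\<^sup>)\<close>, and Nakayama's lemma contradicts the strictness of the chain of
  symbolic powers.\<close>

lemma principal_ideal_theorem:
  assumes P: "primeideal P R" and Q: "primeideal Q R" and Q0: "primeideal Q0 R"
    and lt: "Q0 \<subset> Q" "Q \<subset> P" and x: "x \<in> P" "x \<notin> Q"
    and min: "\<And>P'. primeideal P' R \<Longrightarrow> Q0 \<subseteq> P' \<Longrightarrow> x \<in> P' \<Longrightarrow> P' \<subseteq> P \<Longrightarrow> P' = P"
  shows False
proof -
  interpret P: primeideal P R by fact
  interpret Q: primeideal Q R by fact
  interpret Q0: primeideal Q0 R by fact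
  note [simp del] = symb.simps
  have xc: "x \<in> carrier R" using x P.Icarr by auto
  note id = symb_ideal[OF Q Q0 lt(1)]
  define D where "D n = symb R Q Q0 n <+>\<^bsub>R\<^esub> PIdl x" for n
  have Did: "ideal (D n) R" for n unfolding D_def by (intro add_ideals id cgenideal_ideal xc)
  have DI: "symb R Q Q0 n \<subseteq> D n" for n
  proof
    fix j assume j: "j \<in> symb R Q Q0 n"
    have "\<zero> \<in> PIdl x" using cgenideal_ideal[OF xc] by (simp add: additive_subgroup.zero_closed ideal.axioms(1))
    then show "j \<in> D n" unfolding D_def using j ideal.Icarr[OF id] by (intro set_add_memI[of j _ \<zero>]) auto
  qed
  have "\<exists>n. saturation R P (D (Suc n)) = saturation R P (D n)"
  proof (rule dcc_saturated[OF P])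
    have gc: "Q0 \<union> {x} \<subseteq> carrier R" using Q0.Icarr xc by auto
    show "ideal (Idl (Q0 \<union> {x})) R" by (rule genideal_ideal[OF gc])
    show "P' = P" if "primeideal P' R" "Idl (Q0 \<union> {x}) \<subseteq> P'" "P' \<subseteq> P" for P'
      using min[OF that(1)] genideal_self[OF gc] that by auto
    fix n
    show "ideal (saturation R P (D n)) R" by (rule saturation_ideal[OF P Did])
    show "saturation R P (saturation R P (D n)) = saturation R P (D n)"
      by (rule saturation_saturation[OF P Did])
    have "\<zero> \<in> symb R Q Q0 n" by (rule additive_subgroup.zero_closed[OF ideal.axioms(1)[OF id]])
    then have "x \<in> D n" using cgenideal_self[OF xc] xc unfolding D_def
      by (intro set_add_memI[of \<zero> _ x]) auto
    then have "Idl (Q0 \<union> {x}) \<subseteq> D n" using symb_Q0[OF Q Q0 lt(1), of n] DI[of n]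
      by (intro genideal_minimal Did) auto
    then show "Idl (Q0 \<union> {x}) \<subseteq> saturation R P (D n)" using saturation_incl[OF P Did[of n]] by auto
    have "D (Suc n) \<subseteq> D n" using symb_dec[OF Q Q0 lt(1), of n] unfolding D_def
      by (auto elim!: set_add_memE intro: set_add_memI)
    then show "saturation R P (D (Suc n)) \<subseteq> saturation R P (D n)" by (rule saturation_mono)
  qed
  then obtain n where n: "saturation R P (D (Suc n)) = saturation R P (D n)" by auto
  let ?M = "symb R Q Q0 n" and ?N = "symb R Q Q0 (Suc n)"
  interpret M: ideal ?M R by (rule id)
  interpret N: ideal ?N R by (rule id)
  have NM: "?N \<subseteq> ?M" by (rule symb_dec[OF Q Q0 lt(1)])
  \<comment> \<open>Elements outside \<open>P\<close> are also outside \<open>Q\<close>, so being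
    \<open>Q\<close>-saturated is the stronger property.\<close>
  have sat: "saturation R P (symb R Q Q0 k) = symb R Q Q0 k" for k
    using saturation_incl[OF P id[of k]] saturation_antimono[of Q P R "symb R Q Q0 k"] lt(2)
      symb_saturated[OF Q Q0 lt(1), of k] by auto
  have gc: "?N \<union> {q \<otimes> w |q w. q \<in> P \<and> w \<in> ?M} \<subseteq> carrier R" using N.Icarr M.Icarr P.Icarr by auto
  let ?I = "Idl (?N \<union> {q \<otimes> w |q w. q \<in> P \<and> w \<in> ?M})"
  interpret I: ideal ?I R by (rule genideal_ideal[OF gc])
  have "?M = ?N"
  proof (rule nakayama_saturated[OF P id sat id sat NM], rule)
    fix z assume z: "z \<in> ?M"
    then have zc: "z \<in> carrier R" using M.Icarr by auto
    have "z \<in> saturation R P (D (Suc n))" using n DI saturation_incl[OF P Did] z by blast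
    then obtain s y r where s: "s \<in> carrier R" "s \<notin> P" "y \<in> ?N" "r \<in> carrier R" "s \<otimes> z = y \<oplus> r \<otimes> x"
      unfolding D_def saturation_def by (auto elim!: set_add_memE simp: cgenideal_def)
    have yc: "y \<in> carrier R" using s N.Icarr by auto
    have "s \<otimes> z \<ominus> y \<in> ?M" using M.minus_closed[OF M.I_l_closed[OF z s(1)]] NM s(3) by blast
    moreover have "s \<otimes> z \<ominus> y = x \<otimes> r"
      unfolding s(5) using s yc xc by (simp add: a_minus_def a_ac r_neg1 r_neg2 m_comm)
    ultimately have "x \<otimes> r \<in> ?M" by simp
    \<comment> \<open>\<open>x\<close> is outside \<open>Q\<close> and \<open>Q^(n)\<close> is
      \<open>Q\<close>-saturated, so \<open>x\<close> can be cancelled. Up to localization at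
      \<open>P\<close>, this improves \<open>Q^(n) \<subseteq> Q^(n+1) + (x)\<close> to
      \<open>Q^(n) \<subseteq> Q^(n+1) + x Q^(n)\<close>.\<close>
    then have "r \<in> ?M" using saturationD[OF symb_saturated[OF Q Q0 lt(1), of n], of x r] x xc s by auto
    then have "r \<otimes> x \<in> ?I" using genideal_self[OF gc] x s xc m_comm[of r x] by blast
    moreover have "y \<in> ?I" using genideal_self[OF gc] s by blast
    ultimately have "s \<otimes> z \<in> ?I" unfolding s(5) by simp
    then show "z \<in> saturation R P ?I" unfolding saturation_def using s(1,2) zc by blast
  qed
  then show False using symb_strict[OF Q Q0 lt(1), of n] by simp
qed

text \<open>When \<open>x\<close> is outside \<open>Q\<close>, the principal ideal theorem says that
  \<open>P\<close> is not minimal among the primes containing \<open>Q0\<close> and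
  \<open>x\<close>. A smaller such prime differs from \<open>Q0\<close> because it contains
  \<open>x\<close>.\<close>

lemma prime_interpolation:
  assumes P: "primeideal P R" and Q: "primeideal Q R" and Q0: "primeideal Q0 R"
    and lt: "Q0 \<subset> Q" "Q \<subset> P" and x: "x \<in> P"
  obtains P' where "primeideal P' R" "Q0 \<subset> P'" "P' \<subset> P" "x \<in> P'"
proof (cases "x \<in> Q")
  case True
  then show ?thesis using that Q lt by blast
next
  case False
  then show ?thesis using that lt x principal_ideal_theorem[OF P Q Q0 lt x False] by blast
qed

end

section \<open>Shifting elements down chains of primes\<close>

lemma prime_chain_mono:
  assumes "prime_chain R c n" "i \<le> j" "j \<le> n" shows "c i \<subseteq> c j"
  using assms(2,3)
proof (induct j rule: dec_induct)
  case (step m)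
  then have "c m \<subset> c (Suc m)" using assms(1) by (simp add: prime_chain_def)
  then show ?case using step by auto
qed simp

lemma prime_chain_snoc:
  assumes "prime_chain R c n" "primeideal P R" "c n \<subset> P"
  shows "prime_chain R (c(Suc n := P)) (Suc n)"
  using assms unfolding prime_chain_def by (auto simp: le_Suc_eq less_Suc_eq)

lemma prime_chain_tl:
  "prime_chain R c (Suc n) \<Longrightarrow> prime_chain R (\<lambda>i. c (Suc i)) n"
  unfolding prime_chain_def by auto

lemma prime_chain_Cons:
  assumes "prime_chain R c n" "primeideal P R" "P \<subset> c 0"
  shows "prime_chain R (case_nat P c) (Suc n)"
  using assms unfolding prime_chain_def by (auto split: nat.splits)

context noetherian_cring
begin

text \<open>Interpolation between the last three primes replaces the last interior one by a prime
  that contains \<open>x\<close>. The induction hypothesis for the shorter chain ending there pushes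
  \<open>x\<close> further down, and the old top is put back.\<close>

lemma prime_chain_shift:
  assumes "prime_chain R c (Suc n)" "x \<in> c (Suc n)"
  obtains d where "prime_chain R d (Suc n)" "d 0 = c 0" "d (Suc n) = c (Suc n)" "x \<in> d 1"
proof -
  have "\<exists>d. prime_chain R d (Suc n) \<and> d 0 = c 0 \<and> d (Suc n) = c (Suc n) \<and> x \<in> d 1"
    using assms
  proof (induct n arbitrary: c)
    case 0
    then show ?case by auto
  next
    case (Suc n)
    have c: "primeideal (c i) R" if "i \<le> Suc (Suc n)" for i
      using Suc.prems(1) that by (simp add: prime_chain_def)
    have lt: "c n \<subset> c (Suc n)" "c (Suc n) \<subset> c (Suc (Suc n))"
      using Suc.prems(1) by (simp_all add: prime_chain_def)
    obtain P' where P': "primeideal P' R" "c n \<subset> P'" "P' \<subset> c (Suc (Suc n))" "x \<in> P'"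
      using prime_interpolation[OF c c c lt Suc.prems(2)] by auto
    have "prime_chain R c n" using Suc.prems(1) by (simp add: prime_chain_def)
    then have "prime_chain R (c(Suc n := P')) (Suc n)" using P' by (intro prime_chain_snoc)
    then obtain d where d: "prime_chain R d (Suc n)" "d 0 = c 0" "d (Suc n) = P'" "x \<in> d 1"
      using Suc.hyps[of "c(Suc n := P')"] P'(4) by fastforce
    define e where "e = d(Suc (Suc n) := c (Suc (Suc n)))"
    have "prime_chain R e (Suc (Suc n))"
      unfolding e_def using d P' c by (intro prime_chain_snoc) auto
    moreover have "e 0 = c 0" "e (Suc (Suc n)) = c (Suc (Suc n))" "x \<in> e 1"
      using d by (auto simp: e_def)
    ultimately show ?case by blast
  qed
  then show thesis using that by blast
qed

text \<open>Krull's height theorem. Each generator in turn is shifted into the second prime of the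
  chain and the bottom prime is dropped, so \<open>G\<close> ends up in the bottom at the cost of
  \<open>card G\<close> links. With all of \<open>F\<close> in the bottom prime, that prime is
  already \<open>c n\<close>, and no link may be left.\<close>

lemma prime_chain_le_card_generators:
  assumes c: "prime_chain R c n" and F: "finite F" "F \<subseteq> carrier R" "c n = Idl F"
  shows "n \<le> card F"
proof (rule ccontr)
  assume "\<not> n \<le> card F"
  have Fc: "F \<subseteq> c n" using genideal_self F by auto
  have "\<exists>d. prime_chain R d (n - card G) \<and> d (n - card G) = c n \<and> G \<subseteq> d 0" if "G \<subseteq> F" for G
    using finite_subset[OF that F(1)] that
  proof (induct G)
    case empty
    then show ?case using c by auto
  next
    case (insert x G)
    then obtain d where d: "prime_chain R d (n - card G)" "d (n - card G) = c n" "G \<subseteq> d 0" by auto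
    have xc: "x \<in> d (Suc k)" if "n - card G = Suc k" for k using that d(2) insert.prems Fc by auto
    have "card (insert x G) \<le> card F" using insert.prems F(1) by (rule card_mono[rotated])
    \<comment> \<open>Since \<open>card F < n\<close>, this difference of natural numbers is never
      truncated.\<close>
    then obtain k where k: "n - card G = Suc k" "n - card (insert x G) = k"
      using \<open>\<not> n \<le> card F\<close> insert.hyps by (cases "n - card G") auto
    obtain e where e: "prime_chain R e (Suc k)" "e 0 = d 0" "e (Suc k) = c n" "x \<in> e 1"
      by (rule prime_chain_shift[of d k x]) (use d k xc in auto)
    have "e 0 \<subseteq> e 1" using e(1) by (auto simp: prime_chain_def)
    then show ?case using prime_chain_tl[OF e(1)] e d k by (intro exI[of _ "\<lambda>i. e (Suc i)"]) auto
  qed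
  from this[of F] obtain d where d: "prime_chain R d (n - card F)" "d (n - card F) = c n" "F \<subseteq> d 0" by auto
  have "primeideal (d 0) R" using d(1) by (simp add: prime_chain_def)
  then have "c n \<subseteq> d 0" unfolding F(3) using d(3) genideal_minimal primeideal.axioms(1) by blast
  moreover have "d 0 \<subset> d 1" using d(1) \<open>\<not> n \<le> card F\<close> by (simp add: prime_chain_def)
  moreover have "d 1 \<subseteq> d (n - card F)" using \<open>\<not> n \<le> card F\<close> by (intro prime_chain_mono[OF d(1)]) auto
  ultimately show False using d(2) by auto
qed

end

section \<open>Noetherian rings under homomorphisms and polynomial extension\<close>

lemma noetherian_ring_surj:
  assumes "ring_hom_ring R S h" "noetherian_ring R" "h ` carrier R = carrier S"
  shows "noetherian_ring S"
proof -
  interpret h: ring_hom_ring R S h by fact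
  interpret R: noetherian_ring R by fact
  show ?thesis
  proof (rule h.S.noetherian_ringI)
    fix I assume I: "ideal I S"
    obtain A where A: "A \<subseteq> carrier R" "finite A" "{r \<in> carrier R. h r \<in> I} = Idl\<^bsub>R\<^esub> A"
      using R.finetely_gen[OF h.ideal_vimage[OF I]] by auto
    have hA: "h ` A \<subseteq> carrier S" using A by auto
    have "I = Idl\<^bsub>S\<^esub> (h ` A)"
    proof
      show "Idl\<^bsub>S\<^esub> (h ` A) \<subseteq> I"
        using h.R.genideal_self[OF A(1)] A(3) by (intro h.S.genideal_minimal I) auto
      have "Idl\<^bsub>R\<^esub> A \<subseteq> {r \<in> carrier R. h r \<in> Idl\<^bsub>S\<^esub> (h ` A)}"
        using h.S.genideal_self[OF hA] A(1)
        by (intro h.R.genideal_minimal h.ideal_vimage h.S.genideal_ideal hA) auto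
      then show "I \<subseteq> Idl\<^bsub>S\<^esub> (h ` A)"
        using A(3) assms(3) ideal.Icarr[OF I] by (smt (verit) image_iff mem_Collect_eq subset_iff)
    qed
    then show "\<exists>A\<subseteq>carrier S. finite A \<and> I = Idl\<^bsub>S\<^esub> A" using hA A(2) by blast
  qed
qed

lemma noetherian_cring_surj:
  assumes "ring_hom_ring R S h" "noetherian_ring R" "h ` carrier R = carrier S" "cring S"
  shows "noetherian_cring S"
  using noetherian_ring_surj[OF assms(1-3)] assms(4) by (simp add: noetherian_cring_def)

lemma (in noetherian_ring) ideal_sequence_stationary:
  assumes "\<And>n. ideal (I n) R" "\<And>n. I n \<subseteq> I (Suc n)"
  obtains N where "\<And>n. I n \<subseteq> I N"
proof -
  have mono: "I m \<subseteq> I n" if "m \<le> n" for m n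
    using lift_Suc_mono_le[of I m n] assms(2) that by blast
  have "subset.chain {I. ideal I R} (range I)"
  proof -
    have "I m \<subseteq> I n \<or> I n \<subseteq> I m" for m n using mono[of m n] mono[of n m] by linarith
    then show ?thesis unfolding pred_on.chain_def using assms(1) by auto
  qed
  then have "\<Union>(range I) \<in> range I" by (intro ideal_chain_is_trivial) auto
  then show thesis using that by blast
qed

text \<open>The coefficient at \<open>n\<close> is allowed to vanish, so that for an ideal
  \<open>I\<close> this is an ideal without any case distinction on degrees, and multiplication by
  \<open>X\<close> makes it grow with \<open>n\<close>.\<close>

definition (in UP) leading_coeffs :: "(nat \<Rightarrow> 'a) set \<Rightarrow> nat \<Rightarrow> 'a set" where
  "leading_coeffs I n = {coeff P f n | f. f \<in> I \<and> (\<forall>i>n. coeff P f i = \<zero>)}"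

context UP_cring
begin

lemma leading_coeffs_ideal:
  assumes "ideal I P" shows "ideal (leading_coeffs I n) R"
proof -
  interpret I: ideal I P by fact
  show ?thesis
  proof (rule R.idealI_cring)
    show "leading_coeffs I n \<subseteq> carrier R" using I.Icarr by (auto simp: leading_coeffs_def)
    show "\<zero> \<in> leading_coeffs I n" unfolding leading_coeffs_def
      using I.zero_closed by (auto intro!: exI[of _ "\<zero>\<^bsub>P\<^esub>"])
    fix a b assume "a \<in> leading_coeffs I n" "b \<in> leading_coeffs I n"
    then obtain f g where "f \<in> I" "\<forall>i>n. coeff P f i = \<zero>" "a = coeff P f n"
        "g \<in> I" "\<forall>i>n. coeff P g i = \<zero>" "b = coeff P g n" unfolding leading_coeffs_def by auto
    then show "a \<oplus> b \<in> leading_coeffs I n" unfolding leading_coeffs_def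
      using I.Icarr by (auto intro!: exI[of _ "f \<oplus>\<^bsub>P\<^esub> g"])
  next
    fix a x assume "a \<in> leading_coeffs I n" and x: "x \<in> carrier R"
    then obtain f where f: "f \<in> I" "\<forall>i>n. coeff P f i = \<zero>" "a = coeff P f n" 
      unfolding leading_coeffs_def by auto
    have "x \<odot>\<^bsub>P\<^esub> f = monom P x 0 \<otimes>\<^bsub>P\<^esub> f" using f I.Icarr x by (simp add: monom_mult_is_smult)
    then have "x \<odot>\<^bsub>P\<^esub> f \<in> I" using f x I.I_l_closed by simp
    then show "x \<otimes> a \<in> leading_coeffs I n" unfolding leading_coeffs_def
      using f x I.Icarr by (auto intro!: exI[of _ "x \<odot>\<^bsub>P\<^esub> f"])
  qed
qed

lemma coeff_X_mult_Suc:
  assumes "f \<in> carrier P" shows "coeff P (monom P \<one> 1 \<otimes>\<^bsub>P\<^esub> f) (Suc i) = coeff P f i"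
  using coeff_monom_mult[OF R.one_closed assms, of 1 i] assms by simp

lemma leading_coeffs_Suc:
  assumes "ideal I P" shows "leading_coeffs I n \<subseteq> leading_coeffs I (Suc n)"
proof
  interpret I: ideal I P by fact
  fix a assume "a \<in> leading_coeffs I n"
  then obtain f where f: "f \<in> I" "\<forall>i>n. coeff P f i = \<zero>" "a = coeff P f n" 
    unfolding leading_coeffs_def by auto
  let ?g = "monom P \<one> 1 \<otimes>\<^bsub>P\<^esub> f"
  have c: "coeff P ?g (Suc i) = coeff P f i" for i using coeff_X_mult_Suc I.Icarr f by auto
  have "?g \<in> I" using I.I_l_closed f by simp
  moreover have "coeff P ?g i = \<zero>" if "i > Suc n" for i
    using that c[of "i - 1"] f(2) by auto
  ultimately show "a \<in> leading_coeffs I (Suc n)" unfolding leading_coeffs_def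
    using c[of n] f(3) by (auto simp del: coeff_mult intro!: exI[of _ ?g])
qed

text \<open>Induction on a degree bound: from an element of \<open>J\<close> subtract an element of
  \<open>I\<close> with the same top coefficient. The difference is still in \<open>J\<close>
  because \<open>I \<subseteq> J\<close>, and its bound is smaller.\<close>

lemma ideal_eq_by_leading_coeffs:
  assumes I: "ideal I P" and J: "ideal J P" and "I \<subseteq> J"
    and eq: "\<And>n. leading_coeffs J n \<subseteq> leading_coeffs I n"
  shows "I = J"
proof -
  interpret I: ideal I P by fact
  interpret J: ideal J P by fact
  have fI: "f \<in> I" if "f \<in> J" "\<forall>i\<ge>n. coeff P f i = \<zero>" for f n
    using that
  proof (induct n arbitrary: f)
    case 0
    then have "f = \<zero>\<^bsub>P\<^esub>" using J.Icarr by (intro up_eqI) auto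
    then show ?case by simp
  next
    case (Suc n)
    then have "coeff P f n \<in> leading_coeffs J n" unfolding leading_coeffs_def by auto
    then obtain g where g: "g \<in> I" "\<forall>i>n. coeff P g i = \<zero>" "coeff P f n = coeff P g n"
      using eq[of n] unfolding leading_coeffs_def by auto
    have c: "f \<in> carrier P" "g \<in> carrier P" using Suc g J.Icarr I.Icarr by auto
    have "coeff P (f \<ominus>\<^bsub>P\<^esub> g) i = \<zero>" if "i \<ge> n" for i
      using that g Suc.prems(2) c by (cases "i = n") (auto simp: R.r_neg R.minus_eq)
    moreover have "f \<ominus>\<^bsub>P\<^esub> g \<in> J" using Suc.prems g assms(3) by (intro J.minus_closed) auto
    ultimately have "f \<ominus>\<^bsub>P\<^esub> g \<in> I" using Suc.hyps by blast
    then have "(f \<ominus>\<^bsub>P\<^esub> g) \<oplus>\<^bsub>P\<^esub> g \<in> I" using g by simp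
    then show ?case using P.minus_add_self c by simp
  qed
  have "J \<subseteq> I"
  proof
    fix f assume f: "f \<in> J"
    then have "\<forall>i\<ge>Suc (deg R f). coeff P f i = \<zero>" using deg_aboveD[of f] J.Icarr by auto
    then show "f \<in> I" by (rule fI[OF f])
  qed
  then show ?thesis using assms(3) by (rule subset_antisym[rotated])
qed

end

text \<open>The ideals of leading coefficients stop growing at some \<open>N\<close>. Polynomials in
  \<open>I\<close> that realize generators of these ideals for the finitely many
  \<open>n \<le> N\<close> therefore generate an ideal with the same leading coefficients as
  \<open>I\<close> in every degree.\<close>

theorem (in noetherian_cring) UP_noetherian: "noetherian_cring (UP R)"
proof -
  interpret U: UP_cring R "UP R" by unfold_locales
  let ?P = "UP R"
  have "noetherian_ring ?P"
  proof (rule U.P.noetherian_ringI)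
    fix I assume I: "ideal I ?P"
    interpret I: ideal I ?P by fact
    note Lid = U.leading_coeffs_ideal[OF I]
    obtain N where N: "\<And>n. U.leading_coeffs I n \<subseteq> U.leading_coeffs I N"
      by (rule ideal_sequence_stationary[of "U.leading_coeffs I", OF Lid U.leading_coeffs_Suc[OF I]]) blast
    define D where "D n = {f \<in> I. \<forall>i>n. coeff ?P f i = \<zero>}" for n
    have L: "U.leading_coeffs I n = (\<lambda>f. coeff ?P f n) ` D n" for n
      unfolding D_def U.leading_coeffs_def by auto
    have "\<exists>F. finite F \<and> F \<subseteq> D n \<and> U.leading_coeffs I n = Idl ((\<lambda>f. coeff ?P f n) ` F)" for n
    proof -
      obtain A where A: "A \<subseteq> carrier R" "finite A" "U.leading_coeffs I n = Idl A"
        using finetely_gen[OF Lid[of n]] by auto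
      have "A \<subseteq> (\<lambda>f. coeff ?P f n) ` D n" using genideal_self[OF A(1)] A(3) L[of n] by simp
      then obtain F where "finite F" "F \<subseteq> D n" "A = (\<lambda>f. coeff ?P f n) ` F"
        using finite_subset_image[OF A(2)] by metis
      then show ?thesis using A(3) by blast
    qed
    then obtain F where F: "\<And>n. finite (F n)" "\<And>n. F n \<subseteq> D n"
        "\<And>n. U.leading_coeffs I n = Idl ((\<lambda>f. coeff ?P f n) ` F n)" by metis
    define G where "G = (\<Union>n\<le>N. F n)"
    have GI: "G \<subseteq> I" using F(2) unfolding G_def D_def by auto
    then have Gc: "G \<subseteq> carrier ?P" using I.Icarr by auto
    note J = U.P.genideal_ideal[OF Gc]
    have le: "U.leading_coeffs I n \<subseteq> U.leading_coeffs (Idl\<^bsub>?P\<^esub> G) n" if "n \<le> N" for n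
    proof -
      have "(\<lambda>f. coeff ?P f n) ` F n \<subseteq> U.leading_coeffs (Idl\<^bsub>?P\<^esub> G) n"
        using U.P.genideal_self[OF Gc] F(2)[of n] that unfolding G_def U.leading_coeffs_def D_def by blast
      then show ?thesis unfolding F(3) by (intro genideal_minimal U.leading_coeffs_ideal[OF J])
    qed
    have "Idl\<^bsub>?P\<^esub> G = I"
    proof (rule U.ideal_eq_by_leading_coeffs[OF J I])
      show "Idl\<^bsub>?P\<^esub> G \<subseteq> I" by (rule U.P.genideal_minimal[OF I GI])
      fix n
      show "U.leading_coeffs I n \<subseteq> U.leading_coeffs (Idl\<^bsub>?P\<^esub> G) n"
      proof (cases "n \<le> N")
        case False
        then have "U.leading_coeffs (Idl\<^bsub>?P\<^esub> G) N \<subseteq> U.leading_coeffs (Idl\<^bsub>?P\<^esub> G) n"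
          using lift_Suc_mono_le[of "U.leading_coeffs (Idl\<^bsub>?P\<^esub> G)" N n] U.leading_coeffs_Suc[OF J] by auto
        then show ?thesis using N[of n] le[of N] by blast
      qed (use le in auto)
    qed
    then show "\<exists>A\<subseteq>carrier ?P. finite A \<and> I = Idl\<^bsub>?P\<^esub> A" using F(1) Gc unfolding G_def by blast
  qed
  then show ?thesis by (intro noetherian_cring.intro U.P.is_cring)
qed

section \<open>Monoid rings\<close>

text \<open>The ring laws are proved once, with all exponents allowed;
  \<open>monoid_ring R M\<close> for a submonoid \<open>M\<close> inherits them as a subring.
  Cancellation among the exponents makes multiplication by a monomial a scaled shift of
  coefficients.\<close>

locale full_monoid_ring = cring R for R :: "('a, 'b) ring_scheme" (structure) +
  fixes W :: "('m::cancel_comm_monoid_add \<Rightarrow> 'a) ring"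
  defines W_def: "W \<equiv> monoid_ring R UNIV"
begin

lemma carrier_W: "f \<in> carrier W \<longleftrightarrow> (\<forall>m. f m \<in> carrier R) \<and> finite {m. f m \<noteq> \<zero>}"
  by (auto simp: W_def monoid_ring_def)

lemma W_zero: "\<zero>\<^bsub>W\<^esub> = (\<lambda>m. \<zero>)" and W_one: "\<one>\<^bsub>W\<^esub> = (\<lambda>m. if m = 0 then \<one> else \<zero>)"
  and W_add: "f \<oplus>\<^bsub>W\<^esub> g = (\<lambda>m. f m \<oplus> g m)"
  and W_mult: "(f \<otimes>\<^bsub>W\<^esub> g) m = finsum R (\<lambda>(i, j). f i \<otimes> g j) {(i, j). f i \<noteq> \<zero> \<and> g j \<noteq> \<zero> \<and> i + j = m}"
  by (auto simp: W_def monoid_ring_def)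

lemma coeff_carrier: "f \<in> carrier W \<Longrightarrow> f m \<in> carrier R"
  by (simp add: carrier_W)

text \<open>The defining sum ranges over the exact supports, which change under addition. Enlarging
  them to finite sets common to several factors adds only zero terms and makes products comparable
  term by term.\<close>

lemma mult_eq:
  assumes "f \<in> carrier W" "g \<in> carrier W" "finite F" "finite G"
    "{m. f m \<noteq> \<zero>} \<subseteq> F" "{m. g m \<noteq> \<zero>} \<subseteq> G"
  shows "(f \<otimes>\<^bsub>W\<^esub> g) m = finsum R (\<lambda>(i, j). f i \<otimes> g j) {(i, j). i \<in> F \<and> j \<in> G \<and> i + j = m}"
  unfolding W_mult
proof (rule add.finprod_mono_neutral_cong_left)
  show "finite {(i, j). i \<in> F \<and> j \<in> G \<and> i + j = m}"
    by (rule finite_subset[of _ "F \<times> G"]) (use assms in auto)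
  show "(\<lambda>(i, j). f i \<otimes> g j) \<in> {(i, j). i \<in> F \<and> j \<in> G \<and> i + j = m} \<rightarrow> carrier R"
    using assms(1,2) by (auto simp: carrier_W)
  fix x assume "x \<in> {(i, j). i \<in> F \<and> j \<in> G \<and> i + j = m} - {(i, j). f i \<noteq> \<zero> \<and> g j \<noteq> \<zero> \<and> i + j = m}"
  then show "(case x of (i, j) \<Rightarrow> f i \<otimes> g j) = \<zero>"
    using assms(1,2) by (auto simp: carrier_W)
qed (use assms in auto)

lemma mult_nonzeroD:
  assumes "(f \<otimes>\<^bsub>W\<^esub> g) m \<noteq> \<zero>" shows "\<exists>i j. f i \<noteq> \<zero> \<and> g j \<noteq> \<zero> \<and> m = i + j"
proof (rule ccontr)
  assume "\<not> ?thesis"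
  then have *: "{(i, j). f i \<noteq> \<zero> \<and> g j \<noteq> \<zero> \<and> i + j = m} = {}" by auto
  show False using assms unfolding W_mult * by simp
qed

lemma mult_closed: 
  assumes "f \<in> carrier W" "g \<in> carrier W" shows "f \<otimes>\<^bsub>W\<^esub> g \<in> carrier W"
proof -
  have "{m. (f \<otimes>\<^bsub>W\<^esub> g) m \<noteq> \<zero>} \<subseteq> (\<lambda>(i, j). i + j) ` ({m. f m \<noteq> \<zero>} \<times> {m. g m \<noteq> \<zero>})"
    using mult_nonzeroD by force
  then have "finite {m. (f \<otimes>\<^bsub>W\<^esub> g) m \<noteq> \<zero>}"
    by (rule finite_subset) (use assms in \<open>auto simp: carrier_W\<close>)
  moreover have "(f \<otimes>\<^bsub>W\<^esub> g) m \<in> carrier R" for m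
    unfolding W_mult by (rule finsum_closed) (use assms in \<open>auto simp: carrier_W\<close>)
  ultimately show ?thesis unfolding carrier_W by auto
qed

lemma add_closed: 
  assumes "f \<in> carrier W" "g \<in> carrier W" shows "f \<oplus>\<^bsub>W\<^esub> g \<in> carrier W"
proof -
  have "{m. f m \<oplus> g m \<noteq> \<zero>} \<subseteq> {m. f m \<noteq> \<zero>} \<union> {m. g m \<noteq> \<zero>}" by auto
  then have "finite {m. f m \<oplus> g m \<noteq> \<zero>}" by (rule finite_subset) (use assms in \<open>auto simp: carrier_W\<close>)
  then show ?thesis using assms by (auto simp: carrier_W W_add)
qed

lemma mult_l_distr:
  assumes "f \<in> carrier W" "f' \<in> carrier W" "g \<in> carrier W"
  shows "(f \<oplus>\<^bsub>W\<^esub> f') \<otimes>\<^bsub>W\<^esub> g = f \<otimes>\<^bsub>W\<^esub> g \<oplus>\<^bsub>W\<^esub> f' \<otimes>\<^bsub>W\<^esub> g"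
proof
  fix m
  define F where "F = {m. f m \<noteq> \<zero>} \<union> {m. f' m \<noteq> \<zero>}"
  define G where "G = {m. g m \<noteq> \<zero>}"
  define S where "S = {(i, j). i \<in> F \<and> j \<in> G \<and> i + j = m}"
  have fin: "finite F" "finite G" using assms by (auto simp: F_def G_def carrier_W)
  have c: "\<And>i. f i \<in> carrier R" "\<And>i. f' i \<in> carrier R" "\<And>i. g i \<in> carrier R"
    using assms by (auto simp: carrier_W)
  have "((f \<oplus>\<^bsub>W\<^esub> f') \<otimes>\<^bsub>W\<^esub> g) m = finsum R (\<lambda>(i, j). (f \<oplus>\<^bsub>W\<^esub> f') i \<otimes> g j) S" unfolding S_def
    by (rule mult_eq[OF add_closed]) (use assms fin in \<open>auto simp: F_def G_def W_add\<close>)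
  also have "\<dots> = finsum R (\<lambda>x. (case x of (i, j) \<Rightarrow> f i \<otimes> g j) \<oplus> (case x of (i, j) \<Rightarrow> f' i \<otimes> g j)) S"
    by (rule finsum_cong') (auto simp: W_add l_distr c)
  also have "\<dots> = finsum R (\<lambda>(i, j). f i \<otimes> g j) S \<oplus> finsum R (\<lambda>(i, j). f' i \<otimes> g j) S"
    by (rule finsum_addf) (auto simp: c)
  also have "finsum R (\<lambda>(i, j). f i \<otimes> g j) S = (f \<otimes>\<^bsub>W\<^esub> g) m" unfolding S_def
    by (rule mult_eq[symmetric]) (use assms fin in \<open>auto simp: F_def G_def\<close>)
  also have "finsum R (\<lambda>(i, j). f' i \<otimes> g j) S = (f' \<otimes>\<^bsub>W\<^esub> g) m" unfolding S_def
    by (rule mult_eq[symmetric]) (use assms fin in \<open>auto simp: F_def G_def\<close>)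
  finally show "((f \<oplus>\<^bsub>W\<^esub> f') \<otimes>\<^bsub>W\<^esub> g) m = (f \<otimes>\<^bsub>W\<^esub> g \<oplus>\<^bsub>W\<^esub> f' \<otimes>\<^bsub>W\<^esub> g) m"
    unfolding W_add[of "f \<otimes>\<^bsub>W\<^esub> g"] .
qed

lemma mult_comm:
  assumes "f \<in> carrier W" "g \<in> carrier W" shows "f \<otimes>\<^bsub>W\<^esub> g = g \<otimes>\<^bsub>W\<^esub> f"
proof
  fix m
  let ?S = "{(i, j). f i \<noteq> \<zero> \<and> g j \<noteq> \<zero> \<and> i + j = m}"
  have S: "{(i, j). g i \<noteq> \<zero> \<and> f j \<noteq> \<zero> \<and> i + j = m} = prod.swap ` ?S"
    by (auto simp: image_iff add.commute)
  have c: "\<And>i. f i \<in> carrier R" "\<And>i. g i \<in> carrier R" using assms by (auto simp: carrier_W)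
  have "(g \<otimes>\<^bsub>W\<^esub> f) m = finsum R (\<lambda>x. (\<lambda>(i, j). g i \<otimes> f j) (prod.swap x)) ?S"
    unfolding W_mult S by (rule finsum_reindex) (auto simp: c)
  also have "\<dots> = (f \<otimes>\<^bsub>W\<^esub> g) m" unfolding W_mult
    by (rule finsum_cong') (auto simp: c m_comm)
  finally show "(f \<otimes>\<^bsub>W\<^esub> g) m = (g \<otimes>\<^bsub>W\<^esub> f) m" by simp
qed

definition mono :: "'a \<Rightarrow> 'm \<Rightarrow> 'm \<Rightarrow> 'a" where
  "mono c i = (\<lambda>m. if m = i then c else \<zero>)"

lemma mono_closed: "c \<in> carrier R \<Longrightarrow> mono c i \<in> carrier W"
  by (auto simp: mono_def carrier_W)

lemma mono_mult_shift:
  assumes "c \<in> carrier R" "g \<in> carrier W"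
  shows "(mono c i \<otimes>\<^bsub>W\<^esub> g) (i + k) = c \<otimes> g k"
proof -
  have "(mono c i \<otimes>\<^bsub>W\<^esub> g) (i + k) = finsum R (\<lambda>(i', j). mono c i i' \<otimes> g j)
      {(i', j). i' \<in> {i} \<and> j \<in> insert k {m. g m \<noteq> \<zero>} \<and> i' + j = i + k}"
    by (rule mult_eq) (use assms in \<open>auto simp: mono_closed carrier_W mono_def\<close>)
  also have "{(i', j). i' \<in> {i} \<and> j \<in> insert k {m. g m \<noteq> \<zero>} \<and> i' + j = i + k} = {(i, k)}"
    by auto
  also have "finsum R (\<lambda>(i', j). mono c i i' \<otimes> g j) {(i, k)} = c \<otimes> g k"
    using assms by (simp add: carrier_W mono_def)
  finally show ?thesis .
qed

lemma mono_mult_outside: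
  assumes "m \<notin> range ((+) i)" shows "(mono c i \<otimes>\<^bsub>W\<^esub> g) m = \<zero>"
proof (rule ccontr)
  assume "(mono c i \<otimes>\<^bsub>W\<^esub> g) m \<noteq> \<zero>"
  then obtain i' j where "mono c i i' \<noteq> \<zero>" "m = i' + j" using mult_nonzeroD by blast
  then show False using assms by (auto simp: mono_def split: if_splits)
qed

lemma mono_mult_mono:
  assumes "c \<in> carrier R" "d \<in> carrier R"
  shows "mono c i \<otimes>\<^bsub>W\<^esub> mono d j = mono (c \<otimes> d) (i + j)"
proof
  fix m
  show "(mono c i \<otimes>\<^bsub>W\<^esub> mono d j) m = mono (c \<otimes> d) (i + j) m"
  proof (cases "m \<in> range ((+) i)")
    case True
    then show ?thesis using mono_mult_shift[OF assms(1) mono_closed[OF assms(2)]] assms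
      by (auto simp: mono_def)
  next
    case False
    then show ?thesis using mono_mult_outside[OF False] by (auto simp: mono_def)
  qed
qed

text \<open>With two monomial factors no double sum is needed: both sides are the shift of
  \<open>h\<close> by \<open>i + j\<close>, scaled by \<open>c \<otimes> d\<close>. General
  associativity follows by additive induction on the first two factors.\<close>

lemma mono_mult_assoc:
  assumes "c \<in> carrier R" "d \<in> carrier R" "h \<in> carrier W"
  shows "(mono c i \<otimes>\<^bsub>W\<^esub> mono d j) \<otimes>\<^bsub>W\<^esub> h = mono c i \<otimes>\<^bsub>W\<^esub> (mono d j \<otimes>\<^bsub>W\<^esub> h)"
proof
  fix m
  have cl: "mono d j \<otimes>\<^bsub>W\<^esub> h \<in> carrier W" using assms by (intro mult_closed mono_closed)
  have ch: "\<And>k. h k \<in> carrier R" using assms by (simp add: carrier_W)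
  show "(mono c i \<otimes>\<^bsub>W\<^esub> mono d j \<otimes>\<^bsub>W\<^esub> h) m = (mono c i \<otimes>\<^bsub>W\<^esub> (mono d j \<otimes>\<^bsub>W\<^esub> h)) m"
    unfolding mono_mult_mono[OF assms(1,2)]
  proof (cases "m \<in> range ((+) i)")
    case True
    then obtain k where k: "m = i + k" by auto
    show "(mono (c \<otimes> d) (i + j) \<otimes>\<^bsub>W\<^esub> h) m = (mono c i \<otimes>\<^bsub>W\<^esub> (mono d j \<otimes>\<^bsub>W\<^esub> h)) m"
    proof (cases "k \<in> range ((+) j)")
      case True
      then obtain l where l: "k = j + l" by auto
      have m: "m = (i + j) + l" unfolding k l by (simp add: add.assoc)
      have "(mono (c \<otimes> d) (i + j) \<otimes>\<^bsub>W\<^esub> h) m = (c \<otimes> d) \<otimes> h l"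
        unfolding m using assms by (intro mono_mult_shift) auto
      moreover have "(mono c i \<otimes>\<^bsub>W\<^esub> (mono d j \<otimes>\<^bsub>W\<^esub> h)) m = c \<otimes> (d \<otimes> h l)"
        unfolding k using mono_mult_shift[OF assms(1) cl] mono_mult_shift[OF assms(2,3)] l by simp
      ultimately show ?thesis using assms ch by (simp add: m_assoc)
    next
      case False
      have "m \<notin> range ((+) (i + j))"
      proof
        assume "m \<in> range ((+) (i + j))"
        then obtain l where "i + k = i + j + l" using k by auto
        then have "k = j + l" by (simp add: add.assoc)
        then show False using False by auto
      qed
      then have "(mono (c \<otimes> d) (i + j) \<otimes>\<^bsub>W\<^esub> h) m = \<zero>" by (rule mono_mult_outside)
      moreover have "(mono c i \<otimes>\<^bsub>W\<^esub> (mono d j \<otimes>\<^bsub>W\<^esub> h)) m = c \<otimes> \<zero>"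
        unfolding k using mono_mult_shift[OF assms(1) cl] mono_mult_outside[OF False] by simp
      ultimately show ?thesis using assms by simp
    qed
  next
    case False
    then have "m \<notin> range ((+) (i + j))" by (auto simp: add.assoc)
    then show "(mono (c \<otimes> d) (i + j) \<otimes>\<^bsub>W\<^esub> h) m = (mono c i \<otimes>\<^bsub>W\<^esub> (mono d j \<otimes>\<^bsub>W\<^esub> h)) m"
      using False by (simp add: mono_mult_outside)
  qed
qed

lemma monoid_ring_induct [consumes 1, case_names zero add]:
  assumes "f \<in> carrier W" "P \<zero>\<^bsub>W\<^esub>"
    and "\<And>f c i. f \<in> carrier W \<Longrightarrow> c \<in> carrier R \<Longrightarrow> P f \<Longrightarrow> P (f \<oplus>\<^bsub>W\<^esub> mono c i)"
  shows "P f"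
proof -
  have "finite {m. f m \<noteq> \<zero>}" using assms(1) by (simp add: carrier_W)
  moreover have "P f" if "finite F" "f \<in> carrier W" "{m. f m \<noteq> \<zero>} \<subseteq> F" for F f
    using that
  proof (induct F arbitrary: f)
    case empty
    then have "f = \<zero>\<^bsub>W\<^esub>" by (auto simp: W_zero)
    then show ?case using assms(2) by simp
  next
    case (insert i F)
    define g where "g = f(i := \<zero>)"
    have "{m. g m \<noteq> \<zero>} \<subseteq> F" using insert.prems(2) by (auto simp: g_def)
    moreover have g: "g \<in> carrier W"
      using insert.prems(1) finite_subset[OF \<open>{m. g m \<noteq> \<zero>} \<subseteq> F\<close> insert.hyps(1)]
      by (auto simp: carrier_W g_def)
    ultimately have "P g" by (intro insert.hyps(3)) auto
    moreover have fi: "\<And>m. f m \<in> carrier R" using insert.prems(1) by (simp add: carrier_W)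
    moreover have "f = g \<oplus>\<^bsub>W\<^esub> mono (f i) i" using fi by (auto simp: W_add g_def mono_def)
    ultimately show ?case using assms(3)[OF g, of "f i" i] by simp
  qed
  ultimately show ?thesis using assms(1) by blast
qed

lemma W_zero_closed: "\<zero>\<^bsub>W\<^esub> \<in> carrier W" and W_one_closed: "\<one>\<^bsub>W\<^esub> \<in> carrier W"
  by (auto simp: carrier_W W_zero W_one)

lemma mult_l_null: "\<zero>\<^bsub>W\<^esub> \<otimes>\<^bsub>W\<^esub> g = \<zero>\<^bsub>W\<^esub>"
  by (auto simp: W_zero W_mult)

lemma mult_r_distr:
  assumes "f \<in> carrier W" "f' \<in> carrier W" "g \<in> carrier W"
  shows "g \<otimes>\<^bsub>W\<^esub> (f \<oplus>\<^bsub>W\<^esub> f') = g \<otimes>\<^bsub>W\<^esub> f \<oplus>\<^bsub>W\<^esub> g \<otimes>\<^bsub>W\<^esub> f'"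
  using assms by (simp add: mult_comm[of g] add_closed mult_l_distr)

lemma mult_assoc:
  assumes "f \<in> carrier W" "g \<in> carrier W" "h \<in> carrier W"
  shows "(f \<otimes>\<^bsub>W\<^esub> g) \<otimes>\<^bsub>W\<^esub> h = f \<otimes>\<^bsub>W\<^esub> (g \<otimes>\<^bsub>W\<^esub> h)"
  using assms(1)
proof (induct rule: monoid_ring_induct)
  case zero
  show ?case by (simp add: mult_l_null)
next
  case (add f c i)
  have "(mono c i \<otimes>\<^bsub>W\<^esub> g) \<otimes>\<^bsub>W\<^esub> h = mono c i \<otimes>\<^bsub>W\<^esub> (g \<otimes>\<^bsub>W\<^esub> h)"
    using assms(2)
  proof (induct rule: monoid_ring_induct)
    case zero
    have "mono c i \<otimes>\<^bsub>W\<^esub> \<zero>\<^bsub>W\<^esub> = \<zero>\<^bsub>W\<^esub>"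
      using add(2) mult_comm[OF mono_closed W_zero_closed] mult_l_null by metis
    then show ?case by (simp add: mult_l_null)
  next
    case (add g d j)
    then show ?case using \<open>c \<in> carrier R\<close> assms(3)
      by (simp add: mult_l_distr mult_r_distr mono_closed mult_closed mono_mult_assoc)
  qed
  then show ?case using add assms by (simp add: mult_l_distr mono_closed mult_closed)
qed

lemma mult_l_one: assumes "f \<in> carrier W" shows "\<one>\<^bsub>W\<^esub> \<otimes>\<^bsub>W\<^esub> f = f"
proof
  fix m
  have "\<one>\<^bsub>W\<^esub> = mono \<one> 0" by (auto simp: W_one mono_def)
  then show "(\<one>\<^bsub>W\<^esub> \<otimes>\<^bsub>W\<^esub> f) m = f m"
    using mono_mult_shift[OF one_closed assms, of 0 m] assms by (simp add: carrier_W)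
qed

lemma monoid_ring_cring: "cring W"
proof (rule cringI)
  show "abelian_group W"
  proof (rule abelian_groupI)
    fix f assume f: "f \<in> carrier W"
    then have "(\<lambda>m. \<ominus> f m) \<in> carrier W"
      using finite_subset[of "{m. \<ominus> f m \<noteq> \<zero>}" "{m. f m \<noteq> \<zero>}"] by (auto simp: carrier_W)
    moreover have "(\<lambda>m. \<ominus> f m) \<oplus>\<^bsub>W\<^esub> f = \<zero>\<^bsub>W\<^esub>" using f by (auto simp: W_add W_zero carrier_W l_neg)
    ultimately show "\<exists>g\<in>carrier W. g \<oplus>\<^bsub>W\<^esub> f = \<zero>\<^bsub>W\<^esub>" by blast
  qed (auto simp: add_closed W_zero_closed, auto simp: W_add W_zero carrier_W a_ac)
  show "comm_monoid W"
    by (rule comm_monoidI) (auto simp: mult_closed W_one_closed mult_assoc mult_l_one intro: mult_comm)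
qed (rule mult_l_distr)

end

sublocale full_monoid_ring \<subseteq> W: cring W
  by (rule monoid_ring_cring)

context full_monoid_ring
begin

lemma W_minus: assumes "f \<in> carrier W" shows "\<ominus>\<^bsub>W\<^esub> f = (\<lambda>m. \<ominus> f m)"
proof -
  have "(\<lambda>m. \<ominus> f m) \<in> carrier W"
    using assms finite_subset[of "{m. \<ominus> f m \<noteq> \<zero>}" "{m. f m \<noteq> \<zero>}"] by (auto simp: carrier_W)
  moreover have "(\<lambda>m. \<ominus> f m) \<oplus>\<^bsub>W\<^esub> f = \<zero>\<^bsub>W\<^esub>" using assms by (auto simp: W_add W_zero carrier_W l_neg)
  ultimately show ?thesis using W.minus_equality assms by blast
qed

lemma subringI_coeffs:
  assumes "H \<subseteq> carrier W" "\<one>\<^bsub>W\<^esub> \<in> H"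
    "\<And>f. f \<in> H \<Longrightarrow> (\<lambda>m. \<ominus> f m) \<in> H" "\<And>f g. f \<in> H \<Longrightarrow> g \<in> H \<Longrightarrow> (\<lambda>m. f m \<oplus> g m) \<in> H"
    "\<And>f g. f \<in> H \<Longrightarrow> g \<in> H \<Longrightarrow> f \<otimes>\<^bsub>W\<^esub> g \<in> H"
  shows "subring H W"
proof (rule W.subringI)
  fix f assume "f \<in> H"
  then show "\<ominus>\<^bsub>W\<^esub> f \<in> H" using W_minus[of f] assms(1,3) by auto
qed (use assms in \<open>auto simp: W_add\<close>)

lemma finsum_W:
  assumes "F \<in> A \<rightarrow> carrier W"
  shows "(finsum W F A) m = finsum R (\<lambda>k. F k m) A"
  using assms
proof (induct A rule: infinite_finite_induct)
  case (insert x A)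
  then have "\<And>k. k \<in> insert x A \<Longrightarrow> F k m \<in> carrier R" by (auto simp: carrier_W Pi_def)
  then show ?case using insert by (simp add: W_add Pi_def)
qed (auto simp: W_zero)

end

lemma (in cring) monoid_ring_subring:
  fixes M :: "'m::cancel_comm_monoid_add set"
  assumes "0 \<in> M" "\<And>i j. i \<in> M \<Longrightarrow> j \<in> M \<Longrightarrow> i + j \<in> M"
  shows "subring (carrier (monoid_ring R M)) (monoid_ring R UNIV)"
proof -
  interpret full_monoid_ring R "monoid_ring R UNIV :: ('m \<Rightarrow> 'a) ring"
    by unfold_locales auto
  let ?W = "monoid_ring R UNIV :: ('m \<Rightarrow> 'a) ring"
  have H: "f \<in> carrier (monoid_ring R M) \<longleftrightarrow> f \<in> carrier ?W \<and> (\<forall>m. m \<notin> M \<longrightarrow> f m = \<zero>)" for f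
    by (auto simp: monoid_ring_def)
  show ?thesis
  proof (rule subringI_coeffs)
    fix f assume f: "f \<in> carrier (monoid_ring R M)"
    then have "(\<lambda>m. \<ominus> f m) \<in> carrier ?W" using W_minus[of f] W.a_inv_closed[of f] unfolding H by simp
    then show "(\<lambda>m. \<ominus> f m) \<in> carrier (monoid_ring R M)" using f by (auto simp: H)
    fix g assume g: "g \<in> carrier (monoid_ring R M)"
    show "(\<lambda>m. f m \<oplus> g m) \<in> carrier (monoid_ring R M)"
      using f g W.a_closed[of f g] by (auto simp: H W_add)
    have "(f \<otimes>\<^bsub>?W\<^esub> g) m = \<zero>" if "m \<notin> M" for m
    proof (rule ccontr)
      assume "(f \<otimes>\<^bsub>?W\<^esub> g) m \<noteq> \<zero>"
      then obtain i j where "f i \<noteq> \<zero>" "g j \<noteq> \<zero>" "m = i + j" using mult_nonzeroD by blast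
      then show False using f g assms(2)[of i j] that unfolding H by blast
    qed
    then show "f \<otimes>\<^bsub>?W\<^esub> g \<in> carrier (monoid_ring R M)" using f g by (auto simp: H)
  qed (use assms(1) W.one_closed in \<open>auto simp: H W_one\<close>)
qed

text \<open>Among the components of \<open>monoid_ring\<close>, only the carrier depends on
  \<open>M\<close>.\<close>

lemma monoid_ring_eq: "monoid_ring R M = (monoid_ring R UNIV)\<lparr>carrier := carrier (monoid_ring R M)\<rparr>"
  by (simp add: monoid_ring_def)

lemma (in cring) monoid_ring_is_cring:
  fixes M :: "'m::cancel_comm_monoid_add set"
  assumes "0 \<in> M" "\<And>i j. i \<in> M \<Longrightarrow> j \<in> M \<Longrightarrow> i + j \<in> M"
  shows "cring (monoid_ring R M)"
proof -
  interpret full_monoid_ring R "monoid_ring R UNIV :: ('m \<Rightarrow> 'a) ring"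
    by unfold_locales auto
  have "subcring (carrier (monoid_ring R M)) (monoid_ring R UNIV)"
    using monoid_ring_subring[OF assms] by (rule W.subcringI')
  then show ?thesis using W.subcring_iff[of "carrier (monoid_ring R M)"] monoid_ring_eq[of R M]
    by (auto simp: subcring_def dest: subringE(1))
qed

text \<open>At the sum of the two top exponents, a product has a single term, the product of the
  leading coefficients.\<close>

lemma (in "domain") laurent_domain: "domain (laurent_ring R)"
proof -
  interpret full_monoid_ring R "monoid_ring R UNIV :: (int \<Rightarrow> 'a) ring"
    by unfold_locales auto
  let ?W = "monoid_ring R UNIV :: (int \<Rightarrow> 'a) ring"
  have "domain ?W"
  proof (rule domainI[OF W.is_cring])
    show "\<one>\<^bsub>?W\<^esub> \<noteq> \<zero>\<^bsub>?W\<^esub>" by (auto simp: W_one W_zero fun_eq_iff intro!: exI[of _ 0])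
    fix f g assume fg: "f \<otimes>\<^bsub>?W\<^esub> g = \<zero>\<^bsub>?W\<^esub>" and f: "f \<in> carrier ?W" and g: "g \<in> carrier ?W"
    show "f = \<zero>\<^bsub>?W\<^esub> \<or> g = \<zero>\<^bsub>?W\<^esub>"
    proof (rule ccontr)
      let ?F = "{m. f m \<noteq> \<zero>}" and ?G = "{m. g m \<noteq> \<zero>}"
      assume "\<not> ?thesis"
      then have ne: "?F \<noteq> {}" "?G \<noteq> {}" by (auto simp: W_zero)
      have fin: "finite ?F" "finite ?G" using f g by (auto simp: carrier_W)
      define i where "i = Max ?F"
      define j where "j = Max ?G"
      have ij: "f i \<noteq> \<zero>" "g j \<noteq> \<zero>" using Max_in[OF fin(1) ne(1)] Max_in[OF fin(2) ne(2)]
        unfolding i_def j_def by auto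
      have le: "f k \<noteq> \<zero> \<Longrightarrow> k \<le> i" "g k \<noteq> \<zero> \<Longrightarrow> k \<le> j" for k
        using fin unfolding i_def j_def by auto
      have "{(i', j'). f i' \<noteq> \<zero> \<and> g j' \<noteq> \<zero> \<and> i' + j' = i + j} = {(i, j)}"
        using ij le by (auto, smt (verit) le, smt (verit) le)
      then have "(f \<otimes>\<^bsub>?W\<^esub> g) (i + j) = f i \<otimes> g j" unfolding W_mult
        using f g by (simp add: carrier_W)
      then show False using fg ij integral f g by (auto simp: W_zero carrier_W)
    qed
  qed
  then show ?thesis by (simp add: laurent_ring_def)
qed

section \<open>Localization of a domain\<close>

locale localized_domain = "domain" R + primeideal P R for R (structure) and P +
  fixes L defines L_def: "L \<equiv> localization R P"
begin

abbreviation "D \<equiv> carrier R - P"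
abbreviation "fr \<equiv> loc_frac R P"

lemma denominator_one: "\<one> \<in> D" using one_notin by simp
lemma denominator_mult: "s \<in> D \<Longrightarrow> u \<in> D \<Longrightarrow> s \<otimes> u \<in> D" using I_prime by auto
lemma denominator_nonzero: "s \<in> D \<Longrightarrow> s \<noteq> \<zero>" using zero_closed by auto

text \<open>The factor \<open>w\<close> is nonzero, being outside \<open>P\<close>, and can be
  cancelled in a domain.\<close>

lemma frac_rel_iff:
  "((a, s), (b, u)) \<in> frac_rel R P \<longleftrightarrow>
     a \<in> carrier R \<and> b \<in> carrier R \<and> s \<in> D \<and> u \<in> D \<and> a \<otimes> u = b \<otimes> s"
proof -
  have "(\<exists>w\<in>D. w \<otimes> (a \<otimes> u) = w \<otimes> (b \<otimes> s)) \<longleftrightarrow> a \<otimes> u = b \<otimes> s"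
    if "a \<in> carrier R" "b \<in> carrier R" "s \<in> D" "u \<in> D"
    using that denominator_one denominator_nonzero m_lcancel[of _ "a \<otimes> u" "b \<otimes> s"] by auto
  then show ?thesis unfolding frac_rel_def by auto
qed

lemma equiv_frac_rel: "equiv (carrier R \<times> D) (frac_rel R P)"
proof (rule equivI)
  show "frac_rel R P \<subseteq> (carrier R \<times> D) \<times> (carrier R \<times> D)" by (auto simp: frac_rel_iff)
  show "refl_on (carrier R \<times> D) (frac_rel R P)" by (auto simp: refl_on_def frac_rel_iff)
  show "sym (frac_rel R P)" by (auto simp: sym_def frac_rel_iff)
  show "trans (frac_rel R P)"
  proof (rule transI, clarify)
    fix a s b u c v
    assume 1: "((a, s), b, u) \<in> frac_rel R P" and 2: "((b, u), c, v) \<in> frac_rel R P"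
    then have c: "a \<in> carrier R" "b \<in> carrier R" "c \<in> carrier R" "s \<in> carrier R" "u \<in> carrier R" "v \<in> carrier R"
      and d: "s \<in> D" "u \<in> D" "v \<in> D" and e: "a \<otimes> u = b \<otimes> s" "b \<otimes> v = c \<otimes> u" by (auto simp: frac_rel_iff)
    have "u \<otimes> (a \<otimes> v) = (a \<otimes> u) \<otimes> v" using c by (simp add: m_ac)
    also have "\<dots> = (b \<otimes> v) \<otimes> s" unfolding e(1) using c by (simp add: m_ac)
    also have "\<dots> = u \<otimes> (c \<otimes> s)" unfolding e(2) using c by (simp add: m_ac)
    finally have "a \<otimes> v = c \<otimes> s" using c m_lcancel[of u "a \<otimes> v" "c \<otimes> s"] denominator_nonzero[OF d(2)] by auto
    then show "((a, s), c, v) \<in> frac_rel R P" using c d by (auto simp: frac_rel_iff)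
  qed
qed

lemma fr_eq_iff:
  assumes "a \<in> carrier R" "b \<in> carrier R" "s \<in> D" "u \<in> D"
  shows "fr a s = fr b u \<longleftrightarrow> a \<otimes> u = b \<otimes> s"
  using eq_equiv_class_iff[OF equiv_frac_rel, of "(a, s)" "(b, u)"] assms
  unfolding loc_frac_def by (simp add: frac_rel_iff)

lemma fr_mem: "(b, u) \<in> fr a s \<longleftrightarrow> a \<in> carrier R \<and> b \<in> carrier R \<and> s \<in> D \<and> u \<in> D \<and> a \<otimes> u = b \<otimes> s"
  unfolding loc_frac_def Image_singleton_iff frac_rel_iff ..

lemma carrier_L: "X \<in> carrier L \<longleftrightarrow> (\<exists>a\<in>carrier R. \<exists>s\<in>D. X = fr a s)"
  unfolding L_def localization_def loc_frac_def by (auto simp: quotient_def)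

lemma fr_closed: "a \<in> carrier R \<Longrightarrow> s \<in> D \<Longrightarrow> fr a s \<in> carrier L"
  unfolding carrier_L by blast

lemma carrier_LE:
  assumes "X \<in> carrier L" obtains a s where "a \<in> carrier R" "s \<in> carrier R" "s \<notin> P" "X = fr a s"
  using assms unfolding carrier_L by blast

text \<open>The operations of \<open>localization\<close> are unions over all pairs of
  representatives. Independence of the representatives collapses the union to a single
  class.\<close>

lemma fr_mult:
  assumes "a \<in> carrier R" "b \<in> carrier R" "s \<in> D" "u \<in> D"
  shows "fr a s \<otimes>\<^bsub>L\<^esub> fr b u = fr (a \<otimes> b) (s \<otimes> u)"
proof -
  have 1: "fr (a' \<otimes> b') (s' \<otimes> u') = fr (a \<otimes> b) (s \<otimes> u)" if "(a', s') \<in> fr a s" "(b', u') \<in> fr b u" for a' s' b' u'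
  proof -
    have c: "a' \<in> carrier R" "b' \<in> carrier R" "s' \<in> D" "u' \<in> D" "a \<otimes> s' = a' \<otimes> s" "b \<otimes> u' = b' \<otimes> u"
      using that by (auto simp: fr_mem)
    have "(a' \<otimes> b') \<otimes> (s \<otimes> u) = (a' \<otimes> s) \<otimes> (b' \<otimes> u)" using c assms by (simp add: m_ac)
    also have "\<dots> = (a \<otimes> b) \<otimes> (s' \<otimes> u')" unfolding c(5,6)[symmetric] using c(1-4) assms by (simp add: m_ac)
    finally show ?thesis using c assms denominator_mult by (subst fr_eq_iff) auto
  qed
  have 2: "(a, s) \<in> fr a s" "(b, u) \<in> fr b u" using assms by (auto simp: fr_mem)
  have "fr a s \<otimes>\<^bsub>L\<^esub> fr b u = (\<Union>(a, s)\<in>fr a s. \<Union>(b, u)\<in>fr b u. fr (a \<otimes> b) (s \<otimes> u))"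
    by (simp add: L_def localization_def)
  also have "\<dots> = fr (a \<otimes> b) (s \<otimes> u)" using 1 2 by fast
  finally show ?thesis .
qed

lemma fr_add:
  assumes "a \<in> carrier R" "b \<in> carrier R" "s \<in> D" "u \<in> D"
  shows "fr a s \<oplus>\<^bsub>L\<^esub> fr b u = fr (a \<otimes> u \<oplus> b \<otimes> s) (s \<otimes> u)"
proof -
  have 1: "fr (a' \<otimes> u' \<oplus> b' \<otimes> s') (s' \<otimes> u') = fr (a \<otimes> u \<oplus> b \<otimes> s) (s \<otimes> u)"
    if "(a', s') \<in> fr a s" "(b', u') \<in> fr b u" for a' s' b' u'
  proof -
    have c: "a' \<in> carrier R" "b' \<in> carrier R" "s' \<in> D" "u' \<in> D" "a \<otimes> s' = a' \<otimes> s" "b \<otimes> u' = b' \<otimes> u"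
      using that by (auto simp: fr_mem)
    have "(a' \<otimes> u' \<oplus> b' \<otimes> s') \<otimes> (s \<otimes> u) = (a' \<otimes> s) \<otimes> (u' \<otimes> u) \<oplus> (b' \<otimes> u) \<otimes> (s' \<otimes> s)"
      using c assms by (simp add: m_ac l_distr r_distr)
    also have "\<dots> = (a \<otimes> u \<oplus> b \<otimes> s) \<otimes> (s' \<otimes> u')"
      unfolding c(5,6)[symmetric] using c(1-4) assms by (simp add: m_ac l_distr r_distr)
    finally show ?thesis using c assms denominator_mult by (subst fr_eq_iff) auto
  qed
  have 2: "(a, s) \<in> fr a s" "(b, u) \<in> fr b u" using assms by (auto simp: fr_mem)
  have "fr a s \<oplus>\<^bsub>L\<^esub> fr b u = (\<Union>(a, s)\<in>fr a s. \<Union>(b, u)\<in>fr b u. fr (a \<otimes> u \<oplus> b \<otimes> s) (s \<otimes> u))"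
    by (simp add: L_def localization_def)
  also have "\<dots> = fr (a \<otimes> u \<oplus> b \<otimes> s) (s \<otimes> u)" using 1 2 by fast
  finally show ?thesis .
qed

lemma L_one: "\<one>\<^bsub>L\<^esub> = fr \<one> \<one>" and L_zero: "\<zero>\<^bsub>L\<^esub> = fr \<zero> \<one>"
  by (simp_all add: L_def localization_def)

lemma localization_domain: "domain L"
proof (rule domainI)
  have D': "s \<in> carrier R \<Longrightarrow> s \<notin> P \<Longrightarrow> u \<in> carrier R \<Longrightarrow> u \<notin> P \<Longrightarrow> s \<otimes> u \<notin> P" for s u
    using I_prime by blast
  show "cring L"
  proof (rule cringI)
    show "abelian_group L"
    proof (rule abelian_groupI)
      fix X Y Z assume X: "X \<in> carrier L" and Y: "Y \<in> carrier L" and Z: "Z \<in> carrier L"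
      obtain a s where a: "a \<in> carrier R" "s \<in> carrier R" "s \<notin> P" "X = fr a s" using carrier_LE[OF X] .
      obtain b u where b: "b \<in> carrier R" "u \<in> carrier R" "u \<notin> P" "Y = fr b u" using carrier_LE[OF Y] .
      obtain c v where c: "c \<in> carrier R" "v \<in> carrier R" "v \<notin> P" "Z = fr c v" using carrier_LE[OF Z] .
      show "X \<oplus>\<^bsub>L\<^esub> Y \<in> carrier L" using a b by (simp add: fr_add fr_closed D')
      show "X \<oplus>\<^bsub>L\<^esub> Y \<oplus>\<^bsub>L\<^esub> Z = X \<oplus>\<^bsub>L\<^esub> (Y \<oplus>\<^bsub>L\<^esub> Z)"
        using a b c by (simp add: fr_add D' l_distr r_distr m_ac a_ac)
      show "X \<oplus>\<^bsub>L\<^esub> Y = Y \<oplus>\<^bsub>L\<^esub> X" using a b by (simp add: fr_add D' m_ac a_ac)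
      show "\<zero>\<^bsub>L\<^esub> \<oplus>\<^bsub>L\<^esub> X = X" using a one_notin by (simp add: fr_add L_zero)
      have "fr (\<ominus> a) s \<oplus>\<^bsub>L\<^esub> X = \<zero>\<^bsub>L\<^esub>" 
        unfolding L_zero a(4) using a one_notin by (simp add: fr_add fr_eq_iff D' l_minus l_neg)
      then show "\<exists>Y\<in>carrier L. Y \<oplus>\<^bsub>L\<^esub> X = \<zero>\<^bsub>L\<^esub>" using a fr_closed[of "\<ominus> a" s] by auto
    qed (use one_notin in \<open>simp add: L_zero fr_closed\<close>)
    show "comm_monoid L"
    proof (rule comm_monoidI)
      fix X Y Z assume X: "X \<in> carrier L" and Y: "Y \<in> carrier L" and Z: "Z \<in> carrier L"
      obtain a s where a: "a \<in> carrier R" "s \<in> carrier R" "s \<notin> P" "X = fr a s" using carrier_LE[OF X] .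
      obtain b u where b: "b \<in> carrier R" "u \<in> carrier R" "u \<notin> P" "Y = fr b u" using carrier_LE[OF Y] .
      obtain c v where c: "c \<in> carrier R" "v \<in> carrier R" "v \<notin> P" "Z = fr c v" using carrier_LE[OF Z] .
      show "X \<otimes>\<^bsub>L\<^esub> Y \<in> carrier L" using a b by (simp add: fr_mult fr_closed D')
      show "X \<otimes>\<^bsub>L\<^esub> Y \<otimes>\<^bsub>L\<^esub> Z = X \<otimes>\<^bsub>L\<^esub> (Y \<otimes>\<^bsub>L\<^esub> Z)" using a b c by (simp add: fr_mult D' m_ac)
      show "X \<otimes>\<^bsub>L\<^esub> Y = Y \<otimes>\<^bsub>L\<^esub> X" using a b by (simp add: fr_mult m_ac)
      show "\<one>\<^bsub>L\<^esub> \<otimes>\<^bsub>L\<^esub> X = X" using a one_notin by (simp add: fr_mult L_one)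
    qed (use one_notin in \<open>simp add: L_one fr_closed\<close>)
    fix X Y Z assume X: "X \<in> carrier L" and Y: "Y \<in> carrier L" and Z: "Z \<in> carrier L"
    obtain a s where a: "a \<in> carrier R" "s \<in> carrier R" "s \<notin> P" "X = fr a s" using carrier_LE[OF X] .
    obtain b u where b: "b \<in> carrier R" "u \<in> carrier R" "u \<notin> P" "Y = fr b u" using carrier_LE[OF Y] .
    obtain c v where c: "c \<in> carrier R" "v \<in> carrier R" "v \<notin> P" "Z = fr c v" using carrier_LE[OF Z] .
    show "(X \<oplus>\<^bsub>L\<^esub> Y) \<otimes>\<^bsub>L\<^esub> Z = X \<otimes>\<^bsub>L\<^esub> Z \<oplus>\<^bsub>L\<^esub> Y \<otimes>\<^bsub>L\<^esub> Z"
      using a b c by (simp add: fr_mult fr_add fr_eq_iff D' l_distr r_distr m_ac)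
  qed
  show "\<one>\<^bsub>L\<^esub> \<noteq> \<zero>\<^bsub>L\<^esub>" using one_notin by (simp add: L_one L_zero fr_eq_iff)
  fix X Y assume XY: "X \<otimes>\<^bsub>L\<^esub> Y = \<zero>\<^bsub>L\<^esub>" and X: "X \<in> carrier L" and Y: "Y \<in> carrier L"
  obtain a s where a: "a \<in> carrier R" "s \<in> carrier R" "s \<notin> P" "X = fr a s" using carrier_LE[OF X] .
  obtain b u where b: "b \<in> carrier R" "u \<in> carrier R" "u \<notin> P" "Y = fr b u" using carrier_LE[OF Y] .
  have "a \<otimes> b = \<zero>" using XY a b one_notin by (simp add: fr_mult fr_eq_iff L_zero D')
  then have "a = \<zero> \<or> b = \<zero>" using integral a b by auto
  then show "X = \<zero>\<^bsub>L\<^esub> \<or> Y = \<zero>\<^bsub>L\<^esub>" using a b one_notin by (auto simp: fr_eq_iff L_zero)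
qed

end

sublocale localized_domain \<subseteq> L: "domain" L by (rule localization_domain)

context localized_domain
begin

lemma fr_hom: "ring_hom_ring R L (\<lambda>a. fr a \<one>)"
  by (rule ring_hom_ringI[OF ring_axioms L.ring_axioms])
    (use one_notin in \<open>auto simp: fr_closed fr_mult fr_add L_one\<close>)

sublocale frac: ring_hom_ring R L "\<lambda>a. fr a \<one>" by (rule fr_hom)

lemma fr_denominator:
  assumes "a \<in> carrier R" "s \<in> D" shows "fr s \<one> \<otimes>\<^bsub>L\<^esub> fr a s = fr a \<one>"
  using assms one_notin by (simp add: fr_mult fr_eq_iff m_ac)

lemma fr_factor:
  assumes "a \<in> carrier R" "s \<in> D" shows "fr a s = fr \<one> s \<otimes>\<^bsub>L\<^esub> fr a \<one>"
  using assms one_notin by (simp add: fr_mult)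

text \<open>\<open>fr s \<one>\<close> and \<open>fr \<one> s\<close> are mutually inverse units.
  Hence an ideal of \<open>L\<close> is determined by its contraction to \<open>R\<close>.\<close>

lemma ideal_fr_iff:
  assumes "ideal J L" "a \<in> carrier R" "s \<in> D"
  shows "fr a s \<in> J \<longleftrightarrow> fr a \<one> \<in> J"
proof
  assume "fr a s \<in> J"
  then show "fr a \<one> \<in> J" using ideal.I_l_closed[OF assms(1), of "fr a s" "fr s \<one>"] assms one_notin
    by (simp add: fr_denominator fr_closed)
next
  assume "fr a \<one> \<in> J"
  then show "fr a s \<in> J" using ideal.I_l_closed[OF assms(1), of "fr a \<one>" "fr \<one> s"] assms one_notin
    by (simp add: fr_factor[OF assms(2,3)] fr_closed)
qed

text \<open>Finitely many generators of the contraction of \<open>J\<close> generate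
  \<open>J\<close>, since membership of a fraction depends only on its numerator.\<close>

lemma localization_noetherian:
  assumes "noetherian_ring R" shows "noetherian_cring L"
proof -
  interpret N: noetherian_ring R by fact
  have "noetherian_ring L"
  proof (rule L.noetherian_ringI)
    fix J assume J: "ideal J L"
    obtain A where A: "A \<subseteq> carrier R" "finite A" "{r \<in> carrier R. fr r \<one> \<in> J} = Idl A"
      using N.finetely_gen[OF frac.ideal_vimage[OF J]] by auto
    let ?B = "(\<lambda>a. fr a \<one>) ` A"
    have B: "?B \<subseteq> carrier L" using A(1) by auto
    note IB = L.genideal_ideal[OF B]
    have "J = Idl\<^bsub>L\<^esub> ?B"
    proof
      show "Idl\<^bsub>L\<^esub> ?B \<subseteq> J" using genideal_self[OF A(1)] A(3) by (intro L.genideal_minimal J) auto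
      have "Idl A \<subseteq> {r \<in> carrier R. fr r \<one> \<in> Idl\<^bsub>L\<^esub> ?B}"
        using A(1) L.genideal_self[OF B] by (intro genideal_minimal frac.ideal_vimage IB) auto
      then have *: "fr a \<one> \<in> Idl\<^bsub>L\<^esub> ?B" if "a \<in> carrier R" "fr a \<one> \<in> J" for a using A(3) that by auto
      show "J \<subseteq> Idl\<^bsub>L\<^esub> ?B"
      proof
        fix X assume X: "X \<in> J"
        then obtain a s where a: "a \<in> carrier R" "s \<in> D" "X = fr a s"
          using ideal.Icarr[OF J] carrier_L by blast
        then show "X \<in> Idl\<^bsub>L\<^esub> ?B" using X * ideal_fr_iff[OF J a(1,2)] ideal_fr_iff[OF IB a(1,2)] by auto
      qed
    qed
    then show "\<exists>B\<subseteq>carrier L. finite B \<and> J = Idl\<^bsub>L\<^esub> B" using A(2) B by blast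
  qed
  then show ?thesis by (intro noetherian_cring.intro L.is_cring)
qed

text \<open>An element outside \<open>P\<close> becomes a unit of \<open>L\<close>, so no proper
  ideal contains its image.\<close>

lemma contraction_subset:
  assumes "primeideal J L" shows "{r \<in> carrier R. fr r \<one> \<in> J} \<subseteq> P"
proof (rule subsetI)
  fix r assume r: "r \<in> {r \<in> carrier R. fr r \<one> \<in> J}"
  show "r \<in> P"
  proof (rule ccontr)
    assume "r \<notin> P"
    then have "fr r \<one> \<otimes>\<^bsub>L\<^esub> fr \<one> r = \<one>\<^bsub>L\<^esub>" using r one_notin fr_denominator[of \<one> r] by simp
    moreover have "fr r \<one> \<otimes>\<^bsub>L\<^esub> fr \<one> r \<in> J"
      using r \<open>r \<notin> P\<close>
      by (intro ideal.I_r_closed[OF primeideal.axioms(1)[OF assms]]) (auto simp: fr_closed)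
    ultimately show False using primeideal.one_notin[OF assms] by simp
  qed
qed

lemma contraction_strict_mono:
  assumes "ideal I L" "ideal J L" "I \<subset> J"
  shows "{r \<in> carrier R. fr r \<one> \<in> I} \<subset> {r \<in> carrier R. fr r \<one> \<in> J}"
proof -
  obtain X where X: "X \<in> J" "X \<notin> I" using assms(3) by auto
  then obtain a s where a: "a \<in> carrier R" "s \<in> D" "X = fr a s"
    using ideal.Icarr[OF assms(2)] carrier_L by blast
  then have "fr a \<one> \<in> J" "fr a \<one> \<notin> I" using ideal_fr_iff[OF assms(1)] ideal_fr_iff[OF assms(2)] X by auto
  then show ?thesis using assms(3) a by auto
qed

text \<open>The fractions with numerator in \<open>I\<close> already form an ideal, so they exhaust
  the extension of \<open>I\<close>. This turns the definition of symbolic powers into a condition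
  inside \<open>R\<close>.\<close>

lemma fr_mem_extension:
  assumes I: "ideal I R" and a: "a \<in> carrier R" "fr a \<one> \<in> Idl\<^bsub>L\<^esub> ((\<lambda>x. fr x \<one>) ` I)"
  obtains s where "s \<in> D" "s \<otimes> a \<in> I"
proof -
  interpret I: ideal I R by fact
  let ?J = "{fr x s | x s. x \<in> I \<and> s \<in> D}"
  have D': "s \<in> carrier R \<Longrightarrow> s \<notin> P \<Longrightarrow> u \<in> carrier R \<Longrightarrow> u \<notin> P \<Longrightarrow> s \<otimes> u \<notin> P" for s u
    using I_prime by blast
  have "ideal ?J L"
  proof (rule L.idealI_cring)
    show "?J \<subseteq> carrier L" using I.Icarr fr_closed by auto
    show "\<zero>\<^bsub>L\<^esub> \<in> ?J" using one_notin I.zero_closed frac.hom_zero by (metis (mono_tags, lifting) denominator_one mem_Collect_eq)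
    fix X Y assume "X \<in> ?J" "Y \<in> ?J"
    then obtain x s y u where x: "x \<in> I" "s \<in> D" "X = fr x s" "y \<in> I" "u \<in> D" "Y = fr y u" by blast
    then have "X \<oplus>\<^bsub>L\<^esub> Y = fr (x \<otimes> u \<oplus> y \<otimes> s) (s \<otimes> u)" using I.Icarr by (simp add: fr_add)
    moreover have "x \<otimes> u \<oplus> y \<otimes> s \<in> I" using x I.I_r_closed I.a_closed by simp
    ultimately show "X \<oplus>\<^bsub>L\<^esub> Y \<in> ?J" using denominator_mult x by blast
  next
    fix X Y assume X: "X \<in> ?J" and Y: "Y \<in> carrier L"
    obtain x s where x: "x \<in> I" "s \<in> D" "X = fr x s" using X by blast
    obtain y u where y: "y \<in> carrier R" "u \<in> D" "Y = fr y u" using Y carrier_L by blast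
    have "Y \<otimes>\<^bsub>L\<^esub> X = fr (y \<otimes> x) (u \<otimes> s)" using x y I.Icarr by (simp add: fr_mult)
    moreover have "y \<otimes> x \<in> I" using x y I.I_l_closed by simp
    ultimately show "Y \<otimes>\<^bsub>L\<^esub> X \<in> ?J" using denominator_mult x y by blast
  qed
  then have "Idl\<^bsub>L\<^esub> ((\<lambda>x. fr x \<one>) ` I) \<subseteq> ?J" using denominator_one by (intro L.genideal_minimal) auto
  then obtain x s where x: "x \<in> I" "s \<in> D" "fr a \<one> = fr x s" using a(2) by blast
  then have "a \<otimes> s = x" using a(1) I.Icarr one_notin by (simp add: fr_eq_iff)
  then show thesis using that[of s] x a(1) m_comm by auto
qed

end

section \<open>Prime ideals of a polynomial ring\<close>

lemma (in ideal) finsum_mem: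
  "(\<And>i. i \<in> A \<Longrightarrow> f i \<in> I) \<Longrightarrow> finsum R f A \<in> I"
proof (induct A rule: infinite_finite_induct)
  case (insert x A)
  then have "f \<in> A \<rightarrow> carrier R" "f x \<in> carrier R" using Icarr by auto
  then show ?case using insert by simp
qed auto

definition contraction :: "('a, 'b) ring_scheme \<Rightarrow> (nat \<Rightarrow> 'a) set \<Rightarrow> 'a set" where
  "contraction R Q = {a \<in> carrier R. monom (UP R) a 0 \<in> Q}"

context UP_cring
begin

lemma const_hom: "ring_hom_ring R P (\<lambda>a. monom P a 0)"
  by (intro ring_hom_ringI2 const_ring_hom R.ring_axioms P.ring_axioms)

lemma contraction_prime: "primeideal Q P \<Longrightarrow> primeideal (contraction R Q) R"
  using ring_hom_ring.primeideal_vimage[OF const_hom R.is_cring] unfolding contraction_def P_def by simp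

lemma monom_as_mult: "a \<in> carrier R \<Longrightarrow> monom P a n = monom P \<one> n \<otimes>\<^bsub>P\<^esub> monom P a 0"
  using monom_mult[of \<one> a n 0] by simp

text \<open>Gauss's argument: if \<open>i\<close> and \<open>j\<close> are the least indices of
  coefficients of \<open>f\<close> and \<open>g\<close> outside \<open>p\<close>, then in the
  coefficient of the product at \<open>i + j\<close> every term but one lies in
  \<open>p\<close>.\<close>

lemma poly_extension_prime:
  assumes "primeideal p R" shows "primeideal (poly_extension R p) P"
proof -
  interpret p: primeideal p R by fact
  have mem: "f \<in> poly_extension R p \<longleftrightarrow> f \<in> carrier P \<and> (\<forall>n. coeff P f n \<in> p)" for f
    by (auto simp: poly_extension_def P_def)
  show ?thesis
  proof (rule primeidealI)
    show "ideal (poly_extension R p) P"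
    proof (rule P.idealI_cring)
      fix f g assume f: "f \<in> poly_extension R p" and g: "g \<in> carrier P"
      have "coeff P (g \<otimes>\<^bsub>P\<^esub> f) n \<in> p" for n
        using f g by (auto simp: mem intro!: p.finsum_mem p.I_l_closed)
      then show "g \<otimes>\<^bsub>P\<^esub> f \<in> poly_extension R p" using f g by (auto simp: mem simp del: coeff_mult)
    qed (auto simp: mem)
    show "carrier P \<noteq> poly_extension R p"
    proof
      assume eq: "carrier P = poly_extension R p"
      have "\<one>\<^bsub>P\<^esub> \<in> poly_extension R p" using eq by blast
      then have "coeff P \<one>\<^bsub>P\<^esub> 0 \<in> p" unfolding mem by blast
      then show False using p.one_notin by simp
    qed
    fix f g assume f: "f \<in> carrier P" and g: "g \<in> carrier P" and fg: "f \<otimes>\<^bsub>P\<^esub> g \<in> poly_extension R p"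
    show "f \<in> poly_extension R p \<or> g \<in> poly_extension R p"
    proof (rule ccontr)
      assume "\<not> ?thesis"
      then have ex: "\<exists>i. coeff P f i \<notin> p" "\<exists>j. coeff P g j \<notin> p" using f g by (auto simp: mem)
      define i where "i = (LEAST i. coeff P f i \<notin> p)"
      define j where "j = (LEAST j. coeff P g j \<notin> p)"
      have ij: "coeff P f i \<notin> p" "coeff P g j \<notin> p" unfolding i_def j_def by (rule LeastI_ex[OF ex(1)], rule LeastI_ex[OF ex(2)])
      have lt: "k < i \<Longrightarrow> coeff P f k \<in> p" "k < j \<Longrightarrow> coeff P g k \<in> p" for k
        unfolding i_def j_def using not_less_Least by blast+
      let ?t = "\<lambda>k. coeff P f k \<otimes> coeff P g (i + j - k)"
      have "{..i + j} = insert i ({..i + j} - {i})" by auto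
      then have "coeff P (f \<otimes>\<^bsub>P\<^esub> g) (i + j) = finsum R ?t (insert i ({..i + j} - {i}))"
        using f g by simp
      also have "\<dots> = coeff P f i \<otimes> coeff P g j \<oplus> finsum R ?t ({..i + j} - {i})"
        using f g by (subst R.finsum_insert) auto
      finally have eq: "coeff P (f \<otimes>\<^bsub>P\<^esub> g) (i + j) = coeff P f i \<otimes> coeff P g j \<oplus> finsum R ?t ({..i + j} - {i})" .
      have rest: "finsum R ?t ({..i + j} - {i}) \<in> p"
      proof (rule p.finsum_mem)
        fix k assume "k \<in> {..i + j} - {i}"
        then have "k < i \<or> i + j - k < j" by auto
        then show "?t k \<in> p" using lt f g p.I_l_closed p.I_r_closed by auto
      qed
      have "coeff P (f \<otimes>\<^bsub>P\<^esub> g) (i + j) \<in> p" using fg by (auto simp: mem simp del: coeff_mult)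
      then have "coeff P (f \<otimes>\<^bsub>P\<^esub> g) (i + j) \<ominus> finsum R ?t ({..i + j} - {i}) \<in> p"
        using rest by (rule p.minus_closed)
      moreover have "coeff P (f \<otimes>\<^bsub>P\<^esub> g) (i + j) \<ominus> finsum R ?t ({..i + j} - {i}) = coeff P f i \<otimes> coeff P g j"
        unfolding eq using f g p.Icarr[OF rest] by (simp add: R.minus_eq R.a_assoc R.r_neg del: coeff_mult)
      ultimately show False using p.I_prime[of "coeff P f i" "coeff P g j"] ij f g by auto
    qed
  qed (rule P.is_cring)
qed

lemma poly_extension_subset:
  assumes Q: "ideal Q P" and "p \<subseteq> contraction R Q" shows "poly_extension R p \<subseteq> Q"
proof
  interpret Q: ideal Q P by fact
  fix f assume "f \<in> poly_extension R p"
  then have f: "f \<in> carrier P" "\<And>n. coeff P f n \<in> p" by (auto simp: poly_extension_def P_def)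
  have "finsum P (\<lambda>i. monom P (coeff P f i) i) {..deg R f} \<in> Q"
  proof (rule Q.finsum_mem)
    fix i
    have "monom P (coeff P f i) 0 \<in> Q" using f(2)[of i] assms(2) by (auto simp: contraction_def P_def)
    then show "monom P (coeff P f i) i \<in> Q"
      using monom_as_mult[of "coeff P f i" i] f Q.I_l_closed by auto
  qed
  then show "f \<in> Q" using up_repr[OF f(1)] by simp
qed

lemma contraction_poly_extension:
  assumes "ideal p R" shows "contraction R (poly_extension R p) = p"
proof -
  interpret p: ideal p R by fact
  have "monom P a 0 \<in> poly_extension R p \<longleftrightarrow> a \<in> p" if "a \<in> carrier R" for a
  proof -
    have "(\<forall>n. coeff P (monom P a 0) n \<in> p) \<longleftrightarrow> a \<in> p"
    proof
      assume "\<forall>n. coeff P (monom P a 0) n \<in> p"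
      then have "coeff P (monom P a 0) 0 \<in> p" by blast
      then show "a \<in> p" using that by simp
    qed (use that in simp)
    then show ?thesis using that unfolding poly_extension_def P_def[symmetric] by simp
  qed
  then show ?thesis using p.Icarr unfolding contraction_def P_def[symmetric] by blast
qed

lemma poly_extension_strict_mono:
  assumes "ideal p R" "ideal q R" "p \<subset> q" shows "poly_extension R p \<subset> poly_extension R q"
proof -
  have "poly_extension R p \<subseteq> poly_extension R q" using assms(3) unfolding poly_extension_def by blast
  moreover have "poly_extension R p \<noteq> poly_extension R q"
  proof
    assume "poly_extension R p = poly_extension R q"
    then have "contraction R (poly_extension R p) = contraction R (poly_extension R q)" by (rule arg_cong)
    then have "p = q"
      unfolding contraction_poly_extension[OF assms(1)] contraction_poly_extension[OF assms(2)] .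
    then show False using assms(3) by simp
  qed
  ultimately show ?thesis by blast
qed

lemma coeff_zero_hom: "ring_hom_ring P R (\<lambda>f. coeff P f 0)"
  by (rule ring_hom_ringI[OF P.ring_axioms R.ring_axioms]) auto

text \<open>This prime is \<open>p + (X)\<close>, the preimage of \<open>p\<close> under setting
  \<open>X\<close> to zero. It supplies the extra link above \<open>p[X]\<close> in the lower bound
  for the dimension.\<close>

lemma constant_coeff_prime:
  assumes "primeideal p R" shows "primeideal {f \<in> carrier P. coeff P f 0 \<in> p} P"
  by (rule ring_hom_ring.primeideal_vimage[OF coeff_zero_hom P.is_cring assms])

lemma poly_extension_subset_constant:
  assumes "primeideal p R" shows "poly_extension R p \<subset> {f \<in> carrier P. coeff P f 0 \<in> p}"
proof -
  interpret p: primeideal p R by fact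
  have "monom P \<one> 1 \<in> {f \<in> carrier P. coeff P f 0 \<in> p}" by simp
  moreover have "coeff P (monom P \<one> 1) 1 \<notin> p" using p.one_notin by simp
  then have "monom P \<one> 1 \<notin> poly_extension R p" unfolding poly_extension_def P_def[symmetric] by blast
  moreover have "poly_extension R p \<subseteq> {f \<in> carrier P. coeff P f 0 \<in> p}"
    by (auto simp: poly_extension_def P_def)
  ultimately show ?thesis by blast
qed

text \<open>A degree bound that treats the zero polynomial as being below every degree, so that the
  bound 0 characterizes it; \<open>deg\<close> gives it the degree 0 like other constants.\<close>

definition low :: "nat \<Rightarrow> (nat \<Rightarrow> 'a) \<Rightarrow> bool" where
  "low n f \<longleftrightarrow> f \<in> carrier P \<and> (\<forall>i\<ge>n. coeff P f i = \<zero>)"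

lemma lowD: "low n f \<Longrightarrow> f \<in> carrier P" "low n f \<Longrightarrow> n \<le> i \<Longrightarrow> coeff P f i = \<zero>"
  by (auto simp: low_def)

lemma low_0: "low 0 f \<Longrightarrow> f = \<zero>\<^bsub>P\<^esub>"
  by (intro up_eqI) (auto simp: low_def)

lemma low_1: assumes "low (Suc 0) f" shows "f = monom P (coeff P f 0) 0"
proof (rule up_eqI)
  fix n show "coeff P f n = coeff P (monom P (coeff P f 0) 0) n"
    using assms by (cases n) (auto simp: low_def)
qed (use assms in \<open>auto simp: low_def\<close>)

lemma ex_low: "f \<in> carrier P \<Longrightarrow> \<exists>n. low n f"
  using deg_aboveD[of f] by (intro exI[of _ "Suc (deg R f)"]) (auto simp: low_def)

text \<open>One step of long division without inverses: after cross-multiplication by the two top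
  coefficients, the terms at \<open>n\<close> cancel.\<close>

lemma low_cancel:
  assumes h: "low (Suc d) h" and f: "low (Suc n) f" and dn: "d \<le> n"
  shows "low n (monom P (coeff P h d) 0 \<otimes>\<^bsub>P\<^esub> f \<ominus>\<^bsub>P\<^esub> monom P (coeff P f n) (n - d) \<otimes>\<^bsub>P\<^esub> h)"
proof -
  have c: "h \<in> carrier P" "f \<in> carrier P" using h f by (auto simp: low_def)
  have cc: "coeff P h i \<in> carrier R" "coeff P f i \<in> carrier R" for i using c by auto
  let ?u = "monom P (coeff P h d) 0 \<otimes>\<^bsub>P\<^esub> f" and ?v = "monom P (coeff P f n) (n - d) \<otimes>\<^bsub>P\<^esub> h"
  have uc: "?u \<in> carrier P" "?v \<in> carrier P" using c cc by auto
  have "coeff P (?u \<ominus>\<^bsub>P\<^esub> ?v) i = \<zero>" if i: "i \<ge> n" for i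
  proof -
    have 1: "coeff P ?u i = coeff P h d \<otimes> coeff P f i"
      using coeff_monom_mult[OF cc(1) c(2), of d 0 i] by simp
    have "i = (i - (n - d)) + (n - d)" using i dn by simp
    then have 2: "coeff P ?v i = coeff P f n \<otimes> coeff P h (i - (n - d))"
      using coeff_monom_mult[OF cc(2) c(1), of n "n - d" "i - (n - d)"] by simp
    have "coeff P (?u \<ominus>\<^bsub>P\<^esub> ?v) i = coeff P ?u i \<ominus> coeff P ?v i" using uc by (rule coeff_minus)
    also have "\<dots> = \<zero>"
    proof (cases "i = n")
      case True
      then show ?thesis unfolding 1 2 using dn cc by (simp add: R.minus_eq R.m_comm R.r_neg)
    next
      case False
      then have "coeff P f i = \<zero>" "coeff P h (i - (n - d)) = \<zero>"
        using i dn h f by (auto simp: low_def)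
      then show ?thesis unfolding 1 2 using cc by (simp add: R.minus_eq)
    qed
    finally show ?thesis .
  qed
  then show ?thesis using uc by (simp add: low_def)
qed

lemma low_add: "low n f \<Longrightarrow> low n g \<Longrightarrow> low n (f \<oplus>\<^bsub>P\<^esub> g)"
  by (simp add: low_def)

lemma low_const_mult:
  assumes "low n f" "b \<in> carrier R" shows "low n (monom P b 0 \<otimes>\<^bsub>P\<^esub> f)"
  using assms by (simp add: low_def monom_mult_is_smult del: coeff_mult)

lemma low_mono: "low m f \<Longrightarrow> m \<le> n \<Longrightarrow> low n f"
  by (auto simp: low_def)

lemma const_pow: "b \<in> carrier R \<Longrightarrow> monom P b 0 [^]\<^bsub>P\<^esub> (k::nat) = monom P (b [^] k) 0"
  by (induct k) (auto simp flip: monom_mult)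

text \<open>The top coefficient of \<open>h\<close> need not be invertible, so a power of it appears
  on the left. The bound on \<open>q\<close> is recorded because it drives a descent later
  on.\<close>

lemma pseudo_division:
  assumes h: "low (Suc d) h" and f: "low n f"
  shows "\<exists>k q r. monom P (coeff P h d) 0 [^]\<^bsub>P\<^esub> (k::nat) \<otimes>\<^bsub>P\<^esub> f = q \<otimes>\<^bsub>P\<^esub> h \<oplus>\<^bsub>P\<^esub> r \<and> low (n - d) q \<and> low d r"
  using f
proof (induct n arbitrary: f)
  case 0
  then show ?case using h
    by (intro exI[of _ 0] exI[of _ "\<zero>\<^bsub>P\<^esub>"] exI[of _ f]) (auto simp: low_def)
next
  case (Suc n)
  let ?B = "monom P (coeff P h d) 0"
  have hc: "h \<in> carrier P" "f \<in> carrier P" using h Suc.prems by (auto simp: low_def)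
  have Bc: "?B \<in> carrier P" using hc by simp
  show ?case
  proof (cases "d \<le> n")
    case False
    then have "low d f" using low_mono[OF Suc.prems, of d] by simp
    then show ?thesis using hc by (intro exI[of _ 0] exI[of _ "\<zero>\<^bsub>P\<^esub>"] exI[of _ f]) (auto simp: low_def)
  next
    case dn: True
    let ?m = "monom P (coeff P f n) (n - d)"
    have mc: "?m \<in> carrier P" using hc by simp
    let ?f = "?B \<otimes>\<^bsub>P\<^esub> f \<ominus>\<^bsub>P\<^esub> ?m \<otimes>\<^bsub>P\<^esub> h"
    obtain k q r where kqr: "?B [^]\<^bsub>P\<^esub> (k::nat) \<otimes>\<^bsub>P\<^esub> ?f = q \<otimes>\<^bsub>P\<^esub> h \<oplus>\<^bsub>P\<^esub> r" "low (n - d) q" "low d r"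
      using Suc.hyps[OF low_cancel[OF h Suc.prems dn]] by blast
    have qc: "q \<in> carrier P" "r \<in> carrier P" using kqr by (auto simp: low_def)
    let ?C = "?B [^]\<^bsub>P\<^esub> k"
    have Cc: "?C \<in> carrier P" using Bc by simp
    have "?C \<otimes>\<^bsub>P\<^esub> (?B \<otimes>\<^bsub>P\<^esub> f) = ?C \<otimes>\<^bsub>P\<^esub> (?f \<oplus>\<^bsub>P\<^esub> ?m \<otimes>\<^bsub>P\<^esub> h)"
      using P.minus_add_self[of "?B \<otimes>\<^bsub>P\<^esub> f" "?m \<otimes>\<^bsub>P\<^esub> h"] Bc hc mc by simp
    also have "\<dots> = ?C \<otimes>\<^bsub>P\<^esub> ?f \<oplus>\<^bsub>P\<^esub> ?C \<otimes>\<^bsub>P\<^esub> (?m \<otimes>\<^bsub>P\<^esub> h)"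
      using Bc hc mc Cc by (intro P.r_distr) auto
    also have "\<dots> = (q \<oplus>\<^bsub>P\<^esub> ?C \<otimes>\<^bsub>P\<^esub> ?m) \<otimes>\<^bsub>P\<^esub> h \<oplus>\<^bsub>P\<^esub> r"
      unfolding kqr(1) using qc hc mc Cc by (simp add: P.l_distr P.m_assoc P.a_ac)
    finally have "?B [^]\<^bsub>P\<^esub> Suc k \<otimes>\<^bsub>P\<^esub> f = (q \<oplus>\<^bsub>P\<^esub> ?C \<otimes>\<^bsub>P\<^esub> ?m) \<otimes>\<^bsub>P\<^esub> h \<oplus>\<^bsub>P\<^esub> r"
      using Bc hc Cc by (simp add: P.m_assoc)
    moreover have "low (Suc n - d) (q \<oplus>\<^bsub>P\<^esub> ?C \<otimes>\<^bsub>P\<^esub> ?m)"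
    proof (rule low_add)
      show "low (Suc n - d) q" using kqr(2) by (rule low_mono) simp
      have "low (Suc n - d) ?m" using hc dn by (auto simp: low_def)
      then show "low (Suc n - d) (?C \<otimes>\<^bsub>P\<^esub> ?m)" using hc by (simp add: const_pow low_const_mult)
    qed
    ultimately show ?thesis using kqr(3) by blast
  qed
qed

text \<open>Behind this is the polynomial ring in one variable over the fraction field of
  \<open>R\<close> modulo the common contraction, where nonzero primes are maximal. Denominators are
  avoided by pseudo-division by an \<open>h\<close> of least degree in \<open>Q2 - Q0\<close>, whose
  top coefficient \<open>b\<close> is outside all three primes. If \<open>h\<close> is in
  \<open>Q1\<close> then \<open>Q2 \<subseteq> Q1\<close>; otherwise
  \<open>Q1 \<subseteq> Q0\<close>.\<close>

lemma no_three_primes_over_same: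
  assumes Q: "primeideal Q0 P" "primeideal Q1 P" "primeideal Q2 P" and lt: "Q0 \<subset> Q1" "Q1 \<subset> Q2"
    and contr: "contraction R Q2 \<subseteq> contraction R Q0"
  shows False
proof -
  interpret Q0: primeideal Q0 P by fact
  interpret Q1: primeideal Q1 P by fact
  interpret Q2: primeideal Q2 P by fact
  \<comment> \<open>The least such \<open>e\<close> is one more than the least degree occurring in
    \<open>Q2 - Q0\<close>; an element of \<open>Q2\<close> with a smaller bound lies in
    \<open>Q0\<close>.\<close>
  define E where "E e \<longleftrightarrow> (\<exists>h\<in>Q2 - Q0. low e h)" for e
  obtain h0 where h0: "h0 \<in> Q2 - Q0" using lt by blast
  then obtain e0 where "low e0 h0" using ex_low[of h0] Q2.Icarr by auto
  then have "\<exists>e. E e" unfolding E_def using h0 by blast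
  define e where "e = (LEAST e. E e)"
  have "E e" unfolding e_def using \<open>\<exists>e. E e\<close> by (rule LeastI_ex)
  have min: "f \<in> Q0" if "f \<in> Q2" "low n f" "n < e" for f n
    using not_less_Least[of n E] that unfolding e_def E_def by blast
  obtain h where h: "h \<in> Q2" "h \<notin> Q0" "low e h" using \<open>E e\<close> unfolding E_def by blast
  have hc: "h \<in> carrier P" using h by (auto simp: low_def)
  have "e \<noteq> 0"
  proof
    assume "e = 0"
    then have "h = \<zero>\<^bsub>P\<^esub>" using h(3) by (intro low_0) simp
    then show False using h(2) Q0.zero_closed by simp
  qed
  \<comment> \<open>Here \<open>h\<close> would be a constant in \<open>Q2\<close> outside
    \<open>Q0\<close>, against \<open>contr\<close>.\<close>
  have "e \<noteq> Suc 0"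
  proof
    assume "e = Suc 0"
    then have eq: "h = monom P (coeff P h 0) 0" using low_1 h by simp
    then have "coeff P h 0 \<in> contraction R Q2" using h hc by (simp add: contraction_def P_def[symmetric])
    then have "coeff P h 0 \<in> contraction R Q0" using contr by blast
    then show False using eq h by (simp add: contraction_def P_def[symmetric])
  qed
  then obtain d where d: "e = Suc d" "0 < d" using \<open>e \<noteq> 0\<close> by (cases e) auto
  let ?b = "coeff P h d"
  let ?B = "monom P ?b 0"
  have Bc: "?B \<in> carrier P" using hc by simp
  \<comment> \<open>Otherwise the top term of \<open>h\<close> is in \<open>Q0\<close>, and removing
    it leaves an element of \<open>Q2\<close> of smaller degree, which is in \<open>Q0\<close> by
    minimality. Then \<open>h\<close> would be in \<open>Q0\<close> too.\<close>
  have B0: "?B \<notin> Q0"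
  proof
    assume B: "?B \<in> Q0"
    have m: "monom P ?b d \<in> Q0" using monom_as_mult[of ?b d] hc B Q0.I_l_closed by simp
    then have m2: "monom P ?b d \<in> Q2" using lt by blast
    let ?h = "h \<ominus>\<^bsub>P\<^esub> monom P ?b d"
    have low_h: "coeff P ?h i = \<zero>" if "i \<ge> d" for i
    proof -
      have "coeff P ?h i = coeff P h i \<ominus> coeff P (monom P ?b d) i" using hc by (intro coeff_minus) auto
      then show ?thesis using that h(3) hc d
        by (cases "i = d") (auto simp: low_def R.minus_eq R.r_neg)
    qed
    have "low d ?h" unfolding low_def
      by (intro conjI allI impI low_h P.minus_closed hc monom_closed coeff_closed)
    moreover have "?h \<in> Q2" using h(1) m2 by (rule Q2.minus_closed)
    ultimately have "?h \<in> Q0" using min[of ?h d] d by simp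
    then have "?h \<oplus>\<^bsub>P\<^esub> monom P ?b d \<in> Q0" using m by simp
    then show False using P.minus_add_self[of h "monom P ?b d"] hc h by simp
  qed
  have B2: "?B \<notin> Q2"
  proof
    assume "?B \<in> Q2"
    then have "?b \<in> contraction R Q2" using hc by (simp add: contraction_def P_def[symmetric])
    then have "?b \<in> contraction R Q0" using contr by blast
    then show False using B0 by (simp add: contraction_def P_def[symmetric])
  qed
  then have B1: "?B \<notin> Q1" using lt by blast
  \<comment> \<open>The remainder lies in \<open>Q2\<close> and below the minimal degree, hence in
    \<open>Q0\<close>. So modulo \<open>Q0\<close>, and up to powers of \<open>b\<close>, every
    element of \<open>Q2\<close> is a multiple of \<open>h\<close>.\<close>
  have div: "\<exists>k q r. ?B [^]\<^bsub>P\<^esub> (k::nat) \<otimes>\<^bsub>P\<^esub> f = q \<otimes>\<^bsub>P\<^esub> h \<oplus>\<^bsub>P\<^esub> r \<and> low (n - d) q \<and> r \<in> Q0"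
    if f: "f \<in> Q2" "low n f" for f n
  proof -
    obtain k q r where kqr: "?B [^]\<^bsub>P\<^esub> (k::nat) \<otimes>\<^bsub>P\<^esub> f = q \<otimes>\<^bsub>P\<^esub> h \<oplus>\<^bsub>P\<^esub> r" "low (n - d) q" "low d r"
      using pseudo_division[OF h(3)[unfolded d(1)] f(2)] by blast
    have c: "q \<in> carrier P" "r \<in> carrier P" using kqr by (auto simp: low_def)
    have "?B [^]\<^bsub>P\<^esub> k \<otimes>\<^bsub>P\<^esub> f \<ominus>\<^bsub>P\<^esub> q \<otimes>\<^bsub>P\<^esub> h \<in> Q2"
      using f h c Bc by (intro Q2.minus_closed Q2.I_l_closed) auto
    moreover have "?B [^]\<^bsub>P\<^esub> k \<otimes>\<^bsub>P\<^esub> f \<ominus>\<^bsub>P\<^esub> q \<otimes>\<^bsub>P\<^esub> h = r"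
      unfolding kqr(1) using c hc by (simp add: P.minus_eq P.a_ac P.r_neg1 P.r_neg2 P.r_neg)
    ultimately have "r \<in> Q0" using min[OF _ kqr(3)] d by simp
    then show ?thesis using kqr by blast
  qed
  have prime_cancel: "f \<in> Q" if "primeideal Q P" "?B \<notin> Q" "f \<in> carrier P" "?B [^]\<^bsub>P\<^esub> (k::nat) \<otimes>\<^bsub>P\<^esub> f \<in> Q" for Q f k
    using primeideal.I_prime[OF that(1), of "?B [^]\<^bsub>P\<^esub> k" f] primeideal.pow_notin[OF that(1) Bc that(2), of k]
      that Bc by auto
  show False
  proof (cases "h \<in> Q1")
    case True
    have "f \<in> Q1" if f: "f \<in> Q2" for f
    proof -
      have fc: "f \<in> carrier P" using f Q2.Icarr by auto
      then obtain n where n: "low n f" using ex_low by blast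
      obtain k q r where kqr: "?B [^]\<^bsub>P\<^esub> (k::nat) \<otimes>\<^bsub>P\<^esub> f = q \<otimes>\<^bsub>P\<^esub> h \<oplus>\<^bsub>P\<^esub> r" "low (n - d) q" "r \<in> Q0"
        using div[OF f n] by blast
      have "?B [^]\<^bsub>P\<^esub> k \<otimes>\<^bsub>P\<^esub> f \<in> Q1" unfolding kqr(1)
        using True kqr lt lowD(1)[OF kqr(2)] by (intro Q1.a_closed Q1.I_l_closed) auto
      then show ?thesis using prime_cancel[OF Q(2) B1 fc] by blast
    qed
    then show False using lt by blast
  next
    case False
    \<comment> \<open>Descent on the bound: \<open>q h\<close> is in \<open>Q1\<close> and
      \<open>h\<close> is not, so \<open>q\<close> is in \<open>Q1\<close>, with the bound
      \<open>n - d\<close>. This is smaller than \<open>n\<close> because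
      \<open>0 < d\<close>.\<close>
    have "f \<in> Q0" if "f \<in> Q1" "low n f" for f n
      using that
    proof (induct n arbitrary: f rule: less_induct)
      case (less n)
      have fc: "f \<in> carrier P" using less.prems(1) Q1.Icarr by auto
      have f2: "f \<in> Q2" using less.prems(1) lt by blast
      show ?case
      proof (cases "n = 0")
        case True
        then have "f = \<zero>\<^bsub>P\<^esub>" using less.prems(2) by (intro low_0) simp
        then show ?thesis using Q0.zero_closed by simp
      next
        case n: False
        obtain k q r where kqr: "?B [^]\<^bsub>P\<^esub> (k::nat) \<otimes>\<^bsub>P\<^esub> f = q \<otimes>\<^bsub>P\<^esub> h \<oplus>\<^bsub>P\<^esub> r" "low (n - d) q" "r \<in> Q0"
          using div[OF f2 less.prems(2)] by blast
        have c: "q \<in> carrier P" "r \<in> carrier P" using lowD(1)[OF kqr(2)] Q0.Icarr[OF kqr(3)] by auto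
        have "?B [^]\<^bsub>P\<^esub> k \<otimes>\<^bsub>P\<^esub> f \<ominus>\<^bsub>P\<^esub> r \<in> Q1"
          using less.prems kqr(3) lt Bc by (intro Q1.minus_closed Q1.I_l_closed) auto
        moreover have "?B [^]\<^bsub>P\<^esub> k \<otimes>\<^bsub>P\<^esub> f \<ominus>\<^bsub>P\<^esub> r = q \<otimes>\<^bsub>P\<^esub> h"
          unfolding kqr(1) using c hc by (simp add: P.minus_eq P.a_assoc P.r_neg)
        ultimately have "q \<in> Q1" using Q1.I_prime[of q h] False c hc by auto
        then have "q \<in> Q0" using less.hyps[OF _ _ kqr(2)] n d by auto
        then have "?B [^]\<^bsub>P\<^esub> k \<otimes>\<^bsub>P\<^esub> f \<in> Q0" unfolding kqr(1)
          using kqr(3) hc by (intro Q0.a_closed Q0.I_r_closed) auto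
        then show ?thesis using prime_cancel[OF Q(1) B0 fc] by blast
      qed
    qed
    then have "Q1 \<subseteq> Q0" using ex_low[OF Q1.Icarr] by blast
    then show False using lt by blast
  qed
qed

end

section \<open>Krull dimension of polynomial rings\<close>

text \<open>A constant of the top prime that is not in the bottom one is shifted into the second
  prime. The contractions of the first two primes then differ, and the induction continues with the
  tail. Only the last link may be lost, which is the 1 in \<open>m \<le> Suc k\<close>. The clause
  on \<open>c 0\<close> allows the contracted bottom prime to be prepended.\<close>

lemma (in noetherian_cring) prime_chain_contraction:
  assumes "prime_chain (UP R) Q m"
  shows "\<exists>c k. prime_chain R c k \<and> c 0 = contraction R (Q 0) \<and> m \<le> Suc k"
  using assms
proof (induct m arbitrary: Q)
  interpret U: UP_cring R "UP R" by unfold_locales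
  case 0
  then show ?case using U.contraction_prime
    by (intro exI[of _ "\<lambda>_. contraction R (Q 0)"] exI[of _ 0]) (auto simp: prime_chain_def)
next
  interpret U: UP_cring R "UP R" by unfold_locales
  interpret UN: noetherian_cring "UP R" by (rule UP_noetherian)
  case (Suc n)
  have pr: "primeideal (Q i) (UP R)" if "i \<le> Suc n" for i using Suc.prems that by (simp add: prime_chain_def)
  show ?case
  proof (cases n)
    case 0
    then show ?thesis using U.contraction_prime[OF pr[of 0]]
      by (intro exI[of _ "\<lambda>_. contraction R (Q 0)"] exI[of _ 0]) (auto simp: prime_chain_def)
  next
    case n: (Suc n')
    have lt: "Q 0 \<subset> Q 1" "Q 1 \<subset> Q 2" using Suc.prems n by (auto simp: prime_chain_def numeral_2_eq_2)
    have "Q 2 \<subseteq> Q (Suc n)" using n by (intro prime_chain_mono[OF Suc.prems]) auto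
    then have le: "contraction R (Q 2) \<subseteq> contraction R (Q (Suc n))" by (auto simp: contraction_def)
    \<comment> \<open>Otherwise the three lowest primes of the chain would all have the same
      contraction.\<close>
    have "\<not> contraction R (Q (Suc n)) \<subseteq> contraction R (Q 0)"
      using U.no_three_primes_over_same[OF pr pr pr lt] le n by auto
    then obtain a where a: "a \<in> contraction R (Q (Suc n))" "a \<notin> contraction R (Q 0)" by blast
    then have aQ: "monom (UP R) a 0 \<in> Q (Suc n)" "a \<in> carrier R" by (auto simp: contraction_def)
    obtain d where d: "prime_chain (UP R) d (Suc n)" "d 0 = Q 0" "monom (UP R) a 0 \<in> d 1"
      using UN.prime_chain_shift[OF Suc.prems aQ(1)] by metis
    obtain c k where c: "prime_chain R c k" "c 0 = contraction R (d (Suc 0))" "n \<le> Suc k"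
      using Suc.hyps[OF prime_chain_tl[OF d(1)]] by auto
    have "d 0 \<subset> d 1" using d(1) by (simp add: prime_chain_def)
    then have "contraction R (Q 0) \<subset> c 0" using a(2) aQ(2) d(2,3) c(2) by (auto simp: contraction_def)
    then have "prime_chain R (case_nat (contraction R (Q 0)) c) (Suc k)"
      by (intro prime_chain_Cons c(1) U.contraction_prime pr) auto
    then show ?thesis using c(3) by (intro exI[of _ "case_nat (contraction R (Q 0)) c"] exI[of _ "Suc k"]) auto
  qed
qed

lemma prime_chain_le_krull_dim: "prime_chain R c n \<Longrightarrow> enat n \<le> krull_dim R"
  unfolding krull_dim_def by (intro Sup_upper) blast

lemma krull_dim_leI: "(\<And>c n. prime_chain R c n \<Longrightarrow> enat n \<le> d) \<Longrightarrow> krull_dim R \<le> d"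
  unfolding krull_dim_def by (intro Sup_least) blast

lemma (in noetherian_cring) krull_dim_UP:
  assumes "domain R" shows "krull_dim (UP R) = krull_dim R + 1"
proof (rule antisym)
  interpret U: UP_cring R "UP R" by unfold_locales
  show "krull_dim (UP R) \<le> krull_dim R + 1"
  proof (rule krull_dim_leI)
    fix Q m assume "prime_chain (UP R) Q m"
    then obtain c k where c: "prime_chain R c k" "m \<le> Suc k" using prime_chain_contraction by blast
    have "enat m \<le> enat k + 1" using c(2) by (simp add: one_enat_def)
    also have "\<dots> \<le> krull_dim R + 1" using prime_chain_le_krull_dim[OF c(1)] by (rule add_right_mono)
    finally show "enat m \<le> krull_dim R + 1" .
  qed
  \<comment> \<open>Extension to \<open>R[X]\<close> keeps the chain strict, and
    \<open>c n + (X)\<close> is one more prime above the last extension.\<close>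
  have lift: "enat (Suc n) \<le> krull_dim (UP R)" if c: "prime_chain R c n" for c n
  proof -
    have pr: "primeideal (c i) R" if "i \<le> n" for i using c that by (simp add: prime_chain_def)
    have "prime_chain (UP R) (\<lambda>i. poly_extension R (c i)) n"
      unfolding prime_chain_def
    proof (intro conjI allI impI)
      fix i assume "i < n"
      then show "poly_extension R (c i) \<subset> poly_extension R (c (Suc i))"
        using c by (intro U.poly_extension_strict_mono primeideal.axioms(1) pr) (auto simp: prime_chain_def)
    qed (intro U.poly_extension_prime pr)
    then have "prime_chain (UP R) ((\<lambda>i. poly_extension R (c i))(Suc n := {f \<in> carrier (UP R). coeff (UP R) f 0 \<in> c n})) (Suc n)"
      by (intro prime_chain_snoc U.constant_coeff_prime U.poly_extension_subset_constant pr) auto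
    then show ?thesis by (rule prime_chain_le_krull_dim)
  qed
  show "krull_dim R + 1 \<le> krull_dim (UP R)"
  proof (cases "krull_dim (UP R)")
    case (enat N)
    \<comment> \<open>The zero ideal alone is a chain, so \<open>N\<close> is a successor and the
      added 1 can be cancelled on both sides.\<close>
    have "prime_chain R (\<lambda>_. {\<zero>}) 0" using domain.zeroprimeideal[OF assms] by (simp add: prime_chain_def)
    from lift[OF this] obtain N' where N: "N = Suc N'" unfolding enat by (cases N) auto
    have "krull_dim R \<le> enat N'"
    proof (rule krull_dim_leI)
      fix c n assume "prime_chain R c n"
      from lift[OF this] show "enat n \<le> enat N'" unfolding enat N by simp
    qed
    then have "krull_dim R + 1 \<le> enat N' + 1" by (rule add_right_mono)
    then show ?thesis unfolding enat N by (simp add: one_enat_def)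
  qed simp
qed

section \<open>Primes of height one and S-domains\<close>

lemma height_eq_1D:
  assumes "height R P = 1"
  shows "\<And>c n. prime_chain R c n \<Longrightarrow> c n = P \<Longrightarrow> n \<le> 1" "\<exists>Q. primeideal Q R \<and> Q \<subset> P"
proof -
  show le: "n \<le> 1" if "prime_chain R c n" "c n = P" for c n
  proof -
    have "enat n \<le> height R P" unfolding height_def using that by (intro Sup_upper) blast
    then show ?thesis unfolding assms by (simp add: one_enat_def)
  qed
  show "\<exists>Q. primeideal Q R \<and> Q \<subset> P"
  proof (rule ccontr)
    assume no: "\<not> ?thesis"
    have "n = 0" if c: "prime_chain R c n" "c n = P" for c n
    proof (cases n)
      case (Suc k)
      then have "primeideal (c k) R" "c k \<subset> P" using c by (auto simp: prime_chain_def)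
      then show ?thesis using no by blast
    qed
    then have "height R P \<le> 0" unfolding height_def by (intro Sup_least) (auto simp: zero_enat_def)
    then show False unfolding assms by simp
  qed
qed

lemma height_eq_1I:
  assumes "\<And>c n. prime_chain R c n \<Longrightarrow> c n = P \<Longrightarrow> n \<le> 1"
    "primeideal Q R" "primeideal P R" "Q \<subset> P"
  shows "height R P = 1"
proof (rule antisym)
  show "height R P \<le> 1" unfolding height_def
    by (intro Sup_least) (auto simp: one_enat_def dest: assms(1))
  have "prime_chain R (case_nat Q (\<lambda>_. P)) 1" using assms(2-4) by (auto simp: prime_chain_def split: nat.split)
  then have "enat 1 \<le> height R P" unfolding height_def by (intro Sup_upper) (auto intro!: exI[of _ "case_nat Q (\<lambda>_. P)"])
  then show "1 \<le> height R P" by (simp add: one_enat_def)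
qed

theorem noetherian_domain_is_S_domain:
  fixes R (structure)
  assumes "noetherian_domain R" shows "S_domain R"
proof -
  interpret noetherian_domain R by fact
  interpret NC: noetherian_cring R by (rule is_noetherian_cring)
  interpret U: UP_domain R "UP R" by unfold_locales
  interpret UN: noetherian_cring "UP R" by (rule NC.UP_noetherian)
  have "height (UP R) (poly_extension R P) = 1" if P: "primeideal P R" and h: "height R P = 1" for P
  proof -
    obtain Q where Q: "primeideal Q R" "Q \<subset> P" using height_eq_1D(2)[OF h] by blast
    have zQ: "{\<zero>} \<subset> P" using Q additive_subgroup.zero_closed[OF ideal.axioms(1)[OF primeideal.axioms(1)[OF Q(1)]]] by blast
    show ?thesis
    proof (rule height_eq_1I)
      show "primeideal (poly_extension R Q) (UP R)" "primeideal (poly_extension R P) (UP R)"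
        using U.poly_extension_prime Q P by blast+
      show "poly_extension R Q \<subset> poly_extension R P"
        using Q P by (intro U.poly_extension_strict_mono primeideal.axioms(1))
      fix c n assume c: "prime_chain (UP R) c n" "c n = poly_extension R P"
      show "n \<le> 1"
      proof (rule ccontr)
        assume "\<not> n \<le> 1"
        then have "n = Suc (Suc (n - 2))" by arith
        then obtain k where n: "n = Suc (Suc k)" ..
        have cPE: "contraction R (poly_extension R P) = P"
          by (rule U.contraction_poly_extension[OF primeideal.axioms(1)[OF P]])
        obtain a where a: "a \<in> P" "a \<noteq> \<zero>" using zQ by blast
        have ac: "a \<in> carrier R" using a ideal.Icarr[OF primeideal.axioms(1)[OF P]] by blast
        have "a \<in> contraction R (poly_extension R P)" unfolding cPE by (rule a(1))
        then have aP: "monom (UP R) a 0 \<in> c (Suc (Suc k))" using c(2) n by (simp add: contraction_def)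
        obtain d where d: "prime_chain (UP R) d (Suc (Suc k))" "d (Suc (Suc k)) = poly_extension R P" "monom (UP R) a 0 \<in> d 1"
          by (rule UN.prime_chain_shift[of c "Suc k", OF c(1)[unfolded n] aP]) (use c(2) n in auto)
        have d1: "primeideal (d 1) (UP R)" "d 1 \<subset> d 2" using d(1) by (auto simp: prime_chain_def numeral_2_eq_2)
        have "d 2 \<subseteq> d (Suc (Suc k))" by (rule prime_chain_mono[OF d(1)]) auto
        then have dP: "d 1 \<subset> poly_extension R P" using d1 d(2) by blast
        let ?p = "contraction R (d 1)"
        have p: "primeideal ?p R" by (rule U.contraction_prime[OF d1(1)])
        have "?p \<subseteq> contraction R (poly_extension R P)" using dP unfolding contraction_def by blast
        then have pP: "?p \<subseteq> P" unfolding cPE .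
        have ap: "a \<in> ?p" using d(3) ac by (simp add: contraction_def)
        \<comment> \<open>A strict inclusion would give the chain
          \<open>{\<zero>} \<subset> ?p \<subset> P\<close>, whose first link is strict by
          \<open>a\<close>. Hence \<open>d 1\<close> contracts to \<open>P\<close> and contains
          \<open>P[X]\<close>, although it was chosen strictly below it.\<close>
        have "\<not> ?p \<subset> P"
        proof
          assume lt: "?p \<subset> P"
          have "prime_chain R (case_nat {\<zero>} (case_nat ?p (\<lambda>_. P))) 2"
            using zeroprimeideal p P lt ap a(2) additive_subgroup.zero_closed[OF ideal.axioms(1)[OF primeideal.axioms(1)[OF p]]]
            by (auto simp: prime_chain_def less_Suc_eq numeral_2_eq_2 split: nat.split)
          then show False using height_eq_1D(1)[OF h] by (fastforce simp: numeral_2_eq_2)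
        qed
        then have "?p = P" using pP by blast
        then have "poly_extension R P \<subseteq> d 1"
          using U.poly_extension_subset[OF primeideal.axioms(1)[OF d1(1)], of P] by simp
        then show False using dP by blast
      qed
    qed
  qed
  then show ?thesis unfolding S_domain_def using domain_axioms by blast
qed

theorem (in noetherian_cring) noetherian_strong_S_ring: "strong_S_ring R"
  unfolding strong_S_ring_def
proof (intro conjI allI impI is_cring)
  fix P assume P: "primeideal P R"
  interpret P: primeideal P R by fact
  have "noetherian_ring (R Quot P)"
  proof (rule noetherian_ring_surj[OF P.rcos_ring_hom_ring noetherian_ring_axioms])
    show "(+>) P ` carrier R = carrier (R Quot P)" by (auto simp: FactRing_def A_RCOSETS_def')
  qed
  then show "S_domain (R Quot P)"
    using P.quotient_is_domain by (intro noetherian_domain_is_S_domain noetherian_domain.intro)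
qed

section \<open>Invariance of the Krull dimension\<close>

lemma krull_dim_surj:
  assumes "ring_hom_ring R S h" "cring R" "h ` carrier R = carrier S"
  shows "krull_dim S \<le> krull_dim R"
proof (rule krull_dim_leI)
  interpret h: ring_hom_ring R S h by fact
  fix c n assume c: "prime_chain S c n"
  have pr: "primeideal (c i) S" if "i \<le> n" for i using c that by (simp add: prime_chain_def)
  have "prime_chain R (\<lambda>i. {r \<in> carrier R. h r \<in> c i}) n"
    unfolding prime_chain_def
  proof (intro conjI allI impI)
    fix i assume "i \<le> n"
    then show "primeideal {r \<in> carrier R. h r \<in> c i} R" by (intro h.primeideal_vimage assms(2) pr)
  next
    fix i assume i: "i < n"
    then have lt: "c i \<subset> c (Suc i)" using c by (simp add: prime_chain_def)
    then obtain y where y: "y \<in> c (Suc i)" "y \<notin> c i" by blast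
    then have "y \<in> carrier S" using ideal.Icarr[OF primeideal.axioms(1)[OF pr[of "Suc i"]]] i by auto
    then obtain r where "r \<in> carrier R" "y = h r" using assms(3) by blast
    then show "{r \<in> carrier R. h r \<in> c i} \<subset> {r \<in> carrier R. h r \<in> c (Suc i)}" using y lt by blast
  qed
  then show "enat n \<le> krull_dim R" by (rule prime_chain_le_krull_dim)
qed

lemma krull_dim_iso:
  assumes "h \<in> ring_iso R S" "cring R" "cring S" shows "krull_dim R = krull_dim S"
proof (rule antisym)
  \<comment> \<open>Stated for fresh types, since it is applied both to \<open>h\<close> and to its
    inverse.\<close>
  have surj: "krull_dim S \<le> krull_dim R" if "h \<in> ring_iso R S" "cring R" "cring S"
    for h :: "'x \<Rightarrow> 'y" and R :: "('x, 'p) ring_scheme" and S :: "('y, 'q) ring_scheme"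
  proof (rule krull_dim_surj)
    show "ring_hom_ring R S h" using that by (intro ring_hom_ringI2) (auto simp: ring_iso_def cring.axioms(1))
    show "h ` carrier R = carrier S" using that by (auto simp: ring_iso_def bij_betw_def)
  qed (rule that)
  show "krull_dim S \<le> krull_dim R" by (rule surj[OF assms])
  show "krull_dim R \<le> krull_dim S"
    by (rule surj[OF ring_iso_set_sym[OF _ assms(1)] assms(3,2)]) (use assms(2) in \<open>simp add: cring.axioms(1)\<close>)
qed

section \<open>Polynomials in several variables\<close>

abbreviation mpoly_monomials :: "nat \<Rightarrow> nat multiset set" where
  "mpoly_monomials n \<equiv> {m. set_mset m \<subseteq> {..<n}}"

lemma carrier_mpoly:
  "f \<in> carrier (mpoly_ring n R) \<longleftrightarrow>
     f \<in> carrier (monoid_ring R UNIV) \<and> (\<forall>m. m \<notin> mpoly_monomials n \<longrightarrow> f m = \<zero>\<^bsub>R\<^esub>)"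
  by (auto simp: mpoly_ring_def monoid_ring_def)

lemma mpoly_ops:
  "monoid.mult (mpoly_ring n R) = monoid.mult (monoid_ring R UNIV)" "one (mpoly_ring n R) = one (monoid_ring R UNIV)"
  "add (mpoly_ring n R) = add (monoid_ring R UNIV)" "zero (mpoly_ring n R) = zero (monoid_ring R UNIV)"
  by (simp_all add: mpoly_ring_def monoid_ring_def)

lemma (in cring) mpoly_cring: "cring (mpoly_ring n R)"
  unfolding mpoly_ring_def by (rule monoid_ring_is_cring) auto

lemma multiset_split_var:
  "m = replicate_mset (count m n) n + filter_mset (\<lambda>x. x \<noteq> n) m"
  by (rule multiset_eqI) auto

context cring
begin

context
  fixes n :: nat
begin

interpretation full_monoid_ring R "monoid_ring R UNIV :: (nat multiset \<Rightarrow> 'a) ring"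
  by unfold_locales auto

private abbreviation "W \<equiv> monoid_ring R UNIV :: (nat multiset \<Rightarrow> 'a) ring"
private abbreviation "B \<equiv> mpoly_ring n R"
private abbreviation "C \<equiv> mpoly_ring (Suc n) R"
private abbreviation "var \<equiv> mono \<one> {#n#}"
private abbreviation "rest \<equiv> filter_mset (\<lambda>x. x \<noteq> n)"

interpretation B: cring B by (rule mpoly_cring)
interpretation C: cring C by (rule mpoly_cring)

lemma var_closed: "var \<in> carrier C"
  using mono_closed[of \<one> "{#n#}"] by (auto simp: carrier_mpoly mono_def)

lemma B_subset_C: "f \<in> carrier B \<Longrightarrow> f \<in> carrier C"
proof -
  assume f: "f \<in> carrier B"
  have "m \<notin> mpoly_monomials n" if "m \<notin> mpoly_monomials (Suc n)" for m using that by auto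
  then show "f \<in> carrier C" using f unfolding carrier_mpoly by blast
qed

lemma var_pow: "var [^]\<^bsub>C\<^esub> (k::nat) = mono \<one> (replicate_mset k n)"
proof (induct k)
  case 0
  show ?case by (auto simp: mpoly_ops W_one mono_def)
next
  case (Suc k)
  then show ?case by (simp add: mpoly_ops mono_mult_mono)
qed

text \<open>The variable \<open>n\<close> does not occur in \<open>g\<close>, so every monomial of
  the product contains it exactly \<open>k\<close> times.\<close>

lemma coeff_mult_var_pow:
  assumes "g \<in> carrier B"
  shows "(g \<otimes>\<^bsub>C\<^esub> var [^]\<^bsub>C\<^esub> (k::nat)) m = (if k = count m n then g (rest m) else \<zero>)"
proof -
  have gW: "g \<in> carrier W" using assms by (simp add: carrier_mpoly)
  have eq: "g \<otimes>\<^bsub>C\<^esub> var [^]\<^bsub>C\<^esub> k = mono \<one> (replicate_mset k n) \<otimes>\<^bsub>W\<^esub> g"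
    unfolding var_pow using gW mult_comm[OF mono_closed gW] by (simp add: mpoly_ops)
  show ?thesis
  proof (cases "k \<le> count m n")
    case True
    define m' where "m' = replicate_mset (count m n - k) n + rest m"
    have m: "m = replicate_mset k n + m'"
      using True unfolding m'_def by (intro multiset_eqI) auto
    have v: "(mono \<one> (replicate_mset k n) \<otimes>\<^bsub>W\<^esub> g) m = g m'"
      unfolding m using mono_mult_shift[OF one_closed gW] coeff_carrier[OF gW] by simp
    show ?thesis
    proof (cases "k = count m n")
      case k: True
      then show ?thesis unfolding eq v by (simp add: m'_def)
    next
      case False
      then have "n \<in># m'" using True by (auto simp: m'_def)
      then have "m' \<notin> mpoly_monomials n" by auto
      then have "g m' = \<zero>" using assms by (simp add: carrier_mpoly)
      then show ?thesis unfolding eq v using False by simp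
    qed
  next
    case False
    then have "m \<notin> range ((+) (replicate_mset k n))" by (auto simp: image_iff)
    then show ?thesis unfolding eq using False by (simp add: mono_mult_outside)
  qed
qed

lemma finsum_mpoly:
  assumes "F \<in> A \<rightarrow> carrier C" shows "(finsum C F A) m = finsum R (\<lambda>k. F k m) A"
  using assms
proof (induct A rule: infinite_finite_induct)
  case (insert x A)
  then have "\<And>k. k \<in> insert x A \<Longrightarrow> F k m \<in> carrier R"
    by (metis Pi_iff carrier_mpoly coeff_carrier)
  then show ?case using insert by (simp add: mpoly_ops W_add Pi_def)
qed (auto simp: mpoly_ops W_zero)

lemma id_hom: "ring_hom_cring B C id"
  by (rule ring_hom_cringI) (auto simp: ring_hom_def mpoly_ops B_subset_C B.is_cring C.is_cring)

interpretation EV: UP_pre_univ_prop B C id "UP B"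
  using id_hom by (intro UP_pre_univ_prop.intro UP_cring.intro B.is_cring)

text \<open>Only the summand with \<open>k = count m n\<close> reaches the monomial
  \<open>m\<close>. This coefficientwise form of the evaluation yields both its injectivity and an
  explicit preimage.\<close>

lemma eval_coeff:
  assumes p: "p \<in> carrier (UP B)"
  shows "eval B C id var p m = coeff (UP B) p (count m n) (rest m)"
proof -
  have pc: "coeff (UP B) p k \<in> carrier B" for k using p by (rule EV.coeff_closed)
  have "eval B C id var p = finsum C (\<lambda>k. coeff (UP B) p k \<otimes>\<^bsub>C\<^esub> var [^]\<^bsub>C\<^esub> k) {..deg B p}"
    using EV.eval_on_carrier[OF p, of C id var] by simp
  moreover have "(\<lambda>k. coeff (UP B) p k \<otimes>\<^bsub>C\<^esub> var [^]\<^bsub>C\<^esub> k) \<in> {..deg B p} \<rightarrow> carrier C"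
    using pc B_subset_C var_closed C.m_closed C.nat_pow_closed by blast
  ultimately have "eval B C id var p m = finsum R (\<lambda>k. (coeff (UP B) p k \<otimes>\<^bsub>C\<^esub> var [^]\<^bsub>C\<^esub> k) m) {..deg B p}"
    using finsum_mpoly by simp
  also have "\<dots> = finsum R (\<lambda>k. if k = count m n then coeff (UP B) p k (rest m) else \<zero>) {..deg B p}"
    using coeff_mult_var_pow[OF pc] by simp
  also have "\<dots> = coeff (UP B) p (count m n) (rest m)"
  proof (cases "count m n \<le> deg B p")
    case True
    then show ?thesis
      using pc by (intro add.finprod_singleton_swap) (auto simp: carrier_mpoly intro: coeff_carrier)
  next
    case False
    then have "coeff (UP B) p (count m n) = \<zero>\<^bsub>B\<^esub>" using EV.deg_aboveD[OF _ p] by simp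
    then have z: "coeff (UP B) p (count m n) (rest m) = \<zero>" by (simp add: mpoly_ops W_zero)
    have "finsum R (\<lambda>k. if k = count m n then coeff (UP B) p k (rest m) else \<zero>) {..deg B p} = \<zero>"
      using False by (intro add.finprod_one_eqI) auto
    then show ?thesis using z by simp
  qed
  finally show ?thesis .
qed

lemma mpoly_Suc_iso: "eval B C id var \<in> ring_iso (UP B) C"
proof -
  have hom: "eval B C id var \<in> ring_hom (UP B) C" by (rule EV.eval_ring_hom[OF var_closed])
  have "inj_on (eval B C id var) (carrier (UP B))"
  proof (rule inj_onI)
    fix p q assume p: "p \<in> carrier (UP B)" and q: "q \<in> carrier (UP B)"
      and eq: "eval B C id var p = eval B C id var q"
    show "p = q"
    proof (rule EV.up_eqI[OF _ p q])
      fix k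
      have pc: "coeff (UP B) p k \<in> carrier B" "coeff (UP B) q k \<in> carrier B"
        using p q by (auto intro: EV.coeff_closed)
      show "coeff (UP B) p k = coeff (UP B) q k"
      proof
        fix m
        show "coeff (UP B) p k m = coeff (UP B) q k m"
        proof (cases "m \<in> mpoly_monomials n")
          case True
          then have nm: "n \<notin># m" by auto
          let ?m = "replicate_mset k n + m"
          have "count ?m n = k" using nm by (simp add: not_in_iff)
          moreover have "rest ?m = m" using nm by (intro multiset_eqI) (auto simp: not_in_iff)
          ultimately show ?thesis using eval_coeff[OF p, of ?m] eval_coeff[OF q, of ?m] eq by simp
        next
          case False
          then show ?thesis using pc by (simp add: carrier_mpoly)
        qed
      qed
    qed
  qed
  moreover have "eval B C id var ` carrier (UP B) = carrier C"
  proof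
    show "eval B C id var ` carrier (UP B) \<subseteq> carrier C" using hom by (auto simp: ring_hom_def)
    show "carrier C \<subseteq> eval B C id var ` carrier (UP B)"
    proof
      fix F assume F: "F \<in> carrier C"
      then have FW: "F \<in> carrier W" and fin: "finite {m. F m \<noteq> \<zero>}" by (auto simp: carrier_mpoly carrier_W)
      \<comment> \<open>The preimage sorts the monomials of \<open>F\<close> by their exponent
        \<open>k\<close> in the last variable. Outside the monomials of \<open>B\<close> it is set
        to zero, because \<open>F\<close> itself does not vanish there when \<open>m\<close>
        contains \<open>n\<close>, so far as its definition tells.\<close>
      define p where "p k m = (if set_mset m \<subseteq> {..<n} then F (replicate_mset k n + m) else \<zero>)" for k m
      have cnt: "count (replicate_mset k n + m) n = k" "rest (replicate_mset k n + m) = m"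
        if "set_mset m \<subseteq> {..<n}" for k m
      proof -
        have nm: "n \<notin># m" using that by auto
        show "count (replicate_mset k n + m) n = k" using nm by (simp add: not_in_iff)
        show "rest (replicate_mset k n + m) = m" using nm by (intro multiset_eqI) (auto simp: not_in_iff)
      qed
      have "p k \<in> carrier B" for k
      proof -
        have "{m. p k m \<noteq> \<zero>} \<subseteq> rest ` {m. F m \<noteq> \<zero>}"
        proof
          fix m assume "m \<in> {m. p k m \<noteq> \<zero>}"
          then have "set_mset m \<subseteq> {..<n}" "F (replicate_mset k n + m) \<noteq> \<zero>" by (auto simp: p_def split: if_splits)
          then show "m \<in> rest ` {m. F m \<noteq> \<zero>}"
            using cnt(2)[of m k] by (intro image_eqI[of _ _ "replicate_mset k n + m"]) auto
        qed
        then have "finite {m. p k m \<noteq> \<zero>}" using fin finite_surj by blast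
        then show ?thesis using coeff_carrier[OF FW] by (auto simp: carrier_mpoly carrier_W p_def)
      qed
      moreover have "\<exists>N. bound \<zero>\<^bsub>B\<^esub> N p"
      proof -
        have "finite ((\<lambda>m. count m n) ` {m. F m \<noteq> \<zero>})" using fin by simp
        then obtain N where N: "\<And>m. F m \<noteq> \<zero> \<Longrightarrow> count m n \<le> N"
          using finite_nat_set_iff_bounded_le[of "(\<lambda>m. count m n) ` {m. F m \<noteq> \<zero>}"] by auto
        have "p k = \<zero>\<^bsub>B\<^esub>" if "N < k" for k
        proof
          fix m show "p k m = \<zero>\<^bsub>B\<^esub> m"
            using N[of "replicate_mset k n + m"] cnt(1)[of m k] that by (auto simp: p_def mpoly_ops W_zero)
        qed
        then show ?thesis by (auto intro!: exI[of _ N] bound.intro)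
      qed
      ultimately have pup: "p \<in> carrier (UP B)" and cp: "\<And>k. coeff (UP B) p k = p k"
        by (auto simp: UP_def up_def)
      have "eval B C id var p = F"
      proof
        fix m
        have "eval B C id var p m = p (count m n) (rest m)" using eval_coeff[OF pup] cp by simp
        also have "\<dots> = F m"
        proof (cases "set_mset m \<subseteq> {..<Suc n}")
          case True
          then have "set_mset (rest m) \<subseteq> {..<n}" by (auto simp: less_Suc_eq)
          then show ?thesis unfolding p_def by (simp add: multiset_split_var[symmetric])
        next
          case False
          then have "\<not> set_mset (rest m) \<subseteq> {..<n}" by (auto simp: less_Suc_eq)
          then show ?thesis unfolding p_def using F False by (simp add: carrier_mpoly)
        qed
        finally show "eval B C id var p m = F m" .
      qed
      then show "F \<in> eval B C id var ` carrier (UP B)" using pup by blast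
    qed
  qed
  ultimately show ?thesis using hom by (auto simp: ring_iso_def bij_betw_def)
qed

end

lemma mpoly_0_iso: "(\<lambda>f. f {#}) \<in> ring_iso (mpoly_ring 0 R) R"
proof -
  interpret full_monoid_ring R "monoid_ring R UNIV :: (nat multiset \<Rightarrow> 'a) ring"
    by unfold_locales auto
  let ?B = "mpoly_ring 0 R"
  have mem: "f \<in> carrier ?B \<longleftrightarrow> (\<exists>c\<in>carrier R. f = mono c {#})" for f
  proof
    assume f: "f \<in> carrier ?B"
    then have "f = mono (f {#}) {#}" by (auto simp: carrier_mpoly mono_def)
    moreover have "f {#} \<in> carrier R" using f by (auto simp: carrier_mpoly intro: coeff_carrier)
    ultimately show "\<exists>c\<in>carrier R. f = mono c {#}" by blast
  next
    assume "\<exists>c\<in>carrier R. f = mono c {#}"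
    then show "f \<in> carrier ?B" using mono_closed by (auto simp: carrier_mpoly mono_def)
  qed
  have "(\<lambda>f. f {#}) \<in> ring_hom ?B R"
  proof (rule ring_hom_memI)
    fix f g assume "f \<in> carrier ?B" "g \<in> carrier ?B"
    then obtain c d where "c \<in> carrier R" "d \<in> carrier R" "f = mono c {#}" "g = mono d {#}" using mem by blast
    then show "(f \<otimes>\<^bsub>?B\<^esub> g) {#} = f {#} \<otimes> g {#}" "(f \<oplus>\<^bsub>?B\<^esub> g) {#} = f {#} \<oplus> g {#}"
      by (simp_all add: mpoly_ops mono_mult_mono W_add, simp_all add: mono_def)
  next
    fix f assume "f \<in> carrier ?B"
    then show "f {#} \<in> carrier R" by (auto simp: mem mono_def)
  qed (simp add: mpoly_ops W_one)
  moreover have "bij_betw (\<lambda>f. f {#}) (carrier ?B) (carrier R)"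
    by (rule bij_betwI[of _ _ _ "\<lambda>c. mono c {#}"]) (auto simp: mem mono_def)
  ultimately show ?thesis by (simp add: ring_iso_def)
qed

end

lemma ring_iso_domain:
  assumes "h \<in> ring_iso R S" "domain R" "cring S" shows "domain S"
proof -
  interpret R: "domain" R by fact
  interpret S: cring S by fact
  have "h \<zero>\<^bsub>R\<^esub> = \<zero>\<^bsub>S\<^esub>"
    using assms(1) ring_hom_zero[of h R S] R.ring_axioms S.ring_axioms by (simp add: ring_iso_def)
  then show ?thesis using R.ring_iso_imp_img_domain[OF assms(1)] by simp
qed

lemma noetherian_cring_iso:
  assumes "h \<in> ring_iso R S" "noetherian_cring R" "cring S" shows "noetherian_cring S"
proof -
  interpret R: noetherian_cring R by fact
  interpret S: cring S by fact
  show ?thesis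
  proof (rule noetherian_cring_surj[OF _ R.noetherian_ring_axioms])
    show "ring_hom_ring R S h" using assms(1)
      by (intro ring_hom_ringI2 R.ring_axioms S.ring_axioms) (simp add: ring_iso_def)
    show "h ` carrier R = carrier S" using assms(1) by (auto simp: ring_iso_def bij_betw_def)
  qed (rule assms(3))
qed

context noetherian_cring
begin

lemma mpoly_noetherian: "noetherian_cring (mpoly_ring n R)"
proof (induct n)
  case 0
  show ?case
    by (rule noetherian_cring_iso[OF ring_iso_set_sym[OF _ mpoly_0_iso] noetherian_cring_axioms mpoly_cring])
      (rule cring.axioms(1)[OF mpoly_cring])
next
  case (Suc n)
  show ?case
    by (rule noetherian_cring_iso[OF mpoly_Suc_iso noetherian_cring.UP_noetherian[OF Suc] mpoly_cring])
qed

text \<open>Being a domain is carried through the induction because \<open>krull_dim_UP\<close> asks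
  for it at each new variable.\<close>

lemma mpoly_krull_dim:
  assumes "domain R"
  shows "domain (mpoly_ring n R) \<and> krull_dim (mpoly_ring n R) = enat n + krull_dim R"
proof (induct n)
  case 0
  have "domain (mpoly_ring 0 R)"
    by (rule ring_iso_domain[OF ring_iso_set_sym[OF _ mpoly_0_iso] assms mpoly_cring])
      (rule cring.axioms(1)[OF mpoly_cring])
  then show ?case using krull_dim_iso[OF mpoly_0_iso mpoly_cring is_cring]
    by (simp add: zero_enat_def[symmetric])
next
  case (Suc n)
  interpret M: noetherian_cring "mpoly_ring n R" by (rule mpoly_noetherian)
  interpret MD: UP_domain "mpoly_ring n R" "UP (mpoly_ring n R)"
    by (intro UP_domain.intro conjunct1[OF Suc])
  have "domain (mpoly_ring (Suc n) R)"
    by (rule ring_iso_domain[OF mpoly_Suc_iso MD.UP_domain mpoly_cring])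
  moreover have "krull_dim (mpoly_ring (Suc n) R) = krull_dim (UP (mpoly_ring n R))"
    by (rule krull_dim_iso[OF mpoly_Suc_iso MD.P.is_cring mpoly_cring, symmetric])
  moreover have "\<dots> = enat (Suc n) + krull_dim R"
    using M.krull_dim_UP[OF conjunct1[OF Suc]] conjunct2[OF Suc]
    by (simp add: one_enat_def add.assoc add.commute[of _ "enat 1"] flip: add.assoc)
  ultimately show ?case by simp
qed

end

section \<open>The symbolic Rees algebra\<close>

theorem noetherian_domain_stably_strong:
  assumes "noetherian_domain S" shows "stably_strong_S_domain S"
proof -
  interpret noetherian_domain S by fact
  interpret NC: noetherian_cring S by (rule is_noetherian_cring)
  show ?thesis unfolding stably_strong_S_domain_def
    using domain_axioms noetherian_cring.noetherian_strong_S_ring[OF NC.mpoly_noetherian] by blast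
qed

text \<open>The dimension formula is \<open>mpoly_krull_dim\<close> for the Noetherian domain
  \<open>localization S P\<close>. What remains is the finite dimension that \<open>Jaffard\<close>
  demands; a Noetherian domain can have infinite dimension, but after localization the number of
  generators of \<open>P\<close> is a bound.\<close>

theorem noetherian_domain_locally_Jaffard:
  assumes "noetherian_domain S" shows "locally_Jaffard S"
proof -
  interpret noetherian_domain S by fact
  interpret NC: noetherian_cring S by (rule is_noetherian_cring)
  have "Jaffard (localization S P)" if P: "primeideal P S" for P
  proof -
    interpret loc: localized_domain S P "localization S P"
      by (intro localized_domain.intro domain_axioms P)
    let ?L = "localization S P"
    interpret L: noetherian_cring ?L by (rule loc.localization_noetherian[OF noetherian_ring_axioms])
    obtain F where F: "F \<subseteq> carrier S" "finite F" "P = Idl\<^bsub>S\<^esub> F"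
      using finetely_gen[OF primeideal.axioms(1)[OF P]] by blast
    have "krull_dim ?L \<le> enat (card F)"
    proof (rule krull_dim_leI)
      fix c n assume c: "prime_chain ?L c n"
      have pr: "primeideal (c i) ?L" if "i \<le> n" for i using c that by (simp add: prime_chain_def)
      define d where "d i = {r \<in> carrier S. loc_frac S P r \<one>\<^bsub>S\<^esub> \<in> c i}" for i
      have d: "prime_chain S d n" unfolding prime_chain_def
      proof (intro conjI allI impI)
        fix i assume "i \<le> n"
        then show "primeideal (d i) S" unfolding d_def
          by (intro loc.frac.primeideal_vimage pr is_cring)
      next
        fix i assume "i < n"
        then show "d i \<subset> d (Suc i)" unfolding d_def
          using c by (intro loc.contraction_strict_mono primeideal.axioms(1) pr) (auto simp: prime_chain_def)
      qed
      have dP: "d n \<subseteq> P" unfolding d_def by (rule loc.contraction_subset[OF pr]) simp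
      show "enat n \<le> enat (card F)"
      \<comment> \<open>The bound by generators is about chains that end at \<open>P\<close>; a
        contracted chain may stop short of \<open>P\<close> and is then prolonged by it.\<close>
      proof (cases "d n = P")
        case True
        then show ?thesis using NC.prime_chain_le_card_generators[OF d F(2,1)] F(3) by simp
      next
        case False
        then have "prime_chain S (d(Suc n := P)) (Suc n)" using dP by (intro prime_chain_snoc d P) auto
        then have "Suc n \<le> card F" by (rule NC.prime_chain_le_card_generators[OF _ F(2,1)]) (simp add: F(3))
        then show ?thesis by simp
      qed
    qed
    then have "krull_dim ?L \<noteq> \<infinity>" by (cases "krull_dim ?L") auto
    then show ?thesis unfolding Jaffard_def
      using loc.localization_domain L.mpoly_krull_dim[OF loc.localization_domain] by blast
  qed
  then show ?thesis unfolding locally_Jaffard_def using domain_axioms by blast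
qed

section \<open>Adjoining elements to a Noetherian subring\<close>

lemma (in ring) subring_finsum_mem:
  assumes "subring H R" "\<And>i. i \<in> A \<Longrightarrow> f i \<in> H" shows "finsum R f A \<in> H"
  using assms(2)
proof (induct A rule: infinite_finite_induct)
  case (insert x A)
  then have "f \<in> A \<rightarrow> carrier R" "f x \<in> carrier R" using subringE(1)[OF assms(1)] by auto
  then show ?case using insert subringE(7)[OF assms(1)] by simp
qed (use subringE(2)[OF assms(1)] in auto)

lemma (in ring) subring_pow_mem:
  assumes "subring H R" "x \<in> H" shows "x [^] (n::nat) \<in> H"
  by (induct n) (use subringE(3,6)[OF assms(1)] assms(2) in auto)

text \<open>\<open>B'\<close> is the image of \<open>B[X]\<close> under evaluation at
  \<open>x\<close>, so Hilbert's basis theorem applies. Its minimality is recorded in order to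
  identify the resulting ring with the Rees algebra.\<close>

lemma (in cring) noetherian_adjoin:
  assumes B: "subring B R" "noetherian_ring (R\<lparr>carrier := B\<rparr>)" and x: "x \<in> carrier R"
  obtains B' where "subring B' R" "noetherian_ring (R\<lparr>carrier := B'\<rparr>)" "B \<subseteq> B'" "x \<in> B'"
    "\<And>H. subring H R \<Longrightarrow> B \<subseteq> H \<Longrightarrow> x \<in> H \<Longrightarrow> B' \<subseteq> H"
proof -
  let ?B = "R\<lparr>carrier := B\<rparr>"
  have Bc: "B \<subseteq> carrier R" by (rule subringE(1)[OF B(1)])
  have "subcring B R" using B(1) by (rule subcringI')
  then have B_cring: "cring ?B" using subcring_iff[OF Bc] by simp
  interpret B: cring ?B by (rule B_cring)
  interpret BN: noetherian_cring ?B by (intro noetherian_cring.intro B(2) B_cring)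
  have "ring_hom_cring ?B R id" using Bc
    by (intro ring_hom_cringI B_cring is_cring) (auto simp: ring_hom_def)
  then interpret EV: UP_pre_univ_prop ?B R id "UP ?B"
    by (intro UP_pre_univ_prop.intro UP_cring.intro B_cring)
  let ?e = "eval ?B R id x"
  define B' where "B' = ?e ` carrier (UP ?B)"
  have hom: "ring_hom_ring (UP ?B) R ?e"
    by (intro ring_hom_ringI2 EV.P.ring_axioms ring_axioms EV.eval_ring_hom x)
  interpret h: ring_hom_ring "UP ?B" R ?e by (rule hom)
  show thesis
  proof (rule that)
    show sub: "subring B' R" unfolding B'_def
      by (rule h.img_is_subring[OF ring.carrier_is_subring[OF EV.P.ring_axioms]])
    show "noetherian_ring (R\<lparr>carrier := B'\<rparr>)"
    proof (rule noetherian_ring_surj)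
      show "noetherian_ring (UP ?B)" using BN.UP_noetherian by (simp add: noetherian_cring_def)
      show "ring_hom_ring (UP ?B) (R\<lparr>carrier := B'\<rparr>) ?e"
        by (rule ring_hom_ringI[OF EV.P.ring_axioms subring_is_ring[OF sub]]) (auto simp: B'_def)
      show "?e ` carrier (UP ?B) = carrier (R\<lparr>carrier := B'\<rparr>)" by (simp add: B'_def)
    qed
    show "B \<subseteq> B'"
    proof
      fix b assume b: "b \<in> B"
      then have "?e (monom (UP ?B) b 0) = b" using EV.eval_const[OF x, of b] by simp
      moreover have "monom (UP ?B) b 0 \<in> carrier (UP ?B)" using b by simp
      ultimately show "b \<in> B'" unfolding B'_def by (metis imageI)
    qed
    have "?e (monom (UP ?B) \<one>\<^bsub>?B\<^esub> 1) = x" by (rule EV.eval_monom1[OF x])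
    moreover have "monom (UP ?B) \<one>\<^bsub>?B\<^esub> 1 \<in> carrier (UP ?B)" by (rule EV.monom_closed[OF B.one_closed])
    ultimately show "x \<in> B'" unfolding B'_def by (metis imageI)
    fix H assume H: "subring H R" "B \<subseteq> H" "x \<in> H"
    show "B' \<subseteq> H"
    proof
      fix y assume "y \<in> B'"
      then obtain f where f: "f \<in> carrier (UP ?B)" "y = ?e f" unfolding B'_def by blast
      have "coeff (UP ?B) f i \<in> B" for i using EV.coeff_closed[OF f(1), of i] by simp
      then show "y \<in> H" unfolding f(2) EV.eval_on_carrier[OF f(1)] using H
        by (intro subring_finsum_mem[OF H(1)] subringE(6)[OF H(1)] subring_pow_mem[OF H(1)]) auto
    qed
  qed
qed

lemma (in cring) noetherian_adjoin_finite:
  assumes "finite F" "F \<subseteq> carrier R" "subring B R" "noetherian_ring (R\<lparr>carrier := B\<rparr>)"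
  shows "\<exists>B'. subring B' R \<and> noetherian_ring (R\<lparr>carrier := B'\<rparr>) \<and> B \<subseteq> B' \<and> F \<subseteq> B' \<and>
    (\<forall>H. subring H R \<longrightarrow> B \<subseteq> H \<longrightarrow> F \<subseteq> H \<longrightarrow> B' \<subseteq> H)"
  using assms(1,2)
proof (induct F)
  case empty
  then show ?case using assms(3,4) by blast
next
  case (insert x F)
  then obtain C where C: "subring C R" "noetherian_ring (R\<lparr>carrier := C\<rparr>)" "B \<subseteq> C" "F \<subseteq> C"
    "\<And>H. subring H R \<Longrightarrow> B \<subseteq> H \<Longrightarrow> F \<subseteq> H \<Longrightarrow> C \<subseteq> H" by auto
  have x: "x \<in> carrier R" using insert.prems by simp
  obtain B' where B': "subring B' R" "noetherian_ring (R\<lparr>carrier := B'\<rparr>)" "C \<subseteq> B'" "x \<in> B'"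
    "\<And>H. subring H R \<Longrightarrow> C \<subseteq> H \<Longrightarrow> x \<in> H \<Longrightarrow> B' \<subseteq> H"
    by (rule noetherian_adjoin[OF C(1,2) x]) blast
  have "B' \<subseteq> H" if "subring H R" "B \<subseteq> H" "insert x F \<subseteq> H" for H
    using B'(5)[OF that(1)] C(5)[OF that(1,2)] that(3) by blast
  then show ?case using B'(1-4) C(3,4) by (intro exI[of _ B']) blast
qed

section \<open>The extended Rees algebra of a maximal ideal\<close>

locale noetherian_domain_maximal = noetherian_domain R + maximalideal p R for R (structure) and p
begin

lemma p_prime: "primeideal p R"
  by (rule maximalideal_prime[OF maximalideal_axioms])

definition pw :: "nat \<Rightarrow> 'a set" where "pw n = p [^]\<^bsub>ideals_set R\<^esub> n"

lemma pw_0: "pw 0 = carrier R" and pw_Suc: "pw (Suc n) = pw n \<cdot> p"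
  by (simp_all add: pw_def nat_pow_def ideals_set_def)

lemma pw_ideal: "ideal (pw n) R"
  by (induct n) (auto simp: pw_0 pw_Suc oneideal intro: ideal_prod_is_ideal is_ideal)

lemma pw_mult: "x \<in> pw m \<Longrightarrow> y \<in> pw n \<Longrightarrow> x \<otimes> y \<in> pw (m + n)"
proof -
  interpret I: comm_monoid "ideals_set R" by (rule ideals_set_is_comm_monoid)
  assume "x \<in> pw m" "y \<in> pw n"
  then have "x \<otimes> y \<in> pw m \<cdot> pw n" by (rule ideal_prod.prod)
  moreover have "pw m \<cdot> pw n = pw (m + n)"
    using I.nat_pow_mult[of p m n] is_ideal by (simp add: pw_def ideals_set_def)
  ultimately show ?thesis by simp
qed

lemma pw_mono: assumes "m \<le> n" shows "pw n \<subseteq> pw m"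
proof (rule lift_Suc_antimono_le[OF _ assms])
  show "pw (Suc k) \<subseteq> pw k" for k using ideal_prod_inter[OF pw_ideal is_ideal, of k] by (simp add: pw_Suc)
qed

lemma pw_1: "x \<in> p \<Longrightarrow> x \<in> pw 1"
  using ideal_prod.prod[of \<one> "pw 0" x p R] Icarr by (simp add: pw_Suc pw_0)

text \<open>Maximality gives \<open>\<one> = s v + r\<close> with \<open>r\<close> in
  \<open>p\<close>. Multiplying this by the relation \<open>\<one> = s u + q\<close> for
  \<open>n\<close> leaves \<open>q r\<close>, an element of \<open>p^(n+1)\<close>, as the only term
  without the factor \<open>s\<close>.\<close>

lemma comaximal:
  assumes s: "s \<in> carrier R" "s \<notin> p"
  shows "\<exists>u\<in>carrier R. \<exists>q\<in>pw n. \<one> = s \<otimes> u \<oplus> q"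
proof -
  have "p <+>\<^bsub>R\<^esub> PIdl s = carrier R"
  proof -
    have id: "ideal (p <+>\<^bsub>R\<^esub> PIdl s) R" by (intro add_ideals is_ideal cgenideal_ideal s(1))
    have "\<zero> \<in> PIdl s" using cgenideal_ideal[OF s(1)] by (simp add: additive_subgroup.zero_closed ideal.axioms(1))
    then have "p \<subseteq> p <+>\<^bsub>R\<^esub> PIdl s" using Icarr by (auto intro!: set_add_memI[of _ p \<zero>])
    moreover have "s \<in> p <+>\<^bsub>R\<^esub> PIdl s"
      using cgenideal_self[OF s(1)] s by (intro set_add_memI[of \<zero> _ s]) auto
    moreover have "p <+>\<^bsub>R\<^esub> PIdl s \<subseteq> carrier R" using ideal.Icarr[OF id] by blast
    ultimately show ?thesis using I_maximal[OF id] s(2) by blast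
  qed
  then have "\<one> \<in> p <+>\<^bsub>R\<^esub> PIdl s" by simp
  then obtain r v where r: "r \<in> p" "v \<in> carrier R" "\<one> = r \<oplus> v \<otimes> s"
    by (auto elim!: set_add_memE simp: cgenideal_def)
  have rc: "r \<in> carrier R" using r Icarr by simp
  have one: "\<one> = s \<otimes> v \<oplus> r" unfolding r(3) using rc r(2) s by (simp add: a_comm m_comm)
  show ?thesis
  proof (induct n)
    case 0
    show ?case using s by (intro bexI[of _ \<zero>] bexI[of _ \<one>]) (auto simp: pw_0)
  next
    case (Suc n)
    then obtain u q where u: "u \<in> carrier R" "q \<in> pw n" "\<one> = s \<otimes> u \<oplus> q" by blast
    have qc: "q \<in> carrier R" using u ideal.Icarr[OF pw_ideal] by blast
    have "\<one> = (s \<otimes> u \<oplus> q) \<otimes> (s \<otimes> v \<oplus> r)" unfolding u(3)[symmetric] one[symmetric] by simp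
    also have "\<dots> = s \<otimes> (u \<otimes> (s \<otimes> v) \<oplus> u \<otimes> r \<oplus> q \<otimes> v) \<oplus> q \<otimes> r"
      using s(1) u(1) r(2) qc rc by (simp add: l_distr r_distr m_ac a_ac)
    finally have "\<one> = s \<otimes> (u \<otimes> (s \<otimes> v) \<oplus> u \<otimes> r \<oplus> q \<otimes> v) \<oplus> q \<otimes> r" .
    moreover have "q \<otimes> r \<in> pw (Suc n)" unfolding pw_Suc using u(2) r(1) by (rule ideal_prod.prod)
    moreover have "u \<otimes> (s \<otimes> v) \<oplus> u \<otimes> r \<oplus> q \<otimes> v \<in> carrier R" using s(1) u(1) r(2) qc rc by simp
    ultimately show ?case by blast
  qed
qed

text \<open>Multiply \<open>\<one> = s u + q\<close> by \<open>a\<close>: both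
  \<open>u (s a)\<close> and \<open>q a\<close> lie in \<open>p^n\<close>.\<close>

lemma pw_saturated:
  assumes "s \<in> carrier R" "s \<notin> p" "a \<in> carrier R" "s \<otimes> a \<in> pw n" shows "a \<in> pw n"
proof -
  interpret pw: ideal "pw n" R by (rule pw_ideal)
  obtain u q where u: "u \<in> carrier R" "q \<in> pw n" "\<one> = s \<otimes> u \<oplus> q" using comaximal[OF assms(1,2)] by blast
  have qc: "q \<in> carrier R" using u pw.Icarr by blast
  have "a = (s \<otimes> u \<oplus> q) \<otimes> a" unfolding u(3)[symmetric] using assms(3) by simp
  also have "\<dots> = u \<otimes> (s \<otimes> a) \<oplus> q \<otimes> a" using assms(1,3) u(1) qc by (simp add: l_distr r_distr m_ac)
  finally have "a = u \<otimes> (s \<otimes> a) \<oplus> q \<otimes> a" .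
  moreover have "u \<otimes> (s \<otimes> a) \<oplus> q \<otimes> a \<in> pw n"
    using u assms by (intro pw.a_closed pw.I_l_closed[OF assms(4)] pw.I_r_closed[OF u(2)])
  ultimately show ?thesis by simp
qed

text \<open>For \<open>n \<ge> 1\<close>, membership in the extension of \<open>p^n\<close> means
  membership in \<open>p^n\<close> after multiplication by some \<open>s\<close> outside
  \<open>p\<close>, and \<open>pw_saturated\<close> removes the factor. For \<open>n \<le> 0\<close>
  the truncation \<open>nat n = 0\<close> gives the whole ring.\<close>

lemma symbolic_power_eq: "symbolic_power R p n = pw (nat n)"
proof (cases "n \<ge> 1")
  case True
  interpret loc: localized_domain R p "localization R p"
    by (intro localized_domain.intro domain_axioms p_prime)
  interpret pw: ideal "pw (nat n)" R by (rule pw_ideal)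
  have sub: "(\<lambda>x. loc_frac R p x \<one>) ` pw (nat n) \<subseteq> carrier (localization R p)"
    using pw.Icarr by auto
  have "loc_frac R p a \<one> \<in> Idl\<^bsub>localization R p\<^esub> ((\<lambda>x. loc_frac R p x \<one>) ` pw (nat n)) \<longleftrightarrow> a \<in> pw (nat n)"
    if a: "a \<in> carrier R" for a
  proof
    assume "loc_frac R p a \<one> \<in> Idl\<^bsub>localization R p\<^esub> ((\<lambda>x. loc_frac R p x \<one>) ` pw (nat n))"
    then obtain s where "s \<in> carrier R - p" "s \<otimes> a \<in> pw (nat n)"
      by (rule loc.fr_mem_extension[OF pw_ideal a])
    then show "a \<in> pw (nat n)" using pw_saturated a by blast
  next
    assume "a \<in> pw (nat n)"
    then show "loc_frac R p a \<one> \<in> Idl\<^bsub>localization R p\<^esub> ((\<lambda>x. loc_frac R p x \<one>) ` pw (nat n))"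
      using loc.L.genideal_self[OF sub] by blast
  qed
  then show ?thesis using True pw.Icarr by (auto simp: symbolic_power_def pw_def)
next
  case False
  then show ?thesis by (simp add: symbolic_power_def pw_0)
qed

sublocale full_monoid_ring R "monoid_ring R UNIV :: (int \<Rightarrow> 'a) ring"
  by unfold_locales auto

abbreviation laurent :: "(int \<Rightarrow> 'a) ring" where "laurent \<equiv> monoid_ring R UNIV"

definition rees :: "(int \<Rightarrow> 'a) set" where
  "rees = {f \<in> carrier laurent. \<forall>n. f n \<in> pw (nat n)}"

lemma symbolic_Rees_eq: "symbolic_Rees_algebra R p = laurent\<lparr>carrier := rees\<rparr>"
  by (simp add: symbolic_Rees_algebra_def laurent_ring_def rees_def symbolic_power_eq)

lemma rees_subring: "subring rees laurent"
proof (rule subringI_coeffs)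
  show "\<one>\<^bsub>laurent\<^esub> \<in> rees"
    using W.one_closed additive_subgroup.zero_closed[OF ideal.axioms(1)[OF pw_ideal]]
    by (auto simp: rees_def W_one pw_0)
  fix f assume f: "f \<in> rees"
  then have fc: "f \<in> carrier laurent" by (simp add: rees_def)
  have "(\<lambda>m. \<ominus> f m) \<in> carrier laurent" using W_minus[OF fc] W.a_inv_closed[OF fc] by simp
  then show "(\<lambda>m. \<ominus> f m) \<in> rees"
    using f additive_subgroup.a_inv_closed[OF ideal.axioms(1)[OF pw_ideal]] by (auto simp: rees_def)
  fix g assume g: "g \<in> rees"
  then have gc: "g \<in> carrier laurent" by (simp add: rees_def)
  have "(\<lambda>m. f m \<oplus> g m) \<in> carrier laurent" using W.a_closed[OF fc gc] by (simp add: W_add)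
  then show "(\<lambda>m. f m \<oplus> g m) \<in> rees"
    using f g additive_subgroup.a_closed[OF ideal.axioms(1)[OF pw_ideal]] by (auto simp: rees_def)
  have "(f \<otimes>\<^bsub>laurent\<^esub> g) n \<in> pw (nat n)" for n
    unfolding W_mult
  proof (rule ideal.finsum_mem[OF pw_ideal])
    fix x assume x: "x \<in> {(i, j). f i \<noteq> \<zero> \<and> g j \<noteq> \<zero> \<and> i + j = n}"
    obtain i j where ij: "x = (i, j)" "i + j = n" using x by auto
    have "f i \<otimes> g j \<in> pw (nat i + nat j)" using f g by (intro pw_mult) (auto simp: rees_def)
    \<comment> \<open>With exponents of opposite sign the inequality can be strict, which is why
      \<open>pw_mono\<close> is needed.\<close>
    moreover have "nat n \<le> nat i + nat j" using ij by auto
    ultimately show "(case x of (i, j) \<Rightarrow> f i \<otimes> g j) \<in> pw (nat n)" using pw_mono ij by auto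
  qed
  then show "f \<otimes>\<^bsub>laurent\<^esub> g \<in> rees" using W.m_closed[OF fc gc] by (simp add: rees_def)
qed (auto simp: rees_def)

lemma W_repr:
  assumes "f \<in> carrier laurent" shows "f = finsum laurent (\<lambda>n. mono (f n) n) {n. f n \<noteq> \<zero>}"
proof
  fix m
  have fc: "f n \<in> carrier R" for n using assms by (rule coeff_carrier)
  have fin: "finite {n. f n \<noteq> \<zero>}" using assms by (simp add: carrier_W)
  have "finsum laurent (\<lambda>n. mono (f n) n) {n. f n \<noteq> \<zero>} m = finsum R (\<lambda>n. mono (f n) n m) {n. f n \<noteq> \<zero>}"
    by (rule finsum_W) (auto intro: mono_closed fc)
  also have "\<dots> = finsum R (\<lambda>n. if m = n then f n else \<zero>) {n. f n \<noteq> \<zero>}" by (simp add: mono_def)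
  also have "\<dots> = f m"
  proof (cases "f m = \<zero>")
    case True
    then have "finsum R (\<lambda>n. if m = n then f n else \<zero>) {n. f n \<noteq> \<zero>} = \<zero>"
      by (intro add.finprod_one_eqI) auto
    then show ?thesis using True by simp
  next
    case False
    then show ?thesis using fin fc by (intro add.finprod_singleton) auto
  qed
  finally show "f m = finsum laurent (\<lambda>n. mono (f n) n) {n. f n \<noteq> \<zero>} m" by simp
qed

text \<open>It suffices to reach the monomials \<open>c t^n\<close>. Those with \<open>n > 0\<close>
  are sums of products of elements of \<open>p t\<close>, and those with \<open>n < 0\<close> come
  from constants and powers of \<open>t^-1\<close>.\<close>

lemma rees_generated:
  assumes B: "subring B laurent" and const: "\<And>a. a \<in> carrier R \<Longrightarrow> mono a 0 \<in> B"
    and G: "p = Idl G" "G \<subseteq> carrier R" "\<And>a. a \<in> G \<Longrightarrow> mono a 1 \<in> B"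
    and tinv: "mono \<one> (-1) \<in> B"
  shows "rees \<subseteq> B"
proof -
  have mult: "mono (a \<otimes> b) (i + j) \<in> B"
    if "a \<in> carrier R" "b \<in> carrier R" "mono a i \<in> B" "mono b j \<in> B" for a b i j
    using subringE(6)[OF B that(3,4)] mono_mult_mono[OF that(1,2)] by simp
  have add: "mono (a \<oplus> b) i \<in> B"
    if "a \<in> carrier R" "b \<in> carrier R" "mono a i \<in> B" "mono b i \<in> B" for a b i
  proof -
    have "mono a i \<oplus>\<^bsub>laurent\<^esub> mono b i = mono (a \<oplus> b) i" by (auto simp: W_add mono_def)
    then show ?thesis using subringE(7)[OF B that(3,4)] by simp
  qed
  have zero: "mono \<zero> i \<in> B" for i
  proof -
    have "mono \<zero> i = \<zero>\<^bsub>laurent\<^esub>" by (auto simp: W_zero mono_def)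
    then show ?thesis using subringE(2)[OF B] by simp
  qed
  \<comment> \<open>The coefficients of degree-one monomials in \<open>B\<close> form an ideal, so
    generators of \<open>p\<close> are enough to put all of \<open>p t\<close> into
    \<open>B\<close>.\<close>
  have "ideal {x \<in> carrier R. mono x 1 \<in> B} R"
  proof (rule idealI_cring)
    fix a x assume "a \<in> {x \<in> carrier R. mono x 1 \<in> B}" "x \<in> carrier R"
    then show "x \<otimes> a \<in> {x \<in> carrier R. mono x 1 \<in> B}" using mult[of x a 0 1] const by simp
  qed (auto intro: add zero)
  then have "p \<subseteq> {x \<in> carrier R. mono x 1 \<in> B}"
    unfolding G(1) using G(2,3) by (intro genideal_minimal) auto
  then have deg1: "mono x 1 \<in> B" if "x \<in> p" for x using that by blast
  have pos: "mono c (int k) \<in> B" if "c \<in> pw k" for c k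
    using that
  proof (induct k arbitrary: c)
    case 0
    then show ?case using const by (simp add: pw_0)
  next
    case (Suc k)
    have pc: "x \<in> pw k \<Longrightarrow> x \<in> carrier R" for x using ideal.Icarr[OF pw_ideal] by blast
    from Suc.prems have "c \<in> pw k \<cdot> p" by (simp only: pw_Suc)
    \<comment> \<open>Induction over the product ideal. The carrier condition is included because
      the case of a sum needs it for both summands.\<close>
    then have "c \<in> carrier R \<and> mono c (int (Suc k)) \<in> B"
    proof induct
      case (prod i j)
      then have "mono (i \<otimes> j) (int k + 1) \<in> B" using pc Icarr Suc.hyps deg1 by (intro mult) auto
      then show ?case using prod pc Icarr by (simp add: add.commute)
    next
      case (sum s1 s2)
      then show ?case using add by auto
    qed
    then show ?case by simp
  qed
  have neg: "mono c (- int k) \<in> B" if c: "c \<in> carrier R" for c k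
  proof (induct k)
    case 0
    then show ?case using const[OF c] by simp
  next
    case (Suc k)
    then have "mono (c \<otimes> \<one>) (- int k + (-1)) \<in> B" using c tinv by (intro mult) auto
    then show ?case using c by (simp add: algebra_simps)
  qed
  have all: "mono c n \<in> B" if "c \<in> pw (nat n)" for c n
  proof (cases "n \<ge> 0")
    case True
    then show ?thesis using pos[OF that] by simp
  next
    case False
    have "c \<in> carrier R" using that ideal.Icarr[OF pw_ideal] by blast
    then show ?thesis using neg[of c "nat (- n)"] False by simp
  qed
  show ?thesis
  proof
    fix f assume f: "f \<in> rees"
    then have "finsum laurent (\<lambda>n. mono (f n) n) {n. f n \<noteq> \<zero>} \<in> B"
      by (intro W.subring_finsum_mem[OF B] all) (simp add: rees_def)
    then show "f \<in> B" using W_repr[of f] f by (simp add: rees_def)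
  qed
qed

lemma const_hom: "ring_hom_ring R laurent (\<lambda>a. mono a 0)"
proof (rule ring_hom_ringI[OF ring_axioms W.ring_axioms])
  fix x y assume "x \<in> carrier R" "y \<in> carrier R"
  then show "mono (x \<otimes> y) 0 = mono x 0 \<otimes>\<^bsub>laurent\<^esub> mono y 0" "mono (x \<oplus> y) 0 = mono x 0 \<oplus>\<^bsub>laurent\<^esub> mono y 0"
    by (simp_all add: mono_mult_mono, auto simp: W_add mono_def)
qed (auto simp: mono_closed, auto simp: W_one mono_def)

text \<open>The constants form a homomorphic image of \<open>R\<close>, hence a Noetherian subring.
  Adjoining \<open>F\<close> gives the least subring containing both; leastness bounds it by
  \<open>rees\<close> from above, and \<open>rees_generated\<close> gives the other
  inclusion.\<close>

lemma rees_noetherian: "noetherian_ring (laurent\<lparr>carrier := rees\<rparr>)"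
proof -
  interpret h: ring_hom_ring R laurent "\<lambda>a. mono a 0" by (rule const_hom)
  define B where "B = (\<lambda>a. mono a 0) ` carrier R"
  have B: "subring B laurent" unfolding B_def by (rule h.img_is_subring[OF carrier_is_subring])
  have BN: "noetherian_ring (laurent\<lparr>carrier := B\<rparr>)"
  proof (rule noetherian_ring_surj[OF _ noetherian_ring_axioms])
    show "ring_hom_ring R (laurent\<lparr>carrier := B\<rparr>) (\<lambda>a. mono a 0)"
      by (rule ring_hom_ringI[OF ring_axioms W.subring_is_ring[OF B]]) (auto simp: B_def)
  qed (simp add: B_def)
  obtain G where G: "G \<subseteq> carrier R" "finite G" "p = Idl G" using finetely_gen[OF is_ideal] by blast
  define F where "F = insert (mono \<one> (-1)) ((\<lambda>a. mono a 1) ` G)"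
  have F: "finite F" "F \<subseteq> carrier laurent" using G by (auto simp: F_def intro: mono_closed)
  obtain B' where B': "subring B' laurent" "noetherian_ring (laurent\<lparr>carrier := B'\<rparr>)" "B \<subseteq> B'" "F \<subseteq> B'"
    "\<And>H. subring H laurent \<Longrightarrow> B \<subseteq> H \<Longrightarrow> F \<subseteq> H \<Longrightarrow> B' \<subseteq> H"
    using W.noetherian_adjoin_finite[OF F B BN] by blast
  have z: "\<zero> \<in> pw n" for n by (rule additive_subgroup.zero_closed[OF ideal.axioms(1)[OF pw_ideal]])
  have mem: "mono a n \<in> rees" if "a \<in> pw (nat n)" for a n
    using that z mono_closed[of a n] ideal.Icarr[OF pw_ideal that] by (auto simp: rees_def mono_def)
  have "B \<subseteq> rees" unfolding B_def by (auto intro: mem simp: pw_0)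
  moreover have "F \<subseteq> rees"
  proof -
    have "G \<subseteq> p" unfolding G(3) by (rule genideal_self[OF G(1)])
    then have "mono a 1 \<in> rees" if "a \<in> G" for a using pw_1[of a] that by (intro mem) auto
    moreover have "mono \<one> (-1) \<in> rees" by (rule mem) (simp add: pw_0)
    ultimately show ?thesis unfolding F_def by blast
  qed
  ultimately have "B' \<subseteq> rees" using B'(5)[OF rees_subring] by blast
  moreover have "rees \<subseteq> B'"
    by (rule rees_generated[OF B'(1) _ G(3,1)]) (use B'(3,4) in \<open>auto simp: B_def F_def\<close>)
  ultimately show ?thesis using B'(2) by simp
qed

theorem symbolic_Rees_noetherian_domain: "noetherian_domain (symbolic_Rees_algebra R p)"
proof -
  interpret W: "domain" laurent using laurent_domain by (simp add: laurent_ring_def)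
  show ?thesis unfolding symbolic_Rees_eq
    by (intro noetherian_domain.intro rees_noetherian W.subring_is_domain rees_subring)
qed

end

theorem theorem3p5:
  fixes A :: "('a, 'b) ring_scheme" and p :: "'a set"
  assumes "noetherian_domain A" and "maximalideal p A"
  shows "stably_strong_S_domain (symbolic_Rees_algebra A p) \<and>
         locally_Jaffard (symbolic_Rees_algebra A p)"
proof -
  interpret noetherian_domain_maximal A p using assms by (rule noetherian_domain_maximal.intro)
  show ?thesis
    using noetherian_domain_stably_strong noetherian_domain_locally_Jaffard symbolic_Rees_noetherian_domain
    by blast
qed

end
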